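(* Let $\epsilon>0$ and let $\gamma:(-\epsilon,\epsilon)\to\mathbb{R}^2$ be a $C^\infty$ curve in the affine plane such that $t=0$ is a $3/2$-cusp, and let $s_A$ be its affine arclength parameter. Then $\tau=(s_A)^{3/5}$ can be taken to be a coordinate of $\gamma$ at $t=0$ (called the $3/5$-arclength parameter), and $f:=(s_A)^2\kappa_A$ is a $C^\infty$-function of $t$ (and of $\tau$) at $t=0$, called the normalized affine curvature function. Moreover, it satisfies $f(0)=4/25$, $\dot f(0)=0$ and $$\lim_{t\to0}\frac{(s_A)^2\kappa_A-4/25}{\tau^2}=\frac1{220}\sqrt[5]{\frac{20}{3}}\;\mu_A,$$ where $\mu_A$ is the affine cuspidal curvature of $\gamma$ at $t=0$. Conversely, for any $C^\infty$-function $f(\tau)$ (defined near $\tau=0$) with $f(0)=4/25$ and $\dot f(0)=0$, there exists a curve in $\mathbb{R}^2$ with a $3/2$-cusp at $\tau=0$ whose normalized affine curvature function is $f(\tau)$ with respect to the $3/5$-arclength parameter $\tau$.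
   Context: For $\mathbf a,\mathbf b\in\mathbb{R}^2$, $[\mathbf a,\mathbf b]=a_1b_2-a_2b_1$. Dots and superscripts $^{(k)}$ denote derivatives with respect to the parameter. A $C^\infty$ curve $\gamma$ has a $3/2$-cusp at $t=0$ if after a suitable coordinate change of the parameter and a local diffeomorphism of $\mathbb{R}^2$ at $\gamma(0)$ it becomes $t\mapsto(t^2,t^3)$; equivalently, $\dot\gamma(0)=0$ and $[\ddot\gamma(0),\gamma^{(3)}(0)]\neq0$. The domain is taken small enough that $[\dot\gamma,\ddot\gamma]\neq0$ for $t\ne0$. The affine arclength is $s_A(t)=\int_0^t\bigl|[\dot\gamma(u),\ddot\gamma(u)]\bigr|^{1/3}du$, and the affine curvature function (for $t\neq0$) is $$\kappa_A=\frac{3[\dot\gamma,\ddot\gamma]\,[\dot\gamma,\gamma^{(4)}]+12[\dot\gamma,\ddot\gamma]\,[\ddot\gamma,\gamma^{(3)}]-5[\dot\gamma,\gamma^{(3)}]^2}{9\,\bigl|[\dot\gamma,\ddot\gamma]\bigr|^{8/3}}.$$ Here $(s_A)^{3/5}$ means $\operatorname{sgn}(s_A)|s_A|^{3/5}$. The affine cuspidal curvature at a $3/2$-cusp $t=0$ is $$\mu_A=\left.\frac{24[\ddot\gamma,\gamma^{(3)}]\,[\ddot\gamma,\gamma^{(5)}]+60[\ddot\gamma,\gamma^{(3)}]\,[\gamma^{(3)},\gamma^{(4)}]-35[\ddot\gamma,\gamma^{(4)}]^2}{\bigl|[\ddot\gamma,\gamma^{(3)}]\bigr|^{12/5}}\right|_{t=0}.$$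 Smoothness at $t=0$ concerns germs at $t=0$, functions being extended across $t=0$. *)

theory Defs
  imports "HOL-Analysis.Analysis"
begin

text \<open>
  Smoothness on an open set \<open>S\<close>: all iterated directional derivatives exist and are continuous
  on \<open>S\<close>. The derivatives are two-sided, so these notions are only meant for open \<open>S\<close>.
\<close>

primrec higher_differentiable_on ::
  "'a::real_normed_vector set \<Rightarrow> ('a \<Rightarrow> 'b::real_normed_vector) \<Rightarrow> nat \<Rightarrow> bool" where
  "higher_differentiable_on S f 0 \<longleftrightarrow> continuous_on S f"
| "higher_differentiable_on S f (Suc n) \<longleftrightarrow>
     (\<forall>x\<in>S. f differentiable (at x)) \<and>
     (\<forall>v. higher_differentiable_on S (\<lambda>x. frechet_derivative f (at x) v) n)"

definition smooth_on ::
  "'a::real_normed_vector set \<Rightarrow> ('a \<Rightarrow> 'b::real_normed_vector) \<Rightarrow> bool" where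
  "smooth_on S f \<longleftrightarrow> (\<forall>n. higher_differentiable_on S f n)"

definition diffeomorphism ::
  "'a::real_normed_vector set \<Rightarrow> 'b::real_normed_vector set \<Rightarrow> ('a \<Rightarrow> 'b) \<Rightarrow> ('b \<Rightarrow> 'a) \<Rightarrow> bool" where
  "diffeomorphism S T f g \<longleftrightarrow>
     open S \<and> open T \<and> homeomorphism S T f g \<and> smooth_on S f \<and> smooth_on T g"

definition cusp_3_2 :: "(real \<Rightarrow> real^2) \<Rightarrow> bool" where
  "cusp_3_2 \<gamma> \<longleftrightarrow>
     (\<exists>U V (\<phi> :: real \<Rightarrow> real) \<phi>' W W' (\<Phi> :: real^2 \<Rightarrow> real^2) \<Phi>'.
        0 \<in> U \<and> \<phi> 0 = 0 \<and> diffeomorphism U V \<phi> \<phi>' \<and>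
        \<gamma> 0 \<in> W \<and> diffeomorphism W W' \<Phi> \<Phi>' \<and>
        (\<forall>u\<in>U. \<gamma> (\<phi> u) \<in> W \<and> \<Phi> (\<gamma> (\<phi> u)) = vector [u^2, u^3]))"

definition bracket :: "real^2 \<Rightarrow> real^2 \<Rightarrow> real" where
  "bracket a b = a$1 * b$2 - a$2 * b$1"

definition nderiv :: "nat \<Rightarrow> (real \<Rightarrow> real^2) \<Rightarrow> real \<Rightarrow> real^2" where
  "nderiv k \<gamma> = ((\<lambda>g t. vector_derivative g (at t)) ^^ k) \<gamma>"

definition dbracket :: "(real \<Rightarrow> real^2) \<Rightarrow> nat \<Rightarrow> nat \<Rightarrow> real \<Rightarrow> real" where
  "dbracket \<gamma> i j t = bracket (nderiv i \<gamma> t) (nderiv j \<gamma> t)"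

text \<open>The interval integral is oriented, so the arclength is negative for \<open>t < 0\<close>.\<close>

definition affine_arclength :: "(real \<Rightarrow> real^2) \<Rightarrow> real \<Rightarrow> real" where
  "affine_arclength \<gamma> t = (LBINT u=ereal 0..ereal t. \<bar>dbracket \<gamma> 1 2 u\<bar> powr (1/3))"

definition affine_curvature :: "(real \<Rightarrow> real^2) \<Rightarrow> real \<Rightarrow> real" where
  "affine_curvature \<gamma> t =
     (3 * dbracket \<gamma> 1 2 t * dbracket \<gamma> 1 4 t + 12 * dbracket \<gamma> 1 2 t * dbracket \<gamma> 2 3 t
        - 5 * (dbracket \<gamma> 1 3 t)^2)
     / (9 * \<bar>dbracket \<gamma> 1 2 t\<bar> powr (8/3))"

definition arclength_3_5 :: "(real \<Rightarrow> real^2) \<Rightarrow> real \<Rightarrow> real" where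
  "arclength_3_5 \<gamma> t = sgn (affine_arclength \<gamma> t) * \<bar>affine_arclength \<gamma> t\<bar> powr (3/5)"

text \<open>
  The formula makes sense only for \<open>t \<noteq> 0\<close>; the value at \<open>0\<close> is the one given by continuous
  extension.
\<close>

definition normalized_affine_curvature :: "(real \<Rightarrow> real^2) \<Rightarrow> real \<Rightarrow> real" where
  "normalized_affine_curvature \<gamma> t =
     (if t = 0 then Lim (at 0) (\<lambda>u. (affine_arclength \<gamma> u)^2 * affine_curvature \<gamma> u)
      else (affine_arclength \<gamma> t)^2 * affine_curvature \<gamma> t)"

definition affine_cuspidal_curvature :: "(real \<Rightarrow> real^2) \<Rightarrow> real" where
  "affine_cuspidal_curvature \<gamma> =
     (24 * dbracket \<gamma> 2 3 0 * dbracket \<gamma> 2 5 0 + 60 * dbracket \<gamma> 2 3 0 * dbracket \<gamma> 3 4 0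
        - 35 * (dbracket \<gamma> 2 4 0)^2)
     / \<bar>dbracket \<gamma> 2 3 0\<bar> powr (12/5)"

text \<open>
  The parameter interval is small enough for the curve to have no inflection point besides
  the cusp.
\<close>

definition cuspidal_curve :: "real \<Rightarrow> (real \<Rightarrow> real^2) \<Rightarrow> bool" where
  "cuspidal_curve \<epsilon> \<gamma> \<longleftrightarrow>
     \<epsilon> > 0 \<and> smooth_on {-\<epsilon><..<\<epsilon>} \<gamma> \<and> cusp_3_2 \<gamma> \<and>
     (\<forall>t\<in>{-\<epsilon><..<\<epsilon>}. t \<noteq> 0 \<longrightarrow> dbracket \<gamma> 1 2 t \<noteq> 0)"

end

theory Submission
  imports Defs
begin

text \<open>
  Everything reduces to statements about smooth functions of one variable. At a 3/2-cusp
  \<open>\<gamma>'(0) = 0\<close> and \<open>[\<gamma>'', \<gamma>'''](0) \<noteq> 0\<close>, hence \<open>[\<gamma>', \<gamma>''] = t\<^sup>2 p\<close> with a smooth \<open>p\<close> that has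
  no zero. Put \<open>q = \<bar>p\<bar> powr (1/3)\<close>. The arclength is the primitive of \<open>\<bar>t\<bar>\<close> to the power
  \<open>2/3\<close> times \<open>q\<close>, which by homogeneity is \<open>t\<close> times \<open>\<bar>t\<bar>\<close> to the power \<open>2/3\<close> times \<open>r(t)\<close>, where
  \<open>r\<close> is a weighted mean of \<open>q\<close> over the segment from \<open>0\<close> to \<open>t\<close> and therefore smooth and
  positive. So the \<open>3/5\<close>-arclength is \<open>t\<close> times a positive smooth function, a coordinate. The
  numerator of the affine curvature is \<open>t\<^sup>2 M\<close> with \<open>M\<close> smooth, the powers of \<open>\<bar>t\<bar>\<close> in
  \<open>s_A\<^sup>2 \<kappa>_A\<close> cancel, and what remains is \<open>f = r\<^sup>2 M / (9 q\<^sup>8)\<close>. Comparing Taylor coefficients up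
  to order two in \<open>f \<cdot> 9 q\<^sup>8 = r\<^sup>2 M\<close> gives the values at the cusp
  (\<open>normalized_curvature_expansion\<close>, \<open>normalized_curvature_jet_algebra\<close>).

  For the converse write \<open>\<gamma>' = \<tau> w\<close>. The condition that \<open>\<tau>\<close> be the \<open>3/5\<close>-arclength says that the
  Wronskian \<open>[w, w']\<close> is the constant \<open>c = 125/27\<close>, and the condition on the curvature becomes
  \<open>w'' = - h w\<close> with \<open>h = (25/9) (f - 4/25) / \<tau>\<^sup>2\<close>. This \<open>h\<close> is smooth exactly because \<open>f(0) = 4/25\<close>
  and \<open>f'(0) = 0\<close>, so the singular problem for \<open>\<gamma>\<close> is a regular linear equation for \<open>w\<close>; two
  solutions, found as a series of iterated integrals (\<open>linear_ode_solution\<close>), are the coordinates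
  of \<open>w\<close> (\<open>prescribed_normalized_curvature\<close>).

  Since cusps are defined by their normal form \<open>(u\<^sup>2, u\<^sup>3)\<close>, both directions need the criterion in
  terms of derivatives. One implication is a computation (\<open>cusp_3_2_imp_derivatives\<close>). For the
  other, affine coordinates and a change of the parameter bring the curve to
  \<open>(u\<^sup>2, u\<^sup>3 B(u))\<close>; if \<open>B(u) = P(u\<^sup>2) + u Q(u\<^sup>2)\<close> with smooth \<open>P\<close> and \<open>Q\<close>, the local diffeomorphism
  \<open>(x, y) \<mapsto> (x, (y - x\<^sup>2 Q(x)) / P(x))\<close> straightens it (\<open>derivatives_imp_cusp_3_2\<close>). The
  decomposition of \<open>B\<close> is Whitney's theorem on even functions (\<open>smooth_on_split_square\<close>), proved
  with Borel's lemma: smooth functions with the right Taylor series exist, and the error is flat.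
\<close>

section \<open>Calculus of smooth maps\<close>

lemma higher_differentiable_on_cong:
  assumes "open S" "\<And>x. x \<in> S \<Longrightarrow> f x = g x" "higher_differentiable_on S f n"
  shows "higher_differentiable_on S g n"
  using assms(2,3)
proof (induction n arbitrary: f g)
  case 0
  then show ?case by (metis continuous_on_cong higher_differentiable_on.simps(1))
next
  case (Suc n)
  have d: "(g has_derivative frechet_derivative f (at x)) (at x)" if "x \<in> S" for x
  proof -
    have "(f has_derivative frechet_derivative f (at x)) (at x)"
      using Suc.prems(2) that by (simp add: frechet_derivative_works)
    then show ?thesis
      by (rule has_derivative_transform_within_open[OF _ assms(1) that]) (use Suc.prems(1) in auto)
  qed
  have "frechet_derivative g (at x) = frechet_derivative f (at x)" if "x \<in> S" for x
    by (rule frechet_derivative_at[OF d[OF that], symmetric])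
  then have "higher_differentiable_on S (\<lambda>x. frechet_derivative g (at x) v) n" for v
    using Suc.prems(2) by - (rule Suc.IH[of "\<lambda>x. frechet_derivative f (at x) v"], simp_all)
  then show ?case using d by (auto simp: differentiable_def)
qed

lemma higher_differentiable_on_SucI:
  assumes "open S" "\<And>x. x \<in> S \<Longrightarrow> (f has_derivative f' x) (at x)"
    and "\<And>v. higher_differentiable_on S (\<lambda>x. f' x v) n"
  shows "higher_differentiable_on S f (Suc n)"
proof -
  have "frechet_derivative f (at x) = f' x" if "x \<in> S" for x
    by (rule frechet_derivative_at[OF assms(2)[OF that], symmetric])
  then have "higher_differentiable_on S (\<lambda>x. frechet_derivative f (at x) v) n" for v
    by (intro higher_differentiable_on_cong[OF assms(1) _ assms(3)[of v]]) simp
  then show ?thesis using assms(2) by (auto simp: differentiable_def)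
qed

lemma higher_differentiable_on_has_derivative:
  assumes "higher_differentiable_on S f (Suc n)" "x \<in> S"
  shows "(f has_derivative frechet_derivative f (at x)) (at x)"
  using assms by (simp add: frechet_derivative_works)

lemma higher_differentiable_on_SucD:
  "higher_differentiable_on S f (Suc n) \<Longrightarrow> higher_differentiable_on S f n"
proof (induction n arbitrary: f)
  case 0
  then show ?case
    by (auto intro!: continuous_at_imp_continuous_on differentiable_imp_continuous_within)
next
  case (Suc n)
  then show ?case by auto
qed

lemma higher_differentiable_on_subset:
  "higher_differentiable_on S f n \<Longrightarrow> T \<subseteq> S \<Longrightarrow> higher_differentiable_on T f n"
  by (induction n arbitrary: f) (auto intro: continuous_on_subset)

lemma higher_differentiable_on_const: "open S \<Longrightarrow> higher_differentiable_on S (\<lambda>x. c) n"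
proof (induction n arbitrary: c)
  case (Suc n)
  show ?case
    by (rule higher_differentiable_on_SucI[OF Suc.prems, where f' = "\<lambda>_ _. 0"])
      (use Suc in auto)
qed auto

lemma higher_differentiable_on_bounded_linear:
  assumes "open S" "bounded_linear L" "higher_differentiable_on S f n"
  shows "higher_differentiable_on S (\<lambda>x. L (f x)) n"
  using assms(3)
proof (induction n arbitrary: f)
  case 0
  then show ?case using assms(2) by (auto intro: bounded_linear.continuous_on)
next
  case (Suc n)
  show ?case
    by (rule higher_differentiable_on_SucI[OF assms(1)])
      (use Suc in \<open>auto intro!: bounded_linear.has_derivative[OF assms(2)]
          simp: frechet_derivative_works\<close>)
qed

lemma higher_differentiable_on_id: "open S \<Longrightarrow> higher_differentiable_on S (\<lambda>x. x) n"
proof (cases n)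
  case (Suc m)
  assume "open S"
  then show ?thesis unfolding Suc
    by (auto intro!: higher_differentiable_on_SucI[where f' = "\<lambda>_ v. v"]
        higher_differentiable_on_const)
qed auto

lemma higher_differentiable_on_add:
  assumes "open S" "higher_differentiable_on S f n" "higher_differentiable_on S g n"
  shows "higher_differentiable_on S (\<lambda>x. f x + g x) n"
  using assms(2,3)
proof (induction n arbitrary: f g)
  case 0
  then show ?case by (auto intro: continuous_on_add)
next
  case (Suc n)
  show ?case
    by (rule higher_differentiable_on_SucI[OF assms(1)])
      (use Suc in \<open>auto intro!: has_derivative_add simp: frechet_derivative_works\<close>)
qed

lemma higher_differentiable_on_bilinear:
  assumes "open S" "bounded_bilinear B"
    and "higher_differentiable_on S f n" "higher_differentiable_on S g n"
  shows "higher_differentiable_on S (\<lambda>x. B (f x) (g x)) n"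
  using assms(3,4)
proof (induction n arbitrary: f g)
  case 0
  then show ?case using bounded_bilinear.continuous_on[OF assms(2)] by auto
next
  case (Suc n)
  note n = Suc.prems[THEN higher_differentiable_on_SucD]
  show ?case
  proof (rule higher_differentiable_on_SucI[OF assms(1)])
    show "((\<lambda>x. B (f x) (g x)) has_derivative
        (\<lambda>v. B (f x) (frechet_derivative g (at x) v) + B (frechet_derivative f (at x) v) (g x))) (at x)"
      if "x \<in> S" for x
      by (rule bounded_bilinear.FDERIV[OF assms(2)])
        (use higher_differentiable_on_has_derivative Suc.prems that in blast)+
    show "higher_differentiable_on S
        (\<lambda>x. B (f x) (frechet_derivative g (at x) v) + B (frechet_derivative f (at x) v) (g x)) n" for v
      by (intro higher_differentiable_on_add[OF assms(1)] Suc.IH) (use n Suc.prems in auto)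
  qed
qed

lemma higher_differentiable_on_sum:
  assumes "open S" "\<And>i. i \<in> I \<Longrightarrow> higher_differentiable_on S (f i) n"
  shows "higher_differentiable_on S (\<lambda>x. \<Sum>i\<in>I. f i x) n"
  using assms(2)
  by (induction I rule: infinite_finite_induct)
    (auto intro!: higher_differentiable_on_const higher_differentiable_on_add assms(1))

text \<open>
  The derivative of \<open>g \<circ> f\<close> in direction \<open>v\<close> is a sum over the basis of products of a component of
  the derivative of \<open>f\<close> with a partial derivative of \<open>g\<close> along \<open>f\<close>. The partial derivatives are
  again maps on \<open>T\<close> of one order less, so the induction runs over \<open>g\<close> with \<open>f\<close> fixed. A Euclidean
  middle space is what turns the derivative of \<open>g\<close> into finitely many such maps.
\<close>

lemma higher_differentiable_on_compose:
  fixes f :: "'a::real_normed_vector \<Rightarrow> 'b::euclidean_space"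
    and g :: "'b \<Rightarrow> 'c::real_normed_vector"
  assumes "open S" "open T" "f ` S \<subseteq> T"
    and "higher_differentiable_on S f n" "higher_differentiable_on T g n"
  shows "higher_differentiable_on S (\<lambda>x. g (f x)) n"
  using assms(4,5)
proof (induction n arbitrary: g)
  case 0
  then show ?case using assms(3) by (auto intro: continuous_on_compose2)
next
  case (Suc n)
  note f = higher_differentiable_on_has_derivative[OF Suc.prems(1)]
  note g = higher_differentiable_on_has_derivative[OF Suc.prems(2)]
  show ?case
  proof (rule higher_differentiable_on_SucI[OF assms(1)])
    fix x assume x: "x \<in> S"
    then have y: "f x \<in> T" using assms(3) by auto
    have lin: "linear (frechet_derivative g (at (f x)))"
      using g[OF y] has_derivative_linear by blast
    have "((\<lambda>x. g (f x)) has_derivative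
        (\<lambda>v. frechet_derivative g (at (f x)) (frechet_derivative f (at x) v))) (at x)"
      using diff_chain_at[OF f[OF x] g[OF y]] by (simp add: o_def)
    also have "(\<lambda>v. frechet_derivative g (at (f x)) (frechet_derivative f (at x) v)) =
      (\<lambda>v. \<Sum>i\<in>Basis. (frechet_derivative f (at x) v \<bullet> i) *\<^sub>R frechet_derivative g (at (f x)) i)"
    proof
      fix v
      have "frechet_derivative g (at (f x)) (frechet_derivative f (at x) v)
        = frechet_derivative g (at (f x)) (\<Sum>i\<in>Basis. (frechet_derivative f (at x) v \<bullet> i) *\<^sub>R i)"
        by (simp add: euclidean_representation)
      also have "\<dots> = (\<Sum>i\<in>Basis. (frechet_derivative f (at x) v \<bullet> i) *\<^sub>R frechet_derivative g (at (f x)) i)"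
        by (simp add: linear_sum[OF lin] linear_scale[OF lin])
      finally show "frechet_derivative g (at (f x)) (frechet_derivative f (at x) v) = \<dots>" .
    qed
    finally show "((\<lambda>x. g (f x)) has_derivative \<dots>) (at x)" .
  next
    fix v
    show "higher_differentiable_on S (\<lambda>x. \<Sum>i\<in>Basis. (frechet_derivative f (at x) v \<bullet> i) *\<^sub>R
        frechet_derivative g (at (f x)) i) n"
      by (intro higher_differentiable_on_sum[OF assms(1)]
          higher_differentiable_on_bilinear[OF assms(1) bounded_bilinear_scaleR]
          higher_differentiable_on_bounded_linear[OF assms(1) bounded_linear_inner_left] Suc.IH)
        (use Suc.prems higher_differentiable_on_SucD[OF Suc.prems(1)] in auto)
  qed
qed

lemma smooth_on_cong:
  assumes "open S" "\<And>x. x \<in> S \<Longrightarrow> f x = g x" "smooth_on S f"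
  shows "smooth_on S g"
  using higher_differentiable_on_cong[OF assms(1,2)] assms(3) by (auto simp: smooth_on_def)

lemma smooth_on_subset: "smooth_on S f \<Longrightarrow> T \<subseteq> S \<Longrightarrow> smooth_on T f"
  by (auto simp: smooth_on_def intro: higher_differentiable_on_subset)

lemma smooth_on_continuous_on: "smooth_on S f \<Longrightarrow> continuous_on S f"
  by (metis smooth_on_def higher_differentiable_on.simps(1))

lemma smooth_on_const: "open S \<Longrightarrow> smooth_on S (\<lambda>x. c)"
  by (simp add: smooth_on_def higher_differentiable_on_const)

lemma smooth_on_id: "open S \<Longrightarrow> smooth_on S (\<lambda>x. x)"
  by (simp add: smooth_on_def higher_differentiable_on_id)

lemma smooth_on_bounded_linear:
  "open S \<Longrightarrow> bounded_linear L \<Longrightarrow> smooth_on S f \<Longrightarrow> smooth_on S (\<lambda>x. L (f x))"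
  by (simp add: smooth_on_def higher_differentiable_on_bounded_linear)

lemma smooth_on_add:
  "open S \<Longrightarrow> smooth_on S f \<Longrightarrow> smooth_on S g \<Longrightarrow> smooth_on S (\<lambda>x. f x + g x)"
  by (simp add: smooth_on_def higher_differentiable_on_add)

lemma smooth_on_minus: "open S \<Longrightarrow> smooth_on S f \<Longrightarrow> smooth_on S (\<lambda>x. - f x)"
  by (intro smooth_on_bounded_linear[of S uminus f] bounded_linear_minus bounded_linear_ident)

lemma smooth_on_diff:
  "open S \<Longrightarrow> smooth_on S f \<Longrightarrow> smooth_on S g \<Longrightarrow> smooth_on S (\<lambda>x. f x - g x)"
  using smooth_on_add[of S f "\<lambda>x. - g x"] smooth_on_minus[of S g] by simp

lemma smooth_on_scaleR:
  "open S \<Longrightarrow> smooth_on S f \<Longrightarrow> smooth_on S g \<Longrightarrow> smooth_on S (\<lambda>x. f x *\<^sub>R g x)"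
  by (simp add: smooth_on_def higher_differentiable_on_bilinear bounded_bilinear_scaleR)

lemma smooth_on_mult:
  fixes f g :: "'a::real_normed_vector \<Rightarrow> real"
  shows "open S \<Longrightarrow> smooth_on S f \<Longrightarrow> smooth_on S g \<Longrightarrow> smooth_on S (\<lambda>x. f x * g x)"
  by (simp add: smooth_on_def higher_differentiable_on_bilinear bounded_bilinear_mult)

lemma smooth_on_power:
  fixes f :: "'a::real_normed_vector \<Rightarrow> real"
  shows "open S \<Longrightarrow> smooth_on S f \<Longrightarrow> smooth_on S (\<lambda>x. f x ^ n)"
  by (induction n) (simp_all add: smooth_on_const smooth_on_mult)

lemma smooth_on_compose:
  fixes f :: "'a::real_normed_vector \<Rightarrow> 'b::euclidean_space"
  shows "open S \<Longrightarrow> open T \<Longrightarrow> smooth_on S f \<Longrightarrow> smooth_on T g \<Longrightarrow> f ` S \<subseteq> T \<Longrightarrow>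
    smooth_on S (\<lambda>x. g (f x))"
  by (simp add: smooth_on_def higher_differentiable_on_compose)

lemmas smooth_intros = smooth_on_const smooth_on_id smooth_on_add smooth_on_minus smooth_on_diff
  smooth_on_mult smooth_on_power

section \<open>Smooth functions of one variable\<close>

lemma higher_differentiable_on_SucI_real:
  fixes f :: "real \<Rightarrow> 'a::real_normed_vector"
  assumes "open S" "\<And>t. t \<in> S \<Longrightarrow> (f has_vector_derivative g t) (at t)"
    and "higher_differentiable_on S g n"
  shows "higher_differentiable_on S f (Suc n)"
  using assms(1)
proof (rule higher_differentiable_on_SucI)
  show "(f has_derivative (\<lambda>v. v *\<^sub>R g t)) (at t)" if "t \<in> S" for t
    using assms(2)[OF that] by (simp add: has_vector_derivative_def)
  show "higher_differentiable_on S (\<lambda>t. v *\<^sub>R g t) n" for v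
    by (rule higher_differentiable_on_bounded_linear[OF assms(1) bounded_linear_scaleR_right assms(3)])
qed

text \<open>
  Smoothness as a greatest fixed point: a class of functions that is closed under taking
  derivatives consists of smooth functions. For explicit families, such as powers or
  parametrised integrals, this replaces a formula for the \<open>n\<close>-th derivative.
\<close>

lemma smooth_on_coinduct:
  fixes f :: "real \<Rightarrow> 'a::real_normed_vector"
  assumes "open S" "f \<in> X"
    and step: "\<And>f. f \<in> X \<Longrightarrow> \<exists>g\<in>X. \<forall>t\<in>S. (f has_vector_derivative g t) (at t)"
  shows "smooth_on S f"
proof -
  have "higher_differentiable_on S f n" if "f \<in> X" for f n
    using that
  proof (induction n arbitrary: f)
    case 0
    then obtain g where "\<forall>t\<in>S. (f has_vector_derivative g t) (at t)" using step by blast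
    then show ?case
      by (auto intro!: continuous_at_imp_continuous_on has_vector_derivative_continuous)
  next
    case (Suc n)
    then obtain g where "g \<in> X" "\<forall>t\<in>S. (f has_vector_derivative g t) (at t)" using step by blast
    then show ?case using Suc.IH by (intro higher_differentiable_on_SucI_real[OF assms(1)]) auto
  qed
  then show ?thesis using assms(2) by (simp add: smooth_on_def)
qed

lemma smooth_on_has_vector_derivative:
  fixes f :: "real \<Rightarrow> 'a::real_normed_vector"
  assumes "smooth_on S f" "t \<in> S"
  shows "(f has_vector_derivative vector_derivative f (at t)) (at t)"
proof -
  have "higher_differentiable_on S f (Suc 0)" using assms(1) by (simp only: smooth_on_def)
  then show ?thesis using assms(2) by (simp add: vector_derivative_works)
qed

lemma smooth_on_vector_derivative:
  fixes f :: "real \<Rightarrow> 'a::real_normed_vector"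
  assumes "open S" "smooth_on S f"
  shows "smooth_on S (\<lambda>t. vector_derivative f (at t))"
proof -
  have *: "frechet_derivative f (at t) 1 = vector_derivative f (at t)" if "t \<in> S" for t
    using smooth_on_has_vector_derivative[OF assms(2) that]
    by (metis frechet_derivative_at has_vector_derivative_def scaleR_one)
  have "higher_differentiable_on S (\<lambda>t. vector_derivative f (at t)) n" for n
  proof -
    have "higher_differentiable_on S f (Suc n)" using assms(2) by (simp only: smooth_on_def)
    then have "higher_differentiable_on S (\<lambda>t. frechet_derivative f (at t) 1) n" by simp
    then show ?thesis by (rule higher_differentiable_on_cong[OF assms(1), rotated]) (simp add: *)
  qed
  then show ?thesis by (simp add: smooth_on_def)
qed

lemma smooth_on_derivativeE:
  fixes f :: "real \<Rightarrow> 'a::real_normed_vector"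
  assumes "open S" "smooth_on S f"
  obtains f' where "smooth_on S f'" "\<And>t. t \<in> S \<Longrightarrow> (f has_vector_derivative f' t) (at t)"
  using smooth_on_has_vector_derivative[OF assms(2)] smooth_on_vector_derivative[OF assms] by blast

lemma smooth_on_antiderivative:
  fixes f :: "real \<Rightarrow> 'a::real_normed_vector"
  assumes "open S" "\<And>t. t \<in> S \<Longrightarrow> (f has_vector_derivative g t) (at t)" "smooth_on S g"
  shows "smooth_on S f"
proof -
  have "higher_differentiable_on S f (Suc n)" for n
    using assms by (intro higher_differentiable_on_SucI_real) (auto simp: smooth_on_def)
  then show ?thesis unfolding smooth_on_def using higher_differentiable_on_SucD by blast
qed

lemma smooth_on_powr: "smooth_on {0<..} (\<lambda>x::real. x powr a)"
proof (rule smooth_on_coinduct[where X = "range (\<lambda>(c, b) x. c * x powr b)"])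
  show "(\<lambda>x. x powr a) \<in> range (\<lambda>(c, b) x. c * x powr b)"
    by (rule image_eqI[of _ _ "(1, a)"]) auto
next
  fix f :: "real \<Rightarrow> real" assume "f \<in> range (\<lambda>(c, b) x. c * x powr b)"
  then obtain c b where f: "f = (\<lambda>x. c * x powr b)" by auto
  have "(\<lambda>x. (c * b) * x powr (b - 1)) \<in> range (\<lambda>(c, b) x. c * x powr b)"
    by (rule image_eqI[of _ _ "(c * b, b - 1)"]) auto
  moreover have "(f has_vector_derivative (c * b) * x powr (b - 1)) (at x)" if "x > 0" for x
    unfolding f has_real_derivative_iff_has_vector_derivative[symmetric]
    using that by (auto intro!: derivative_eq_intros)
  ultimately show "\<exists>g\<in>range (\<lambda>(c, b) x. c * x powr b).
      \<forall>x\<in>{0<..}. (f has_vector_derivative g x) (at x)"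
    by (metis (no_types, lifting) greaterThan_iff)
qed auto

lemma smooth_on_inverse: "smooth_on (- {0}) (\<lambda>x::real. inverse x)"
proof (rule smooth_on_coinduct[where X = "range (\<lambda>(c, n) x. c * inverse x ^ n)"])
  show "(\<lambda>x. inverse x) \<in> range (\<lambda>(c, n) x. c * inverse (x::real) ^ n)"
    by (rule image_eqI[of _ _ "(1, 1)"]) auto
next
  fix f :: "real \<Rightarrow> real" assume "f \<in> range (\<lambda>(c, n) x. c * inverse x ^ n)"
  then obtain c n where f: "f = (\<lambda>x. c * inverse x ^ n)" by auto
  have "(\<lambda>x. (- c * n) * inverse x ^ (Suc n)) \<in> range (\<lambda>(c, n) x. c * inverse x ^ n)"
    by (rule image_eqI[of _ _ "(- c * n, Suc n)"]) auto
  moreover have "(f has_vector_derivative (- c * n) * inverse x ^ (Suc n)) (at x)" if "x \<noteq> 0" for x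
  proof (cases n)
    case (Suc m)
    then show ?thesis
      unfolding f has_real_derivative_iff_has_vector_derivative[symmetric] Suc
      using DERIV_cmult[OF DERIV_power[OF DERIV_inverse[OF that]], of c "Suc m"]
      by (simp add: algebra_simps)
  qed (simp add: f)
  ultimately show "\<exists>g\<in>range (\<lambda>(c, n) x. c * inverse x ^ n).
      \<forall>x\<in>- {0}. (f has_vector_derivative g x) (at x)"
    by (metis (no_types, lifting) ComplD singletonI)
qed auto

lemma smooth_on_divide:
  fixes f g :: "'a::real_normed_vector \<Rightarrow> real"
  assumes "open S" "smooth_on S f" "smooth_on S g" "\<And>x. x \<in> S \<Longrightarrow> g x \<noteq> 0"
  shows "smooth_on S (\<lambda>x. f x / g x)"
  unfolding divide_inverse
  by (intro smooth_on_mult smooth_on_compose[of S "- {0}" g inverse] smooth_on_inverse assms)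
    (use assms in auto)

lemma smooth_on_powr_compose:
  fixes f :: "'a::real_normed_vector \<Rightarrow> real"
  assumes "open S" "smooth_on S f" "\<And>x. x \<in> S \<Longrightarrow> f x > 0"
  shows "smooth_on S (\<lambda>x. f x powr a)"
  by (rule smooth_on_compose[of S "{0<..}" f "\<lambda>x. x powr a"]) (use assms smooth_on_powr in auto)

section \<open>Weighted means along rays\<close>

lemma mult_mem_symmetric_interval:
  fixes e t v :: real
  assumes "t \<in> {-e<..<e}" "v \<in> {0..1}"
  shows "t * v \<in> {-e<..<e}"
proof -
  have "\<bar>t * v\<bar> \<le> \<bar>t\<bar>" using assms(2) by (simp add: abs_mult mult_left_le)
  then show ?thesis using assms(1) by auto
qed

lemma DERIV_abs_nonzero:
  assumes "(t::real) \<noteq> 0"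
  shows "((\<lambda>t. \<bar>t\<bar>) has_field_derivative sgn t) (at t)"
proof (cases "t > 0")
  case True
  then have "((\<lambda>t. \<bar>t\<bar>) has_field_derivative 1) (at t)"
    using has_field_derivative_transform_within_open[OF DERIV_ident, of "{0<..}" t abs] by simp
  then show ?thesis using True by simp
next
  case False
  then have "((\<lambda>t. \<bar>t\<bar>) has_field_derivative -1) (at t)" using assms
    using has_field_derivative_transform_within_open[OF DERIV_minus[OF DERIV_ident], of "{..<0}" t abs]
    by simp
  then show ?thesis using False assms by simp
qed

text \<open>
  At \<open>t = 0\<close> the absolute value is not differentiable, but the condition \<open>a > 1\<close> makes the
  difference quotient tend to \<open>0\<close>.
\<close>

lemma DERIV_signed_powr:
  fixes a t :: real
  assumes a: "a > 1"
  shows "((\<lambda>t. t * \<bar>t\<bar> powr (a - 1)) has_field_derivative a * \<bar>t\<bar> powr (a - 1)) (at t)"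
proof (cases "t = 0")
  case True
  have "((\<lambda>x::real. \<bar>x\<bar> powr (a - 1)) \<longlongrightarrow> \<bar>0\<bar> powr (a - 1)) (at 0)"
    using a by (intro tendsto_powr' tendsto_rabs) auto
  then have "((\<lambda>x::real. \<bar>x\<bar> powr (a - 1)) \<longlongrightarrow> 0) (at 0)" using a by simp
  then have "((\<lambda>x::real. (x * \<bar>x\<bar> powr (a - 1)) / x) \<longlongrightarrow> 0) (at 0)"
    by (rule Lim_transform_eventually) (auto simp: eventually_at_filter)
  then show ?thesis using True a by (simp add: has_field_derivative_iff)
next
  case False
  have "((\<lambda>t. t * \<bar>t\<bar> powr (a - 1)) has_field_derivative
     \<bar>t\<bar> powr (a - 1) + t * ((a - 1) * \<bar>t\<bar> powr (a - 1 - 1) * sgn t)) (at t)"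
    using DERIV_mult[OF DERIV_ident DERIV_fun_powr[OF DERIV_abs_nonzero[OF False], of "a - 1"]] False
    by (simp add: algebra_simps)
  moreover have "t * ((a - 1) * \<bar>t\<bar> powr (a - 1 - 1) * sgn t) = (a - 1) * \<bar>t\<bar> powr (a - 1)"
  proof -
    have "t * ((a - 1) * \<bar>t\<bar> powr (a - 1 - 1) * sgn t)
        = (a - 1) * (\<bar>t\<bar> powr (a - 1 - 1) * (t * sgn t))" by simp
    also have "t * sgn t = \<bar>t\<bar> powr 1" by (simp add: abs_sgn[symmetric])
    finally show ?thesis using False by (simp only: powr_add[symmetric]) simp
  qed
  ultimately show ?thesis by (simp add: algebra_simps)
qed

lemma ray_mean_has_derivative:
  fixes q q' w :: "real \<Rightarrow> real"
  assumes w: "continuous_on {0..1} w" and q': "continuous_on {-e<..<e} q'"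
    and d: "\<And>t. t \<in> {-e<..<e} \<Longrightarrow> (q has_vector_derivative q' t) (at t)"
    and t: "t \<in> {-e<..<e}"
  shows "((\<lambda>t. integral {0..1} (\<lambda>v. w v * q (t * v))) has_vector_derivative
    integral {0..1} (\<lambda>v. (w v * v) * q' (t * v))) (at t)"
proof -
  have q: "continuous_on {-e<..<e} q"
    by (meson continuous_at_imp_continuous_on d has_vector_derivative_continuous)
  have "((\<lambda>t. integral (cbox 0 1) (\<lambda>v. w v * q (t * v))) has_vector_derivative
    integral (cbox 0 1) (\<lambda>v. (w v * v) * q' (t * v))) (at t within {-e<..<e})"
  proof (rule leibniz_rule_vector_derivative[where fx = "\<lambda>t v. (w v * v) * q' (t * v)"])
    fix x v :: real assume x: "x \<in> {-e<..<e}" and v: "v \<in> cbox 0 1"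
    have "(q has_field_derivative q' (x * v)) (at (x * v))"
      using d[OF mult_mem_symmetric_interval[OF x, of v]] v
      by (simp add: has_real_derivative_iff_has_vector_derivative)
    then have "((\<lambda>x. w v * q (x * v)) has_field_derivative w v * (q' (x * v) * v)) (at x)"
      by (intro DERIV_cmult DERIV_chain2[of q]) (auto intro!: derivative_eq_intros)
    then show "((\<lambda>x. w v * q (x * v)) has_vector_derivative (w v * v) * q' (x * v))
        (at x within {-e<..<e})"
      by (auto simp: has_real_derivative_iff_has_vector_derivative algebra_simps
          intro: has_vector_derivative_at_within)
  next
    fix x :: real assume x: "x \<in> {-e<..<e}"
    show "(\<lambda>v. w v * q (x * v)) integrable_on cbox 0 1"
      using mult_mem_symmetric_interval[OF x] w
      by (intro integrable_continuous continuous_intros continuous_on_compose2[OF q]) auto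
  next
    show "continuous_on ({-e<..<e} \<times> cbox 0 1) (\<lambda>(x, v). (w v * v) * q' (x * v))"
      unfolding split_beta
      by (intro continuous_intros continuous_on_compose2[OF q'] continuous_on_compose2[OF w])
        (auto intro: mult_mem_symmetric_interval simp del: greaterThanLessThan_iff)
  qed (use t in auto)
  then show ?thesis using t by (simp add: at_within_open[of t "{-e<..<e}"])
qed

text \<open>
  Differentiation under the integral sign turns the mean of \<open>q\<close> with weight \<open>w(v)\<close> into the mean of
  \<open>q'\<close> with weight \<open>v w(v)\<close>, an object of the same kind. The weights are merely continuous because
  fractional powers of \<open>v\<close> occur below.
\<close>

lemma smooth_on_ray_mean:
  fixes q w :: "real \<Rightarrow> real"
  assumes "continuous_on {0..1} w" "smooth_on {-e<..<e} q"
  shows "smooth_on {-e<..<e} (\<lambda>t. integral {0..1} (\<lambda>v. w v * q (t * v)))"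
proof (rule smooth_on_coinduct[where X = "{\<lambda>t. integral {0..1} (\<lambda>v. w v * q (t * v)) | w q.
    continuous_on {0..1} w \<and> smooth_on {-e<..<e} q}"])
  fix f :: "real \<Rightarrow> real"
  assume "f \<in> {\<lambda>t. integral {0..1} (\<lambda>v. w v * q (t * v)) | w q.
    continuous_on {0..1} w \<and> smooth_on {-e<..<e} q}"
  then obtain w q where f: "f = (\<lambda>t. integral {0..1} (\<lambda>v. w v * q (t * v)))"
    and w: "continuous_on {0..1} w" and q: "smooth_on {-e<..<e} q" by auto
  obtain q' where q': "smooth_on {-e<..<e} q'"
    "\<And>t. t \<in> {-e<..<e} \<Longrightarrow> (q has_vector_derivative q' t) (at t)"
    using smooth_on_derivativeE[OF _ q] by auto
  have "continuous_on {0..1} (\<lambda>v. w v * v)" using w by (intro continuous_intros)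
  then have X: "(\<lambda>t. integral {0..1} (\<lambda>v. (w v * v) * q' (t * v))) \<in>
      {\<lambda>t. integral {0..1} (\<lambda>v. w v * q (t * v)) | w q.
        continuous_on {0..1} w \<and> smooth_on {-e<..<e} q}"
    using q'(1) by (intro CollectI exI[of _ "\<lambda>v. w v * v"] exI[of _ q']) simp
  have "\<forall>t\<in>{-e<..<e}. (f has_vector_derivative
      integral {0..1} (\<lambda>v. (w v * v) * q' (t * v))) (at t)"
    using ray_mean_has_derivative[OF w smooth_on_continuous_on[OF q'(1)] q'(2)]
    unfolding f by simp
  from this X show "\<exists>g\<in>{\<lambda>t. integral {0..1} (\<lambda>v. w v * q (t * v)) | w q.
      continuous_on {0..1} w \<and> smooth_on {-e<..<e} q}.
      \<forall>t\<in>{-e<..<e}. (f has_vector_derivative g t) (at t)"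
    by (rule bexI[of "\<lambda>g. \<forall>t\<in>{-e<..<e}. (f has_vector_derivative g t) (at t)"])
qed (use assms in auto)

text \<open>
  The primitive of \<open>\<bar>t\<bar>\<close> to the power \<open>a - 1\<close> times \<open>q(t)\<close> that vanishes at \<open>0\<close> has the same singular
  factor as in the case of constant \<open>q\<close>, up to a smooth positive factor \<open>r\<close>: substituting \<open>u = t v\<close>
  in the integral exhibits \<open>r\<close> as the mean of \<open>q\<close> along the ray with weight \<open>v powr (a - 1)\<close>. The
  equation \<open>a r + t r' = q\<close>, which comes from integrating the derivative of \<open>v powr a * q (t * v)\<close>
  over the unit interval, determines the Taylor coefficients of \<open>r\<close> from those of \<open>q\<close>.
\<close>

lemma smooth_on_homogeneous_primitive:
  fixes q :: "real \<Rightarrow> real"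
  assumes "e > 0" and q: "smooth_on {-e<..<e} q" and q0: "\<And>t. t \<in> {-e<..<e} \<Longrightarrow> q t > 0"
    and a: "a > 1"
  obtains r where "smooth_on {-e<..<e} r"
    and "\<And>t. t \<in> {-e<..<e} \<Longrightarrow>
      ((\<lambda>t. t * \<bar>t\<bar> powr (a - 1) * r t) has_vector_derivative \<bar>t\<bar> powr (a - 1) * q t) (at t)"
    and "\<And>t. t \<in> {-e<..<e} \<Longrightarrow> \<exists>d. (r has_vector_derivative d) (at t) \<and> a * r t + t * d = q t"
    and "\<And>t. t \<in> {-e<..<e} \<Longrightarrow> r t > 0"
proof -
  obtain q' where q': "smooth_on {-e<..<e} q'"
    "\<And>t. t \<in> {-e<..<e} \<Longrightarrow> (q has_vector_derivative q' t) (at t)"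
    using smooth_on_derivativeE[OF _ q] by auto
  have w: "continuous_on {0..1} (\<lambda>v::real. v powr b)" if "b > 0" for b
    using that by (intro continuous_on_powr' continuous_intros) auto
  define r where "r t = integral {0..1} (\<lambda>v. v powr (a - 1) * q (t * v))" for t
  define d where "d t = integral {0..1} (\<lambda>v. v powr (a - 1) * v * q' (t * v))" for t
  have smooth: "smooth_on {-e<..<e} r"
    unfolding r_def by (rule smooth_on_ray_mean[OF w q]) (use a in auto)
  have rd: "(r has_vector_derivative d t) (at t)" if "t \<in> {-e<..<e}" for t
    unfolding r_def d_def
    by (rule ray_mean_has_derivative[OF w smooth_on_continuous_on[OF q'(1)] q'(2) that])
      (use a in auto)
  have cont: "continuous_on {0..1} (\<lambda>v. v powr (a - 1) * f (t * v))"
    "continuous_on {0..1} (\<lambda>v. v powr (a - 1) * v * f (t * v))"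
    if t: "t \<in> {-e<..<e}" and f: "continuous_on {-e<..<e} f" for f :: "real \<Rightarrow> real" and t
    using mult_mem_symmetric_interval[OF t] a
    by (intro continuous_intros w continuous_on_compose2[OF f]; auto)+
  note int = cont[THEN integrable_continuous_real]
  have ode: "a * r t + t * d t = q t" if t: "t \<in> {-e<..<e}" for t
  proof -
    have "((\<lambda>v. a * (v powr (a - 1) * q (t * v)) + t * (v powr (a - 1) * v * q' (t * v)))
        has_integral (1 powr a * q (t * 1) - 0 powr a * q (t * 0))) {0..1}"
    proof (rule fundamental_theorem_of_calculus_interior)
      show "continuous_on {0..1} (\<lambda>v. v powr a * q (t * v))"
        using mult_mem_symmetric_interval[OF t] a
        by (intro continuous_intros w continuous_on_compose2[OF smooth_on_continuous_on[OF q]]) auto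
      fix v :: real assume v: "v \<in> {0<..<1}"
      have "(q has_field_derivative q' (t * v)) (at (t * v))"
        using q'(2)[OF mult_mem_symmetric_interval[OF t, of v]] v
        by (simp add: has_real_derivative_iff_has_vector_derivative)
      then have *: "((\<lambda>v. q (t * v)) has_field_derivative q' (t * v) * t) (at v)"
        by (intro DERIV_chain2[of q]) (auto intro!: derivative_eq_intros)
      have "((\<lambda>v. v powr a * q (t * v)) has_field_derivative
          (a * v powr (a - 1)) * q (t * v) + v powr a * (q' (t * v) * t)) (at v)"
        using v by (auto intro!: derivative_eq_intros *)
      moreover have "v powr a = v powr (a - 1) * v"
        using v powr_add[of v "a - 1" 1] by simp
      ultimately show "((\<lambda>v. v powr a * q (t * v)) has_vector_derivative
          a * (v powr (a - 1) * q (t * v)) + t * (v powr (a - 1) * v * q' (t * v))) (at v)"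
        by (simp add: has_real_derivative_iff_has_vector_derivative algebra_simps)
    qed simp
    then have "integral {0..1} (\<lambda>v. a * (v powr (a - 1) * q (t * v)) + t * (v powr (a - 1) * v * q' (t * v))) = q t"
      using a by (simp add: integral_unique)
    moreover have "integral {0..1} (\<lambda>v. a * (v powr (a - 1) * q (t * v)) + t * (v powr (a - 1) * v * q' (t * v)))
       = a * r t + t * d t"
      unfolding r_def d_def
      by (subst integral_add)
        (use int[OF t smooth_on_continuous_on[OF q]] int[OF t smooth_on_continuous_on[OF q'(1)]]
          in \<open>auto intro!: integrable_on_mult_right\<close>)
    ultimately show ?thesis by simp
  qed
  have prim: "((\<lambda>t. t * \<bar>t\<bar> powr (a - 1) * r t) has_vector_derivative \<bar>t\<bar> powr (a - 1) * q t) (at t)"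
    if t: "t \<in> {-e<..<e}" for t
  proof -
    have "(r has_real_derivative d t) (at t)"
      using rd[OF t] by (simp add: has_real_derivative_iff_has_vector_derivative)
    from DERIV_mult[OF DERIV_signed_powr[OF a] this]
    have "((\<lambda>t. t * \<bar>t\<bar> powr (a - 1) * r t) has_field_derivative
        \<bar>t\<bar> powr (a - 1) * (a * r t + t * d t)) (at t)"
      by (simp add: algebra_simps)
    then show ?thesis
      by (simp add: ode[OF t] has_real_derivative_iff_has_vector_derivative)
  qed
  have pos: "r t > 0" if t: "t \<in> {-e<..<e}" for t
  proof -
    have "integral {0..1} (\<lambda>v::real. 0::real) < integral {0..1} (\<lambda>v. v powr (a - 1) * q (t * v))"
    proof (rule integral_less_real)
      show "continuous_on {0..1} (\<lambda>v. v powr (a - 1) * q (t * v))"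
        by (rule cont(1)[OF t smooth_on_continuous_on[OF q]])
      show "{0<..<1} \<noteq> ({} :: real set)" by auto
      show "0 < v powr (a - 1) * q (t * v)" if "v \<in> {0<..<1}" for v
        using that q0[OF mult_mem_symmetric_interval[OF t, of v]] by simp
    qed auto
    then show ?thesis by (simp add: r_def)
  qed
  show ?thesis
  proof (rule that[OF smooth prim])
    show "\<exists>d. (r has_vector_derivative d) (at t) \<and> a * r t + t * d = q t" if "t \<in> {-e<..<e}" for t
      using rd[OF that] ode[OF that] by blast
  qed (use pos in auto)
qed

section \<open>Inverse functions of one variable\<close>

text \<open>
  The inverse \<open>g\<close> satisfies \<open>g' = 1 / f'(g)\<close>, so each order of differentiability of \<open>g\<close> yields the
  next one.
\<close>

lemma diffeomorphism_of_pos_derivative: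
  fixes f :: "real \<Rightarrow> real"
  assumes f: "smooth_on {a<..<b} f" and d: "\<And>t. t \<in> {a<..<b} \<Longrightarrow> (f has_vector_derivative f' t) (at t)"
    and pos: "\<And>t. t \<in> {a<..<b} \<Longrightarrow> f' t > 0"
  obtains g where "diffeomorphism {a<..<b} (f ` {a<..<b}) f g"
proof -
  let ?I = "{a<..<b}" and ?J = "f ` {a<..<b}"
  have less: "f s < f t" if "s \<in> ?I" "t \<in> ?I" "s < t" for s t
  proof (rule DERIV_pos_imp_increasing[OF that(3)])
    fix x assume "s \<le> x" "x \<le> t"
    then have "x \<in> ?I" using that by auto
    then show "\<exists>y. (f has_real_derivative y) (at x) \<and> 0 < y"
      using d pos by (auto simp: has_real_derivative_iff_has_vector_derivative)
  qed
  have inj: "inj_on f ?I"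
    by (rule inj_onI) (metis less less_irrefl linorder_neqE_linordered_idom)
  have cont: "continuous_on ?I f" using f by (rule smooth_on_continuous_on)
  have "open ?J" using invariance_of_domain[OF cont _ inj] by simp
  obtain g where g: "homeomorphism ?I ?J f g"
    using invariance_of_domain_homeomorphism[OF _ cont _ inj] by auto
  then have gI: "g y \<in> ?I" and fg: "f (g y) = y" if "y \<in> ?J" for y
    using that unfolding homeomorphism_def by blast+
  then have gJ: "g ` ?J \<subseteq> ?I" by blast
  have "f' t = vector_derivative f (at t)" if "t \<in> ?I" for t
    using d[OF that] by (simp add: vector_derivative_at)
  then have f': "smooth_on ?I f'"
    using smooth_on_vector_derivative[OF _ f] by (rule_tac smooth_on_cong[rotated 2]) auto
  have dg: "(g has_vector_derivative inverse (f' (g y))) (at y)" if y: "y \<in> ?J" for y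
    unfolding has_real_derivative_iff_has_vector_derivative[symmetric]
  proof (rule has_field_derivative_inverse_basic[where f = f and t = ?J])
    show "(f has_real_derivative f' (g y)) (at (g y))"
      using d[OF gI[OF y]] by (simp add: has_real_derivative_iff_has_vector_derivative)
    show "f' (g y) \<noteq> 0" using pos[OF gI[OF y]] by simp
    show "isCont g y"
      using g y \<open>open ?J\<close> by (auto simp: homeomorphism_def continuous_on_eq_continuous_at)
  qed (use \<open>open ?J\<close> y fg in auto)
  have "higher_differentiable_on ?J g n" for n
  proof (induction n)
    case 0
    show ?case using g by (simp add: homeomorphism_def)
  next
    case (Suc n)
    have h: "higher_differentiable_on ?J (\<lambda>y. f' (g y)) n"
      using higher_differentiable_on_compose[OF \<open>open ?J\<close> _ _ Suc, of ?I f'] f' gJ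
      by (simp add: smooth_on_def)
    have "(\<lambda>y. f' (g y)) ` ?J \<subseteq> - {0}"
      by (intro image_subsetI) (metis ComplI gI less_irrefl pos singletonD)
    then have "higher_differentiable_on ?J (\<lambda>y. inverse (f' (g y))) n"
      using higher_differentiable_on_compose[OF \<open>open ?J\<close> _ _ h, of "- {0}" inverse]
        smooth_on_inverse by (simp add: smooth_on_def open_Compl)
    then show ?case using dg by (intro higher_differentiable_on_SucI_real[OF \<open>open ?J\<close>]) auto
  qed
  then have "smooth_on ?J g" by (simp add: smooth_on_def)
  with f g \<open>open ?J\<close> have "diffeomorphism ?I ?J f g"
    by (simp add: diffeomorphism_def)
  then show ?thesis by (rule that)
qed

section \<open>The derivatives of a cuspidal curve at the cusp\<close>

lemma nderiv_Suc: "nderiv (Suc k) \<gamma> = (\<lambda>t. vector_derivative (nderiv k \<gamma>) (at t))"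
  by (simp add: nderiv_def)

lemma nderiv_0: "nderiv 0 \<gamma> = \<gamma>"
  by (simp add: nderiv_def)

lemma smooth_on_nderiv: "open S \<Longrightarrow> smooth_on S \<gamma> \<Longrightarrow> smooth_on S (nderiv k \<gamma>)"
  by (induction k) (simp_all add: nderiv_0 nderiv_Suc smooth_on_vector_derivative)

lemma nderiv_has_vector_derivative:
  assumes "open S" "smooth_on S \<gamma>" "t \<in> S"
  shows "(nderiv k \<gamma> has_vector_derivative nderiv (Suc k) \<gamma> t) (at t)"
  unfolding nderiv_Suc
  using smooth_on_has_vector_derivative[OF smooth_on_nderiv[OF assms(1,2)] assms(3)] .

lemma nderiv_SucI:
  assumes "open S" "t \<in> S" "\<And>u. u \<in> S \<Longrightarrow> nderiv k \<gamma> u = f u"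
    and "(f has_vector_derivative d) (at t)"
  shows "nderiv (Suc k) \<gamma> t = d"
proof -
  have "(nderiv k \<gamma> has_vector_derivative d) (at t)"
    using has_vector_derivative_transform_within_open[OF assms(4,1,2)] assms(3) by simp
  then show ?thesis unfolding nderiv_Suc by (rule vector_derivative_at)
qed

lemma vector_derivative_unique_on_open:
  assumes "open S" "t \<in> S" "\<And>u. u \<in> S \<Longrightarrow> f u = g u"
    and "(f has_vector_derivative a) (at t)" "(g has_vector_derivative b) (at t)"
  shows "a = b"
  using has_vector_derivative_transform_within_open[OF assms(4,1,2,3)] assms(5)
  by (blast intro: vector_derivative_unique_at)

lemma has_vector_derivative_real_scaleR:
  fixes f :: "real \<Rightarrow> real"
  assumes "(f has_vector_derivative f') (at t)" "(g has_vector_derivative g') (at t)"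
  shows "((\<lambda>t. f t *\<^sub>R g t) has_vector_derivative (f' *\<^sub>R g t + f t *\<^sub>R g')) (at t)"
  using has_vector_derivative_scaleR[of f f' t UNIV g g'] assms
  by (simp add: has_real_derivative_iff_has_vector_derivative add.commute)

lemma real_power_has_vector_derivative:
  "((\<lambda>u::real. c * u ^ n) has_vector_derivative (c * n * u ^ (n - 1))) (at u)"
  unfolding has_real_derivative_iff_has_vector_derivative[symmetric]
  by (auto intro!: derivative_eq_intros)

lemma vector_2_eq: "(vector [a, b] :: real^2) = a *\<^sub>R axis 1 1 + b *\<^sub>R axis 2 1"
  by (simp add: vec_eq_iff forall_2 axis_def)

lemma compose_cusp_has_vector_derivative:
  fixes G :: "real^2 \<Rightarrow> real^2"
  assumes "smooth_on W G" "open W" "vector [u^2, u^3] \<in> W"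
  shows "((\<lambda>u. G (vector [u^2, u^3])) has_vector_derivative
     (2 * u) *\<^sub>R frechet_derivative G (at (vector [u^2, u^3])) (axis 1 1)
     + (3 * u^2) *\<^sub>R frechet_derivative G (at (vector [u^2, u^3])) (axis 2 1)) (at u)"
proof -
  let ?p = "\<lambda>u::real. vector [u^2, u^3] :: real^2"
  have "higher_differentiable_on W G (Suc 0)" using assms(1) by (simp only: smooth_on_def)
  note dG = higher_differentiable_on_has_derivative[OF this assms(3)]
  have "(?p has_vector_derivative ((2 * u) *\<^sub>R axis 1 1 + (3 * u^2) *\<^sub>R axis 2 1)) (at u)"
    unfolding vector_2_eq
    using has_vector_derivative_add[OF
       has_vector_derivative_real_scaleR[OF real_power_has_vector_derivative[of 1 2 u]
         has_vector_derivative_const[of "axis 1 1 :: real^2"]]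
       has_vector_derivative_real_scaleR[OF real_power_has_vector_derivative[of 1 3 u]
         has_vector_derivative_const[of "axis 2 1 :: real^2"]]]
    by simp
  from vector_derivative_diff_chain_within[OF this has_derivative_at_withinI[OF dG]]
  have "((G \<circ> ?p) has_vector_derivative
      frechet_derivative G (at (?p u)) ((2 * u) *\<^sub>R axis 1 1 + (3 * u^2) *\<^sub>R axis 2 1)) (at u)"
    by simp
  moreover have "linear (frechet_derivative G (at (?p u)))"
    using dG has_derivative_linear by blast
  ultimately show ?thesis by (simp add: o_def linear_add linear_scale)
qed

lemma bracket_0_imp_dependent:
  assumes "bracket a b = 0"
  shows "b$1 *\<^sub>R a = a$1 *\<^sub>R b" "b$2 *\<^sub>R a = a$2 *\<^sub>R b"
  using assms by (auto simp: bracket_def vec_eq_iff forall_2 algebra_simps)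

lemma bracket_injective_linear:
  fixes L :: "real^2 \<Rightarrow> real^2"
  assumes "linear L" "inj L"
  shows "bracket (L (axis 1 1)) (L (axis 2 1)) \<noteq> 0"
proof
  let ?a = "L (axis 1 1)" and ?b = "L (axis 2 1)"
  assume "bracket ?a ?b = 0"
  then have *: "?b$i *\<^sub>R ?a = ?a$i *\<^sub>R ?b" if "i = 1 \<or> i = 2" for i :: 2
    using bracket_0_imp_dependent that by blast
  have "?a$i = 0" if "i = 1 \<or> i = 2" for i :: 2
  proof -
    have "L (?b$i *\<^sub>R axis 1 1) = L (?a$i *\<^sub>R axis 2 1)"
      using *[OF that] by (simp add: linear_scale[OF assms(1)])
    then have "?b$i *\<^sub>R (axis 1 1 :: real^2) = ?a$i *\<^sub>R axis 2 1"
      using assms(2) by (simp add: inj_eq)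
    then have "(?b$i *\<^sub>R (axis 1 1 :: real^2)) $ 2 = (?a$i *\<^sub>R axis 2 1) $ 2" by simp
    then show ?thesis by (simp add: axis_def)
  qed
  then have "L (axis 1 1) = L 0"
    using linear_0[OF assms(1)] by (simp add: vec_eq_iff forall_2)
  then have "axis 1 1 = (0::real^2)" using assms(2) by (simp only: inj_eq)
  then show False by (simp add: axis_eq_0_iff)
qed

lemma diffeomorphism_derivative_injective:
  assumes "diffeomorphism S T f g" "y \<in> T"
  shows "linear (frechet_derivative g (at y))" "inj (frechet_derivative g (at y))"
proof -
  have S: "open S" "open T" and h: "homeomorphism S T f g" and "smooth_on S f" "smooth_on T g"
    using assms(1) by (auto simp: diffeomorphism_def)
  then have "higher_differentiable_on S f (Suc 0)" "higher_differentiable_on T g (Suc 0)"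
    by (simp_all only: smooth_on_def)
  moreover have x: "g y \<in> S" using h assms(2) by (auto simp: homeomorphism_def)
  ultimately have f: "(f has_derivative frechet_derivative f (at (g y))) (at (g y))"
    and g: "(g has_derivative frechet_derivative g (at y)) (at y)"
    using assms(2) higher_differentiable_on_has_derivative by blast+
  show "linear (frechet_derivative g (at y))" using g has_derivative_linear by blast
  have "((\<lambda>z. f (g z)) has_derivative (\<lambda>v. v)) (at y)"
    by (rule has_derivative_transform_within_open[OF has_derivative_ident S(2) assms(2)])
      (use h in \<open>auto simp: homeomorphism_def\<close>)
  moreover have "((\<lambda>z. f (g z)) has_derivative
      (\<lambda>v. frechet_derivative f (at (g y)) (frechet_derivative g (at y) v))) (at y)"
    using diff_chain_at[OF g f] by (simp add: o_def)
  ultimately have "(\<lambda>v. v) = (\<lambda>v. frechet_derivative f (at (g y)) (frechet_derivative g (at y) v))"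
    by (rule has_derivative_unique)
  then show "inj (frechet_derivative g (at y))" by (metis injI)
qed

lemma bracket_scaleR_left: "bracket (c *\<^sub>R a) b = c * bracket a b"
  and bracket_scaleR_right: "bracket a (c *\<^sub>R b) = c * bracket a b"
  and bracket_add_right: "bracket a (b + d) = bracket a b + bracket a d"
  and bracket_add_left: "bracket (a + d) b = bracket a b + bracket d b"
  and bracket_self: "bracket a a = 0"
  by (simp_all add: bracket_def algebra_simps)

text \<open>
  Let \<open>\<Psi>\<close> be the inverse of the diffeomorphism of the plane, with partial derivatives \<open>\<Psi>\<^sub>1\<close> and
  \<open>\<Psi>\<^sub>2\<close>. The second and third derivatives of \<open>\<Psi>(u\<^sup>2, u\<^sup>3)\<close> at \<open>0\<close> are \<open>2 \<Psi>\<^sub>1\<close> and \<open>6 \<Psi>\<^sub>2\<close>, which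
  are independent because the derivative of \<open>\<Psi>\<close> is injective. On the other hand they are
  \<open>\<phi>'\<^sup>2 \<gamma>''\<close> and \<open>\<phi>'\<^sup>3 \<gamma>'''\<close> up to a multiple of \<open>\<gamma>''\<close>, which the bracket does not see.
\<close>

lemma cusp_3_2_imp_derivatives:
  assumes "e > 0" and \<gamma>: "smooth_on {-e<..<e} \<gamma>" and "cusp_3_2 \<gamma>"
  shows "nderiv 1 \<gamma> 0 = 0" "bracket (nderiv 2 \<gamma> 0) (nderiv 3 \<gamma> 0) \<noteq> 0"
proof -
  obtain U V \<phi> \<phi>' W W' \<Phi> \<Psi> where cusp: "0 \<in> U \<and> \<phi> 0 = 0 \<and> diffeomorphism U V \<phi> \<phi>' \<and>
      \<gamma> 0 \<in> W \<and> diffeomorphism W W' \<Phi> \<Psi> \<and>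
      (\<forall>u\<in>U. \<gamma> (\<phi> u) \<in> W \<and> \<Phi> (\<gamma> (\<phi> u)) = (vector [u^2, u^3] :: real^2))"
    using assms(3) unfolding cusp_3_2_def by (elim exE) (rule that)
  then have U: "0 \<in> U" "\<phi> 0 = 0" and \<phi>: "diffeomorphism U V \<phi> \<phi>'"
    and \<Phi>: "diffeomorphism W W' \<Phi> \<Psi>"
    and normal: "\<And>u. u \<in> U \<Longrightarrow> \<gamma> (\<phi> u) \<in> W \<and> \<Phi> (\<gamma> (\<phi> u)) = (vector [u^2, u^3] :: real^2)"
    by simp_all
  have oU: "open U" and s\<phi>: "smooth_on U \<phi>" using \<phi> by (auto simp: diffeomorphism_def)
  have W': "open W'" and s\<Psi>: "smooth_on W' \<Psi>" using \<Phi> by (auto simp: diffeomorphism_def)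
  have h: "homeomorphism W W' \<Phi> \<Psi>" using \<Phi> by (auto simp: diffeomorphism_def)
  let ?p = "\<lambda>u::real. vector [u^2, u^3] :: real^2"
  define S where "S = U \<inter> \<phi> -` {-e<..<e}"
  have S: "open S" "0 \<in> S" "S \<subseteq> U"
    using continuous_open_preimage[OF smooth_on_continuous_on[OF s\<phi>] oU, of "{-e<..<e}"] U assms(1)
    by (auto simp: S_def)
  have pW: "?p u \<in> W'" if "u \<in> S" for u
    using normal[of u] that h S by (metis homeomorphism_image1 imageI subsetD)
  have eq: "\<gamma> (\<phi> u) = \<Psi> (?p u)" if "u \<in> S" for u
    using normal[of u] that h S by (metis homeomorphism_apply1 subsetD)
  have I: "\<phi> u \<in> {-e<..<e}" if "u \<in> S" for u using that by (simp add: S_def)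
  obtain \<phi>1 where \<phi>1: "smooth_on U \<phi>1" "\<And>u. u \<in> U \<Longrightarrow> (\<phi> has_vector_derivative \<phi>1 u) (at u)"
    using smooth_on_derivativeE[OF oU s\<phi>] by blast
  obtain \<phi>2 where \<phi>2: "smooth_on U \<phi>2" "\<And>u. u \<in> U \<Longrightarrow> (\<phi>1 has_vector_derivative \<phi>2 u) (at u)"
    using smooth_on_derivativeE[OF oU \<phi>1(1)] by blast
  obtain \<phi>3 where \<phi>3: "\<And>u. u \<in> U \<Longrightarrow> (\<phi>2 has_vector_derivative \<phi>3 u) (at u)"
    using smooth_on_derivativeE[OF oU \<phi>2(1)] by blast
  have "\<phi>1 0 \<noteq> 0"
  proof
    assume *: "\<phi>1 0 = 0"
    have sV: "open V" "smooth_on V \<phi>'" "homeomorphism U V \<phi> \<phi>'"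
      using \<phi> by (auto simp: diffeomorphism_def)
    then have "0 \<in> V" using U by (auto simp: homeomorphism_def)
    then have "(\<phi>' has_field_derivative vector_derivative \<phi>' (at (\<phi> 0))) (at (\<phi> 0))"
      using smooth_on_has_vector_derivative[OF sV(2)] U
      by (simp add: has_real_derivative_iff_has_vector_derivative)
    moreover have "(\<phi> has_field_derivative 0) (at 0)"
      using \<phi>1(2)[OF U(1)] * by (simp add: has_real_derivative_iff_has_vector_derivative)
    ultimately have "((\<lambda>u. \<phi>' (\<phi> u)) has_field_derivative 0) (at 0)"
      using DERIV_chain2 by force
    moreover have "((\<lambda>u. \<phi>' (\<phi> u)) has_field_derivative 1) (at 0)"
      by (rule has_field_derivative_transform_within_open[OF DERIV_ident oU U(1)])
        (use sV(3) in \<open>auto simp: homeomorphism_def\<close>)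
    ultimately show False using DERIV_unique by fastforce
  qed
  define N where "N k u = nderiv k \<gamma> (\<phi> u)" for k u
  have N: "(N k has_vector_derivative \<phi>1 u *\<^sub>R N (Suc k) u) (at u)" if "u \<in> S" for k u
  proof -
    have "(nderiv k \<gamma> has_vector_derivative nderiv (Suc k) \<gamma> (\<phi> u)) (at (\<phi> u))"
      by (rule nderiv_has_vector_derivative[OF _ \<gamma> I[OF that]]) simp
    from vector_diff_chain_at[OF \<phi>1(2) this] that S(3)
    show ?thesis by (auto simp: N_def[abs_def] o_def)
  qed
  define P where "P i z = frechet_derivative \<Psi> (at z) (axis i 1)" for i z
  define Q where "Q i j z = frechet_derivative (P i) (at z) (axis j 1)" for i j z
  have deriv_smooth: "smooth_on W' (\<lambda>z. frechet_derivative G (at z) v)" if "smooth_on W' G"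
    for G :: "real^2 \<Rightarrow> real^2" and v
  proof -
    have "higher_differentiable_on W' G (Suc n)" for n using that by (simp only: smooth_on_def)
    then show ?thesis by (simp add: smooth_on_def)
  qed
  have sP: "smooth_on W' (P i)" for i unfolding P_def by (rule deriv_smooth[OF s\<Psi>])
  have sQ: "smooth_on W' (Q i j)" for i j unfolding Q_def by (rule deriv_smooth[OF sP])
  note d\<Psi> = compose_cusp_has_vector_derivative[OF s\<Psi> W' pW, folded P_def]
  note dP = compose_cusp_has_vector_derivative[OF sP W' pW, folded Q_def]
  note dQ = compose_cusp_has_vector_derivative[OF sQ W' pW]
  note \<phi>U = \<phi>1(2)[OF subsetD[OF S(3)]] \<phi>2(2)[OF subsetD[OF S(3)]] \<phi>3[OF subsetD[OF S(3)]]
  note pw = real_power_has_vector_derivative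
  \<comment> \<open>The first three derivatives of the normal form \<open>\<gamma> \<circ> \<phi>\<close>, computed in two ways.\<close>
  have first: "\<phi>1 u *\<^sub>R N 1 u = (2 * u) *\<^sub>R P 1 (?p u) + (3 * u^2) *\<^sub>R P 2 (?p u)" if "u \<in> S" for u
    by (rule vector_derivative_unique_on_open[OF S(1) that _ N[OF that, of 0, simplified] d\<Psi>[OF that], unfolded One_nat_def[symmetric]])
      (simp add: N_def nderiv_0 eq)
  have second: "\<phi>2 u *\<^sub>R N 1 u + \<phi>1 u *\<^sub>R \<phi>1 u *\<^sub>R N 2 u =
      2 *\<^sub>R P 1 (?p u) + (4 * u^2) *\<^sub>R Q 1 1 (?p u) + (6 * u^3) *\<^sub>R Q 1 2 (?p u)
      + (6 * u) *\<^sub>R P 2 (?p u) + (6 * u^3) *\<^sub>R Q 2 1 (?p u) + (9 * u^4) *\<^sub>R Q 2 2 (?p u)"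
    if "u \<in> S" for u
  proof (rule vector_derivative_unique_on_open[OF S(1) that first])
    show "((\<lambda>u. \<phi>1 u *\<^sub>R N 1 u) has_vector_derivative
        \<phi>2 u *\<^sub>R N 1 u + \<phi>1 u *\<^sub>R \<phi>1 u *\<^sub>R N 2 u) (at u)"
      using has_vector_derivative_real_scaleR[OF \<phi>U(2)[OF that] N[OF that, of 1]]
      by (simp add: numeral_2_eq_2)
    show "((\<lambda>u. (2 * u) *\<^sub>R P 1 (?p u) + (3 * u^2) *\<^sub>R P 2 (?p u)) has_vector_derivative
      2 *\<^sub>R P 1 (?p u) + (4 * u^2) *\<^sub>R Q 1 1 (?p u) + (6 * u^3) *\<^sub>R Q 1 2 (?p u)
      + (6 * u) *\<^sub>R P 2 (?p u) + (6 * u^3) *\<^sub>R Q 2 1 (?p u) + (9 * u^4) *\<^sub>R Q 2 2 (?p u)) (at u)"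
      using has_vector_derivative_add[OF
        has_vector_derivative_real_scaleR[OF pw[of 2 1 u] dP[OF that, of 1]]
        has_vector_derivative_real_scaleR[OF pw[of 3 2 u] dP[OF that, of 2]]]
      by (simp add: algebra_simps power2_eq_square power3_eq_cube power4_eq_xxxx)
  qed
  have third: "\<phi>3 0 *\<^sub>R N 1 0 + \<phi>2 0 *\<^sub>R \<phi>1 0 *\<^sub>R N 2 0 + (\<phi>2 0 *\<^sub>R \<phi>1 0 *\<^sub>R N 2 0
      + \<phi>1 0 *\<^sub>R (\<phi>2 0 *\<^sub>R N 2 0 + \<phi>1 0 *\<^sub>R \<phi>1 0 *\<^sub>R N 3 0)) = 6 *\<^sub>R P 2 (?p 0)"
  proof (rule vector_derivative_unique_on_open[OF S(1,2) second])
    show "((\<lambda>u. \<phi>2 u *\<^sub>R N 1 u + \<phi>1 u *\<^sub>R \<phi>1 u *\<^sub>R N 2 u) has_vector_derivative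
      \<phi>3 0 *\<^sub>R N 1 0 + \<phi>2 0 *\<^sub>R \<phi>1 0 *\<^sub>R N 2 0 + (\<phi>2 0 *\<^sub>R \<phi>1 0 *\<^sub>R N 2 0
      + \<phi>1 0 *\<^sub>R (\<phi>2 0 *\<^sub>R N 2 0 + \<phi>1 0 *\<^sub>R \<phi>1 0 *\<^sub>R N 3 0))) (at 0)"
      using has_vector_derivative_add[OF
        has_vector_derivative_real_scaleR[OF \<phi>U(3)[OF S(2)] N[OF S(2), of 1]]
        has_vector_derivative_real_scaleR[OF \<phi>U(2)[OF S(2)]
          has_vector_derivative_real_scaleR[OF \<phi>U(2)[OF S(2)] N[OF S(2), of 2]]]]
      by (simp add: numeral_2_eq_2 numeral_3_eq_3 algebra_simps)
    show "((\<lambda>u. 2 *\<^sub>R P 1 (?p u) + (4 * u^2) *\<^sub>R Q 1 1 (?p u) + (6 * u^3) *\<^sub>R Q 1 2 (?p u)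
      + (6 * u) *\<^sub>R P 2 (?p u) + (6 * u^3) *\<^sub>R Q 2 1 (?p u) + (9 * u^4) *\<^sub>R Q 2 2 (?p u))
      has_vector_derivative 6 *\<^sub>R P 2 (?p 0)) (at 0)"
      using has_vector_derivative_add[OF has_vector_derivative_add[OF has_vector_derivative_add[OF
        has_vector_derivative_add[OF has_vector_derivative_add[OF
        has_vector_derivative_real_scaleR[OF pw[of 2 0 0] dP[OF S(2), of 1]]
        has_vector_derivative_real_scaleR[OF pw[of 4 2 0] dQ[OF S(2), of 1 1]]]
        has_vector_derivative_real_scaleR[OF pw[of 6 3 0] dQ[OF S(2), of 1 2]]]
        has_vector_derivative_real_scaleR[OF pw[of 6 1 0] dP[OF S(2), of 2]]]
        has_vector_derivative_real_scaleR[OF pw[of 6 3 0] dQ[OF S(2), of 2 1]]]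
        has_vector_derivative_real_scaleR[OF pw[of 9 4 0] dQ[OF S(2), of 2 2]]]
      by simp
  qed
  show d1: "nderiv 1 \<gamma> 0 = 0" using first[OF S(2)] \<open>\<phi>1 0 \<noteq> 0\<close> by (simp add: N_def U)
  let ?n2 = "nderiv 2 \<gamma> 0" and ?n3 = "nderiv 3 \<gamma> 0"
  have a: "2 *\<^sub>R P 1 (?p 0) = (\<phi>1 0)^2 *\<^sub>R ?n2"
    using second[OF S(2)] by (simp add: N_def U d1[unfolded One_nat_def] power2_eq_square)
  have b: "6 *\<^sub>R P 2 (?p 0) = (3 * \<phi>1 0 * \<phi>2 0) *\<^sub>R ?n2 + (\<phi>1 0)^3 *\<^sub>R ?n3"
    using third
    by (simp add: N_def U d1[unfolded One_nat_def] vec_eq_iff forall_2 power3_eq_cube algebra_simps)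
  have "bracket (P 1 (?p 0)) (P 2 (?p 0)) \<noteq> 0"
    unfolding P_def
    by (rule bracket_injective_linear[OF diffeomorphism_derivative_injective[OF \<Phi> pW[OF S(2)]]])
  moreover have "12 * bracket (P 1 (?p 0)) (P 2 (?p 0)) = bracket (2 *\<^sub>R P 1 (?p 0)) (6 *\<^sub>R P 2 (?p 0))"
    by (simp add: bracket_scaleR_left bracket_scaleR_right)
  ultimately have "bracket (2 *\<^sub>R P 1 (?p 0)) (6 *\<^sub>R P 2 (?p 0)) \<noteq> 0" by linarith
  then have "bracket ((\<phi>1 0)^2 *\<^sub>R ?n2) ((3 * \<phi>1 0 * \<phi>2 0) *\<^sub>R ?n2 + (\<phi>1 0)^3 *\<^sub>R ?n3) \<noteq> 0"
    unfolding a b .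
  then show "bracket ?n2 ?n3 \<noteq> 0"
    by (simp add: bracket_scaleR_left bracket_scaleR_right bracket_add_right bracket_self)
qed

section \<open>Taylor expansion with smooth remainder\<close>

text \<open>
  The derivatives are taken within \<open>S\<close>, so that \<open>S\<close> may be a compact interval. There bounds for
  one term carry over to its primitive, which is how Borel's lemma is proved.
\<close>

definition derivative_sequence :: "real set \<Rightarrow> (nat \<Rightarrow> real \<Rightarrow> real) \<Rightarrow> bool" where
  "derivative_sequence S T \<longleftrightarrow>
     (\<forall>k. \<forall>t\<in>S. (T k has_real_derivative T (Suc k) t) (at t within S))"

lemma derivative_sequenceD:
  "derivative_sequence S T \<Longrightarrow> t \<in> S \<Longrightarrow> (T k has_real_derivative T (Suc k) t) (at t within S)"
  by (simp add: derivative_sequence_def)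

lemma derivative_sequence_shift: "derivative_sequence S T \<Longrightarrow> derivative_sequence S (\<lambda>k. T (k + m))"
  by (simp add: derivative_sequence_def)

lemma derivative_sequence_smooth_on:
  assumes "open S" "derivative_sequence S T"
  shows "smooth_on S (T k)"
proof (rule smooth_on_coinduct[OF assms(1), of _ "range T"])
  fix f assume "f \<in> range T"
  then obtain k where "f = T k" by auto
  then have "\<forall>t\<in>S. (f has_vector_derivative T (Suc k) t) (at t)"
    using derivative_sequenceD[OF assms(2)] assms(1)
    by (simp add: at_within_open[OF _ assms(1)] has_real_derivative_iff_has_vector_derivative)
  then show "\<exists>g\<in>range T. \<forall>t\<in>S. (f has_vector_derivative g t) (at t)" by blast
qed auto

lemma smooth_on_derivative_sequence:
  fixes f :: "real \<Rightarrow> real"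
  assumes "open S" "smooth_on S f"
  obtains T where "derivative_sequence S T" "T 0 = f"
proof -
  define T where "T k = ((\<lambda>g t. vector_derivative g (at t)) ^^ k) f" for k
  have sm: "smooth_on S (T k)" for k
    by (induction k) (simp_all add: T_def assms smooth_on_vector_derivative)
  have "(T k has_vector_derivative T (Suc k) t) (at t)" if "t \<in> S" for k t
    using smooth_on_has_vector_derivative[OF sm that, of k] by (simp add: T_def)
  then have "derivative_sequence S T"
    by (auto simp: derivative_sequence_def has_real_derivative_iff_has_vector_derivative
        intro: has_vector_derivative_at_within)
  then show ?thesis by (rule that) (simp add: T_def)
qed

text \<open>
  Taylor's formula on the segment from \<open>0\<close> to \<open>t\<close>, with the integral remainder: after the
  substitution \<open>u = t v\<close> the remainder is \<open>t ^ n\<close> times a weighted mean of the \<open>n\<close>-th derivative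
  along the ray, hence smooth. In particular a smooth function may be divided by as many powers
  of \<open>t\<close> as there are vanishing derivatives at \<open>0\<close>.
\<close>

lemma taylor_smooth_remainder:
  assumes T: "derivative_sequence {-e<..<e} T"
  obtains g where "smooth_on {-e<..<e} g"
    and "\<And>t. t \<in> {-e<..<e} \<Longrightarrow> T 0 t = (\<Sum>i<n. T i 0 / fact i * t ^ i) + t ^ n * g t"
proof (cases "n = 0")
  case True
  then show ?thesis using that[of "T 0"] derivative_sequence_smooth_on[OF _ T] by simp
next
  case False
  define g where "g t = integral {0..1} (\<lambda>v. (1 - v) ^ (n - 1) / fact (n - 1) * T n (t * v))" for t
  have "smooth_on {-e<..<e} g" unfolding g_def
    by (intro smooth_on_ray_mean derivative_sequence_smooth_on[OF _ T] continuous_intros) auto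
  moreover have "T 0 t = (\<Sum>i<n. T i 0 / fact i * t ^ i) + t ^ n * g t" if t: "t \<in> {-e<..<e}" for t
  proof -
    have *: "((\<lambda>v. t ^ m * T m (t * v)) has_vector_derivative t ^ Suc m * T (Suc m) (t * v))
        (at v within {0..1})" if v: "0 \<le> v" "v \<le> 1" for m v
    proof -
      have tv: "t * v \<in> {-e<..<e}" using mult_mem_symmetric_interval[OF t] v by auto
      have "(T m has_field_derivative T (Suc m) (t * v)) (at (t * v))"
        using derivative_sequenceD[OF T tv, of m] at_within_open[OF tv open_greaterThanLessThan]
        by (simp only:)
      then have "((\<lambda>v. T m (t * v)) has_field_derivative T (Suc m) (t * v) * t) (at v)"
        by (intro DERIV_chain2[of "T m"]) (auto intro!: derivative_eq_intros)
      then have "((\<lambda>v. t ^ m * T m (t * v)) has_field_derivative t ^ m * (T (Suc m) (t * v) * t)) (at v)"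
        by (rule DERIV_cmult)
      then show ?thesis
        by (simp add: has_real_derivative_iff_has_vector_derivative algebra_simps
            has_vector_derivative_at_within)
    qed
    have "t ^ 0 * T 0 (t * 1) = (\<Sum>i<n. ((1 - 0) ^ i / fact i) *\<^sub>R (t ^ i * T i (t * 0)))
      + integral {0..1} (\<lambda>v. ((1 - v) ^ (n - 1) / fact (n - 1)) *\<^sub>R (t ^ n * T n (t * v)))"
      by (rule Taylor_integral[where Df = "\<lambda>m v. t ^ m * T m (t * v)" and p = n
            and f = "\<lambda>v. t ^ 0 * T 0 (t * v)" and a = 0 and b = 1])
        (use False * in simp_all)
    also have "integral {0..1} (\<lambda>v. ((1 - v) ^ (n - 1) / fact (n - 1)) *\<^sub>R (t ^ n * T n (t * v)))
        = integral {0..1} (\<lambda>v. t ^ n * ((1 - v) ^ (n - 1) / fact (n - 1) * T n (t * v)))"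
      by (simp add: mult.left_commute)
    also have "\<dots> = t ^ n * g t" unfolding g_def by (rule integral_mult_right)
    finally show ?thesis by (simp add: algebra_simps)
  qed
  ultimately show ?thesis by (rule that)
qed

section \<open>A second order linear differential equation\<close>

lemma small_antiderivative:
  fixes g :: "real \<Rightarrow> real"
  assumes "r \<ge> 0" "continuous_on {-r..r} g" "\<And>t. t \<in> {-r..r} \<Longrightarrow> \<bar>g t\<bar> \<le> C"
  obtains G where "\<And>t. t \<in> {-r..r} \<Longrightarrow> (G has_real_derivative g t) (at t within {-r..r})"
    and "G 0 = 0" "\<And>t. t \<in> {-r..r} \<Longrightarrow> \<bar>G t\<bar> \<le> C * r"
proof -
  obtain H where H: "\<And>t. t \<in> {-r..r} \<Longrightarrow> (H has_vector_derivative g t) (at t within {-r..r})"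
    using antiderivative_continuous[OF assms(2)] by blast
  define G where "G t = H t - H 0" for t
  have G: "(G has_real_derivative g t) (at t within {-r..r})" if "t \<in> {-r..r}" for t
    using H[OF that] unfolding G_def[abs_def] has_real_derivative_iff_has_vector_derivative
    by (auto intro!: derivative_eq_intros)
  have C: "C \<ge> 0" using assms(3)[of 0] assms(1) by auto
  have "\<bar>G t\<bar> \<le> C * r" if t: "t \<in> {-r..r}" for t
  proof -
    have "norm (G t - G 0) \<le> C * norm (t - 0)"
      by (rule field_differentiable_bound[OF _ G]) (use assms t in auto)
    also have "\<dots> \<le> C * r" using t C by (auto intro!: mult_left_mono)
    finally show ?thesis by (simp add: G_def)
  qed
  with G show ?thesis using that[of G] by (simp add: G_def)
qed

lemma has_real_derivative_within_continuous_on: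
  assumes "\<And>t. t \<in> S \<Longrightarrow> (f has_real_derivative f' t) (at t within S)"
  shows "continuous_on S f"
  using assms by (meson continuous_on_eq_continuous_within DERIV_continuous)

text \<open>
  The solution is \<open>w = \<Sum>\<phi>\<^sub>n\<close>, where \<open>\<phi>\<^sub>0(t) = a + b t\<close> and \<open>\<phi>\<close> with index \<open>n + 1\<close> has second derivative
  \<open>- h \<phi>\<^sub>n\<close> and vanishes to second order at \<open>0\<close>. The interval is so short that each double
  integration halves the bound, so the series and its first two derivatives converge uniformly.
\<close>

lemma linear_ode_solution:
  fixes h :: "real \<Rightarrow> real"
  assumes r: "0 < r" "r \<le> 1" and h: "continuous_on {-r..r} h"
    and M: "\<And>t. t \<in> {-r..r} \<Longrightarrow> \<bar>h t\<bar> \<le> M" and small: "M * r \<le> 1 / 2"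
  obtains w w' where "w 0 = a" "w' 0 = b"
    and "\<And>t. t \<in> {-r<..<r} \<Longrightarrow> (w has_real_derivative w' t) (at t)"
    and "\<And>t. t \<in> {-r<..<r} \<Longrightarrow> (w' has_real_derivative - h t * w t) (at t)"
proof -
  let ?J = "{-r..r}"
  define B where "B = \<bar>a\<bar> + \<bar>b\<bar>"
  \<comment> \<open>A pair in the recursion consists of a term of the series and its derivative.\<close>
  define P where "P n p \<longleftrightarrow> (\<forall>t\<in>?J. (fst p has_real_derivative snd p t) (at t within ?J)
      \<and> \<bar>fst p t\<bar> \<le> B * (1/2) ^ n \<and> \<bar>snd p t\<bar> \<le> B * (1/2) ^ n)
      \<and> (n = 0 \<longrightarrow> p = (\<lambda>t. a + b * t, \<lambda>t. b))" for n and p :: "(real \<Rightarrow> real) \<times> (real \<Rightarrow> real)"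
  define Q where "Q p p' \<longleftrightarrow> (\<forall>t\<in>?J. (snd p' has_real_derivative - h t * fst p t) (at t within ?J))
      \<and> fst p' 0 = 0 \<and> snd p' 0 = 0" for p p' :: "(real \<Rightarrow> real) \<times> (real \<Rightarrow> real)"
  have "\<exists>f. \<forall>n. P n (f n) \<and> Q (f n) (f (Suc n))"
  proof (rule dependent_nat_choice)
    have "\<bar>a + b * t\<bar> \<le> B" if "t \<in> ?J" for t
    proof -
      have "\<bar>b * t\<bar> \<le> \<bar>b\<bar> * 1" unfolding abs_mult using that r by (intro mult_left_mono) auto
      then show ?thesis unfolding B_def by linarith
    qed
    then have "P 0 (\<lambda>t. a + b * t, \<lambda>t. b)"
      by (auto simp: P_def B_def intro!: derivative_eq_intros)
    then show "\<exists>p. P 0 p" by blast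
  next
    fix p :: "(real \<Rightarrow> real) \<times> (real \<Rightarrow> real)" and n assume p: "P n p"
    let ?C = "B * (1/2) ^ n"
    have c: "continuous_on ?J (fst p)"
      using p by (intro has_real_derivative_within_continuous_on[of _ _ "snd p"]) (auto simp: P_def)
    have bd: "\<bar>- h t * fst p t\<bar> \<le> M * ?C" if "t \<in> ?J" for t
      unfolding abs_mult abs_minus_cancel
      by (rule mult_mono) (use M[OF that] p that abs_ge_zero[of "h t"] in \<open>auto simp: P_def\<close>)
    obtain v where v: "\<And>t. t \<in> ?J \<Longrightarrow> (v has_real_derivative - h t * fst p t) (at t within ?J)"
      "v 0 = 0" "\<And>t. t \<in> ?J \<Longrightarrow> \<bar>v t\<bar> \<le> M * ?C * r"
    proof (rule small_antiderivative[of r "\<lambda>t. - h t * fst p t" "M * ?C"])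
      show "continuous_on ?J (\<lambda>t. - h t * fst p t)" by (intro continuous_intros h c)
    qed (use r bd in auto)
    have B0: "B \<ge> 0" by (simp add: B_def)
    have v': "\<bar>v t\<bar> \<le> B * (1/2) ^ Suc n" if "t \<in> ?J" for t
    proof -
      have "M * ?C * r = (M * r) * ?C" by simp
      also have "\<dots> \<le> (1 / 2) * ?C" by (rule mult_right_mono[OF small]) (use B0 in simp)
      finally show ?thesis using v(3)[OF that] by simp
    qed
    obtain u where u: "\<And>t. t \<in> ?J \<Longrightarrow> (u has_real_derivative v t) (at t within ?J)"
      "u 0 = 0" "\<And>t. t \<in> ?J \<Longrightarrow> \<bar>u t\<bar> \<le> B * (1/2) ^ Suc n * r"
      by (rule small_antiderivative[OF _ has_real_derivative_within_continuous_on[OF v(1)] v'])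
        (use r in auto)
    have "\<bar>u t\<bar> \<le> B * (1/2) ^ Suc n" if "t \<in> ?J" for t
    proof -
      have "B * (1/2) ^ Suc n * r \<le> B * (1/2) ^ Suc n"
        using r B0 by (intro mult_right_le_one_le) auto
      then show ?thesis using u(3)[OF that] by linarith
    qed
    then have "P (Suc n) (u, v) \<and> Q p (u, v)"
      using u v v' by (auto simp: P_def Q_def)
    then show "\<exists>p'. P (Suc n) p' \<and> Q p p'" by blast
  qed
  then obtain f where P: "\<And>n. P n (f n)" and Q: "\<And>n. Q (f n) (f (Suc n))" by blast
  define \<phi> where "\<phi> n = fst (f n)" for n
  define \<psi> where "\<psi> n = snd (f n)" for n
  define \<psi>' where "\<psi>' n t = (case n of 0 \<Rightarrow> 0 | Suc m \<Rightarrow> - h t * \<phi> m t)" for n t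
  have f0: "\<phi> 0 = (\<lambda>t. a + b * t)" "\<psi> 0 = (\<lambda>t. b)"
    using P[of 0] by (auto simp: P_def \<phi>_def \<psi>_def)
  have z: "\<phi> (Suc n) 0 = 0" "\<psi> (Suc n) 0 = 0" for n
    using Q[of n] by (auto simp: Q_def \<phi>_def \<psi>_def)
  have \<phi>: "(\<phi> n has_real_derivative \<psi> n t) (at t within ?J)" "\<bar>\<phi> n t\<bar> \<le> B * (1/2) ^ n"
    "\<bar>\<psi> n t\<bar> \<le> B * (1/2) ^ n" if "t \<in> ?J" for n t
    using P[of n] that by (auto simp: P_def \<phi>_def \<psi>_def)
  have \<psi>: "(\<psi> n has_real_derivative \<psi>' n t) (at t within ?J)" if "t \<in> ?J" for n t
    using Q[of "n - 1"] that f0 by (cases n) (auto simp: Q_def \<phi>_def \<psi>_def \<psi>'_def)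
  have \<psi>'_bound: "\<bar>\<psi>' n t\<bar> \<le> (2 * M * B) * (1/2) ^ n" if "t \<in> ?J" for n t
  proof (cases n)
    case 0
    have "0 \<le> M" using M[OF that] by linarith
    then show ?thesis using 0 by (simp add: \<psi>'_def B_def)
  next
    case (Suc m)
    have "\<bar>h t * \<phi> m t\<bar> \<le> M * (B * (1/2) ^ m)"
      unfolding abs_mult
      by (rule mult_mono) (use M[OF that] \<phi>(2)[OF that] abs_ge_zero[of "h t"] in \<open>auto intro: order_trans\<close>)
    then show ?thesis using Suc by (simp add: \<psi>'_def)
  qed
  have geo: "summable (\<lambda>n. c * (1/2) ^ n)" for c :: real
    by (intro summable_mult summable_geometric) simp
  have uc: "uniformly_convergent_on ?J (\<lambda>n t. \<Sum>i<n. \<psi> i t)" "uniformly_convergent_on ?J (\<lambda>n t. \<Sum>i<n. \<psi>' i t)"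
    by (rule Weierstrass_m_test'[OF _ geo[of B]], use \<phi>(3) in simp,
        rule Weierstrass_m_test'[OF _ geo[of "2 * M * B"]], use \<psi>'_bound in simp)
  have J0: "0 \<in> ?J" using r by auto
  have s0: "summable (\<lambda>n. \<phi> n 0)" "summable (\<lambda>n. \<psi> n 0)"
    by (rule summable_comparison_test'[OF geo[of B]], use \<phi>[OF J0] in simp)+
  have int: "t \<in> interior ?J" "t \<in> ?J" if "t \<in> {-r<..<r}" for t using that by auto
  define w where "w t = (\<Sum>n. \<phi> n t)" for t
  define w' where "w' t = (\<Sum>n. \<psi> n t)" for t
  have "w 0 = a" unfolding w_def
    using suminf_split_head[OF s0(1)] z f0 by simp
  moreover have "w' 0 = b" unfolding w'_def
    using suminf_split_head[OF s0(2)] z f0 by simp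
  moreover have "(w has_real_derivative w' t) (at t)" if "t \<in> {-r<..<r}" for t
    unfolding w_def[abs_def] w'_def
    by (rule has_field_derivative_series'(2)[OF _ \<phi>(1) uc(1) J0 s0(1) int(1)[OF that]]) auto
  moreover have "(w' has_real_derivative - h t * w t) (at t)" if t: "t \<in> {-r<..<r}" for t
  proof -
    have "(w' has_real_derivative (\<Sum>n. \<psi>' n t)) (at t)"
      unfolding w'_def[abs_def]
      by (rule has_field_derivative_series'(2)[OF _ \<psi> uc(2) J0 s0(2) int(1)[OF t]]) auto
    moreover have "(\<Sum>n. \<psi>' n t) = - h t * w t"
    proof -
      have "summable (\<lambda>n. \<psi>' n t)"
        by (rule summable_comparison_test'[OF geo[of "2 * M * B"]]) (use \<psi>'_bound[OF int(2)[OF t]] in simp)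
      from suminf_split_head[OF this] have "(\<Sum>n. \<psi>' n t) = (\<Sum>n. \<psi>' (Suc n) t)"
        by (simp add: \<psi>'_def[of 0])
      also have "\<dots> = (\<Sum>n. - h t * \<phi> n t)" by (simp add: \<psi>'_def)
      also have "\<dots> = - h t * w t" unfolding w_def
        by (rule suminf_mult, rule summable_comparison_test'[OF geo[of B]]) (use \<phi>(2)[OF int(2)[OF t]] in simp)
      finally show ?thesis .
    qed
    ultimately show ?thesis by simp
  qed
  ultimately show ?thesis by (rule that)
qed

text \<open>
  The length of the interval is chosen from a bound for \<open>h\<close> alone, so that one interval serves all
  initial values; solutions inherit the smoothness of \<open>h\<close> through the equation itself.
\<close>

lemma linear_ode_solutions_smooth:
  assumes "d > 0" and h: "smooth_on {-d<..<d} h"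
  obtains r where "0 < r" "r \<le> d"
    "\<And>a b. \<exists>w w'. w 0 = a \<and> w' 0 = b \<and> smooth_on {-r<..<r} w \<and> smooth_on {-r<..<r} w' \<and>
       (\<forall>t\<in>{-r<..<r}. (w has_real_derivative w' t) (at t) \<and> (w' has_real_derivative - h t * w t) (at t))"
proof -
  have "compact ((\<lambda>t. h t) ` {-d/2..d/2})"
    by (rule compact_continuous_image[OF continuous_on_subset[OF smooth_on_continuous_on[OF h]]])
      (use assms(1) in auto)
  then obtain M where M: "\<And>t. t \<in> {-d/2..d/2} \<Longrightarrow> \<bar>h t\<bar> \<le> M" "M > 0"
    by (force simp: bounded_pos dest!: compact_imp_bounded)
  define r where "r = min (d/2) (min 1 (1 / (2 * M)))"
  have r: "0 < r" "r \<le> 1" "r \<le> d / 2" "r \<le> 1 / (2 * M)"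
    using assms(1) M(2) by (auto simp: r_def)
  have c: "continuous_on {-r..r} h"
    by (rule continuous_on_subset[OF smooth_on_continuous_on[OF h]]) (use r assms(1) in auto)
  have small: "M * r \<le> 1/2" using r(4) M(2) by (simp add: field_simps)
  have bd: "\<bar>h t\<bar> \<le> M" if "t \<in> {-r..r}" for t using M(1)[of t] that r by auto
  have hr: "smooth_on {-r<..<r} h" by (rule smooth_on_subset[OF h]) (use r assms(1) in auto)
  show ?thesis
  proof (rule that)
    show "0 < r" "r \<le> d" using r assms(1) by auto
    fix a b
    obtain w w' where w: "w 0 = a" "w' 0 = b"
      "\<And>t. t \<in> {-r<..<r} \<Longrightarrow> (w has_real_derivative w' t) (at t)"
      "\<And>t. t \<in> {-r<..<r} \<Longrightarrow> (w' has_real_derivative - h t * w t) (at t)"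
      using linear_ode_solution[OF r(1,2) c bd small] by metis
    have "higher_differentiable_on {-r<..<r} w n \<and> higher_differentiable_on {-r<..<r} w' n" for n
    proof (induction n)
      case 0
      show ?case using w(3,4)
        by (simp, intro conjI continuous_at_imp_continuous_on ballI) (blast intro: DERIV_isCont)+
    next
      case (Suc n)
      have "higher_differentiable_on {-r<..<r} (\<lambda>t. - h t * w t) n"
        using smooth_on_minus[OF _ hr] Suc
        by (intro higher_differentiable_on_bilinear[OF _ bounded_bilinear_mult]) (auto simp: smooth_on_def)
      then show ?case
        using w(3,4) Suc higher_differentiable_on_SucI_real[of "{-r<..<r}" w w' n]
          higher_differentiable_on_SucI_real[of "{-r<..<r}" w' "\<lambda>t. - h t * w t" n]
        unfolding has_real_derivative_iff_has_vector_derivative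
        by (simp del: higher_differentiable_on.simps)
    qed
    then show "\<exists>w w'. w 0 = a \<and> w' 0 = b \<and> smooth_on {-r<..<r} w \<and> smooth_on {-r<..<r} w' \<and>
       (\<forall>t\<in>{-r<..<r}. (w has_real_derivative w' t) (at t) \<and> (w' has_real_derivative - h t * w t) (at t))"
      using w unfolding smooth_on_def by blast
  qed
qed

section \<open>Borel's theorem\<close>

lemma derivative_sequence_antiderivative:
  assumes T: "derivative_sequence {-1..1} T" and bd: "\<And>t. t \<in> {-1..1} \<Longrightarrow> \<bar>T 0 t\<bar> \<le> C"
  obtains T' where "derivative_sequence {-1..1} T'" "\<And>k. T' (Suc k) = T k" "T' 0 0 = 0"
    and "\<And>t. t \<in> {-1..1} \<Longrightarrow> \<bar>T' 0 t\<bar> \<le> C"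
proof -
  have "continuous_on {-1..1} (T 0)"
    by (rule has_real_derivative_within_continuous_on[OF derivative_sequenceD[OF T]])
  from small_antiderivative[of 1, OF _ this bd] obtain G where G:
    "\<And>t. t \<in> {-1..1} \<Longrightarrow> (G has_real_derivative T 0 t) (at t within {-1..1})"
    "G 0 = 0" "\<And>t. t \<in> {-1..1} \<Longrightarrow> \<bar>G t\<bar> \<le> C"
    by auto
  have "derivative_sequence {-1..1} (case_nat G T)"
    using G(1) derivative_sequenceD[OF T]
    by (auto simp: derivative_sequence_def split: nat.split simp del: atLeastAtMost_iff)
  then show ?thesis by (rule that) (use G in auto)
qed

text \<open>
  A correction term for Borel's lemma: it prescribes the derivative of order \<open>n + 1\<close> at \<open>0\<close> while the
  lower derivatives vanish there and are small on the whole interval. Start with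
  \<open>a r sin (t / r)\<close>, whose derivative at \<open>0\<close> is \<open>a\<close> although its size is only \<open>\<bar>a\<bar> r\<close>, and integrate \<open>n\<close>
  times; integration from \<open>0\<close> over an interval of length at most \<open>1\<close> does not enlarge the bound.
\<close>

lemma derivative_sequence_small:
  fixes a :: real
  assumes "\<epsilon> > 0"
  obtains T where "derivative_sequence {-1..1} T" "\<And>k. k \<le> n \<Longrightarrow> T k 0 = 0" "T (Suc n) 0 = a"
    and "\<And>k t. k \<le> n \<Longrightarrow> t \<in> {-1..1} \<Longrightarrow> \<bar>T k t\<bar> \<le> \<epsilon>"
proof -
  have "\<exists>T. derivative_sequence {-1..1} T \<and> (\<forall>k\<le>n. T k 0 = 0) \<and> T (Suc n) 0 = a \<and>
      (\<forall>k\<le>n. \<forall>t\<in>{-1..1}. \<bar>T k t\<bar> \<le> \<epsilon>)"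
  proof (induction n)
    case 0
    define r where "r = \<epsilon> / (\<bar>a\<bar> + 1)"
    have r: "r > 0" "\<bar>a\<bar> * r \<le> \<epsilon>" using assms by (auto simp: r_def field_simps)
    define T where "T k t = a * r * (1 / r) ^ k * sin (t / r + k * (pi / 2))" for k t
    have "(T k has_real_derivative T (Suc k) t) (at t)" for k t
    proof -
      have "sin (t / r + Suc k * (pi / 2)) = sin ((t / r + k * (pi / 2)) + pi / 2)"
        by (simp add: algebra_simps add_divide_distrib)
      also have "\<dots> = cos (t / r + k * (pi / 2))" by (subst sin_add) simp
      finally have *: "sin (t / r + Suc k * (pi / 2)) = cos (t / r + k * (pi / 2))" .
      show ?thesis unfolding T_def * using r(1)
        by (auto intro!: derivative_eq_intros)
    qed
    then have "derivative_sequence {-1..1} T"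
      by (auto simp: derivative_sequence_def intro: has_field_derivative_at_within)
    moreover have "T 0 0 = 0" "T (Suc 0) 0 = a" using r(1) by (auto simp: T_def)
    moreover have "\<bar>T 0 t\<bar> \<le> \<epsilon>" for t
    proof -
      have "\<bar>T 0 t\<bar> = (\<bar>a\<bar> * r) * \<bar>sin (t / r)\<bar>" using r(1) by (simp add: T_def abs_mult)
      also have "\<dots> \<le> (\<bar>a\<bar> * r) * 1" using r(1) by (intro mult_left_mono) auto
      finally show ?thesis using r(2) by simp
    qed
    ultimately show ?case by (intro exI[of _ T]) auto
  next
    case (Suc n)
    then obtain T where T: "derivative_sequence {-1..1} T" "\<forall>k\<le>n. T k 0 = 0" "T (Suc n) 0 = a"
      "\<forall>k\<le>n. \<forall>t\<in>{-1..1}. \<bar>T k t\<bar> \<le> \<epsilon>" by blast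
    obtain T' where T': "derivative_sequence {-1..1} T'" "\<And>k. T' (Suc k) = T k" "T' 0 0 = 0"
      "\<And>t. t \<in> {-1..1} \<Longrightarrow> \<bar>T' 0 t\<bar> \<le> \<epsilon>"
      using derivative_sequence_antiderivative[OF T(1)] T(4) by (metis le0)
    have "T' k 0 = 0 \<and> (\<forall>t\<in>{-1..1}. \<bar>T' k t\<bar> \<le> \<epsilon>)" if "k \<le> Suc n" for k
      using T T' that by (cases k) auto
    then show ?case using T T' by (intro exI[of _ T']) auto
  qed
  then show ?thesis using that by blast
qed

lemma derivative_sequence_add:
  "derivative_sequence S T \<Longrightarrow> derivative_sequence S T' \<Longrightarrow>
    derivative_sequence S (\<lambda>k t. T k t + T' k t)"
  unfolding derivative_sequence_def by (auto intro: DERIV_add)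

text \<open>
  Partial sums are chosen one after the other: the \<open>n\<close>-th one has the right derivatives at \<open>0\<close> up to
  order \<open>n\<close>, and passing to the next one changes the derivatives of order at most \<open>n\<close> by no more
  than \<open>2\<close> to the power \<open>-n\<close>. So for each order the derivatives converge uniformly.
\<close>

theorem borel_lemma:
  fixes c :: "nat \<Rightarrow> real"
  obtains T where "derivative_sequence {-1<..<1} T" "\<And>k. T k 0 = c k"
proof -
  let ?J = "{-1..1} :: real set"
  have "\<exists>S. \<forall>n. (derivative_sequence ?J (S n) \<and> (\<forall>k\<le>n. S n k 0 = c k)) \<and>
      (\<forall>k\<le>n. \<forall>t\<in>?J. \<bar>S (Suc n) k t - S n k t\<bar> \<le> (1/2) ^ n)"
  proof (rule dependent_nat_choice)
    have "derivative_sequence ?J (\<lambda>k t. if k = 0 then c 0 else 0)"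
      by (auto simp: derivative_sequence_def)
    then show "\<exists>S. derivative_sequence ?J S \<and> (\<forall>k\<le>0. S k 0 = c k)"
      by (intro exI[of _ "\<lambda>k t. if k = 0 then c 0 else 0"]) auto
  next
    fix S :: "nat \<Rightarrow> real \<Rightarrow> real" and n
    assume S: "derivative_sequence ?J S \<and> (\<forall>k\<le>n. S k 0 = c k)"
    obtain T where T: "derivative_sequence ?J T" "\<And>k. k \<le> n \<Longrightarrow> T k 0 = 0"
      "T (Suc n) 0 = c (Suc n) - S (Suc n) 0"
      "\<And>k t. k \<le> n \<Longrightarrow> t \<in> ?J \<Longrightarrow> \<bar>T k t\<bar> \<le> (1/2) ^ n"
      using derivative_sequence_small[of "(1/2) ^ n" n "c (Suc n) - S (Suc n) 0"] by auto
    show "\<exists>S'. (derivative_sequence ?J S' \<and> (\<forall>k\<le>Suc n. S' k 0 = c k)) \<and>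
        (\<forall>k\<le>n. \<forall>t\<in>?J. \<bar>S' k t - S k t\<bar> \<le> (1/2) ^ n)"
    proof (intro exI[of _ "\<lambda>k t. S k t + T k t"] conjI)
      show "derivative_sequence ?J (\<lambda>k t. S k t + T k t)"
        using derivative_sequence_add S T(1) by blast
      show "\<forall>k\<le>Suc n. S k 0 + T k 0 = c k" using S T(2,3) by (auto simp: le_Suc_eq)
    qed (use T(4) in auto)
  qed
  then obtain S where S: "\<And>n. derivative_sequence ?J (S n)" "\<And>n k. k \<le> n \<Longrightarrow> S n k 0 = c k"
    "\<And>n k t. k \<le> n \<Longrightarrow> t \<in> ?J \<Longrightarrow> \<bar>S (Suc n) k t - S n k t\<bar> \<le> (1/2) ^ n"
    by metis
  \<comment> \<open>The \<open>k\<close>-th derivatives of the increments, counted from the \<open>m\<close>-th partial sum on. The sum for order \<open>k\<close> starts at \<open>m = k\<close>, where the estimate for that order begins.\<close>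
  define f where "f m k i t = S (Suc (i + m)) k t - S (i + m) k t" for m k i t
  define T where "T k t = S k k t + (\<Sum>i. f k k i t)" for k t
  have geo: "summable (\<lambda>i. (1/2::real) ^ i)" by (intro summable_geometric) simp
  have f_bound: "\<bar>f m k i t\<bar> \<le> (1/2) ^ i" if "k \<le> i + m" "t \<in> ?J" for m k i t
  proof -
    have "\<bar>f m k i t\<bar> \<le> (1/2) ^ (i + m)" using S(3)[OF that] by (simp add: f_def)
    also have "\<dots> \<le> (1/2) ^ i" by (intro power_decreasing) auto
    finally show ?thesis .
  qed
  have summ: "summable (\<lambda>i. f m k i t)" if "t \<in> ?J" "k \<le> Suc m" for m k t
  proof (rule summable_comparison_test'[OF geo, of 1])
    show "norm (f m k i t) \<le> (1/2) ^ i" if "1 \<le> i" for i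
      using f_bound[of k i m t] that \<open>t \<in> ?J\<close> \<open>k \<le> Suc m\<close> by simp
  qed
  have step: "(T k has_real_derivative T (Suc k) t) (at t)" if t: "t \<in> {-1<..<1}" for k t
  proof -
    have tJ: "t \<in> ?J" using t by auto
    have "((\<lambda>t. \<Sum>i. f k k i t) has_real_derivative (\<Sum>i. f k (Suc k) i t)) (at t)"
    proof (rule has_field_derivative_series'(2)[where S = ?J])
      show "(f k k i has_real_derivative f k (Suc k) i t) (at t within ?J)" if "t \<in> ?J" for i t
        unfolding f_def[abs_def] by (intro DERIV_diff derivative_sequenceD[OF S(1) that])
      have "\<forall>\<^sub>F i in sequentially. \<forall>t\<in>?J. norm (f k (Suc k) i t) \<le> (1/2) ^ i"
        using eventually_ge_at_top[of 1] by eventually_elim (use f_bound in auto)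
      then show "uniformly_convergent_on ?J (\<lambda>n t. \<Sum>i<n. f k (Suc k) i t)"
        by (rule Weierstrass_m_test'_ev[OF _ geo])
      show "summable (\<lambda>i. f k k i 0)" by (rule summ) auto
      show "t \<in> interior ?J" using t by simp
    qed auto
    moreover have "(S k k has_real_derivative S k (Suc k) t) (at t)"
      using derivative_sequenceD[OF S(1) tJ, of k k] t at_within_interior[of t ?J] by simp
    ultimately have "(T k has_real_derivative S k (Suc k) t + (\<Sum>i. f k (Suc k) i t)) (at t)"
      unfolding T_def[abs_def] by (rule DERIV_add[rotated])
    also have "S k (Suc k) t + (\<Sum>i. f k (Suc k) i t) = T (Suc k) t"
    proof -
      have "(\<Sum>i. f k (Suc k) (Suc i) t) = (\<Sum>i. f k (Suc k) i t) - f k (Suc k) 0 t"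
        by (rule suminf_split_head[OF summ[OF tJ]]) simp
      moreover have "f k (Suc k) (Suc i) t = f (Suc k) (Suc k) i t" for i by (simp add: f_def)
      ultimately show ?thesis by (simp add: T_def f_def)
    qed
    finally show ?thesis .
  qed
  show ?thesis
  proof (rule that)
    show "derivative_sequence {-1<..<1} T"
      using step by (auto simp: derivative_sequence_def intro: has_field_derivative_at_within)
    show "T k 0 = c k" for k using S(2) by (simp add: T_def f_def)
  qed
qed

section \<open>Smooth functions of the square of the parameter\<close>

text \<open>
  Flatness at \<open>0\<close>, the vanishing of all derivatives, expressed by divisibility. In this form it passes
  to derivatives and to quotients by \<open>t\<close> without any computation of higher derivatives.
\<close>

definition flat_on :: "real set \<Rightarrow> (real \<Rightarrow> real) \<Rightarrow> bool" where
  "flat_on S f \<longleftrightarrow> (\<forall>n. \<exists>g. smooth_on S g \<and> (\<forall>t\<in>S. f t = t ^ n * g t))"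

lemma flat_on_smooth_on: "open S \<Longrightarrow> flat_on S f \<Longrightarrow> smooth_on S f"
  unfolding flat_on_def by (elim allE[of _ 0]) (auto intro: smooth_on_cong)

text \<open>
  At \<open>t = 0\<close> the quotient is \<open>0\<close> by the convention for division; this is the value of its smooth
  extension, since one more power of \<open>t\<close> than the quotient needs is split off from \<open>f\<close>.
\<close>

lemma flat_on_divide_parameter:
  assumes "open S" "flat_on S f"
  shows "flat_on S (\<lambda>t. c * f t / t)" unfolding flat_on_def
proof
  fix n
  obtain g where g: "smooth_on S g" "\<And>t. t \<in> S \<Longrightarrow> f t = t ^ Suc (Suc n) * g t"
    using assms(2) unfolding flat_on_def by blast
  show "\<exists>g. smooth_on S g \<and> (\<forall>t\<in>S. c * f t / t = t ^ n * g t)"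
    by (rule exI[of _ "\<lambda>t. c * t * g t"]) (use g assms(1) in \<open>auto intro!: smooth_intros\<close>)
qed

lemma flat_on_derivative:
  assumes S: "open S" "flat_on S f" and d: "\<And>t. t \<in> S \<Longrightarrow> (f has_vector_derivative f' t) (at t)"
  shows "flat_on S f'" unfolding flat_on_def
proof
  fix n
  obtain g where g: "smooth_on S g" "\<And>t. t \<in> S \<Longrightarrow> f t = t ^ Suc n * g t"
    using assms(2) unfolding flat_on_def by blast
  obtain g' where g': "smooth_on S g'" "\<And>t. t \<in> S \<Longrightarrow> (g has_vector_derivative g' t) (at t)"
    using smooth_on_derivativeE[OF S(1) g(1)] by blast
  have "f' t = t ^ n * (Suc n * g t + t * g' t)" if t: "t \<in> S" for t
  proof -
    have "((\<lambda>t. t ^ Suc n * g t) has_real_derivative Suc n * t ^ n * g t + t ^ Suc n * g' t) (at t)"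
    proof -
      have "(g has_real_derivative g' t) (at t)"
        using g'(2)[OF t] by (simp add: has_real_derivative_iff_has_vector_derivative)
      from DERIV_mult[OF DERIV_power_Suc[OF DERIV_ident, of n] this] show ?thesis
        by (simp add: algebra_simps)
    qed
    moreover have "((\<lambda>t. t ^ Suc n * g t) has_real_derivative f' t) (at t)"
      using has_vector_derivative_transform_within_open[OF d[OF t] S(1) t g(2)]
      by (simp add: has_real_derivative_iff_has_vector_derivative)
    ultimately show ?thesis using DERIV_unique by (fastforce simp: algebra_simps)
  qed
  moreover have "smooth_on S (\<lambda>t. Suc n * g t + t * g' t)"
    using g(1) g'(1) S(1) by (intro smooth_intros)
  ultimately show "\<exists>g. smooth_on S g \<and> (\<forall>t\<in>S. f' t = t ^ n * g t)" by blast
qed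

text \<open>
  For \<open>x > 0\<close> the derivative of \<open>f (sqrt x)\<close> is \<open>g (sqrt x)\<close> with \<open>g t = f' t / (2 * t)\<close>, and \<open>g\<close> is flat again;
  at \<open>x = 0\<close> the difference quotient tends to \<open>0\<close> because \<open>f\<close> is divisible by \<open>t ^ 4\<close>. Hence the
  functions of this form are closed under differentiation.
\<close>

lemma flat_on_sqrt_smooth:
  assumes "e > 0" and f: "flat_on {-e<..<e} f"
  shows "smooth_on {..<e\<^sup>2} (\<lambda>x. if x > 0 then f (sqrt x) else 0)"
proof (rule smooth_on_coinduct[where X = "{\<lambda>x. if x > 0 then f (sqrt x) else 0 | f. flat_on {-e<..<e} f}"])
  fix F :: "real \<Rightarrow> real"
  assume "F \<in> {\<lambda>x. if x > 0 then f (sqrt x) else 0 | f. flat_on {-e<..<e} f}"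
  then obtain f where F: "F = (\<lambda>x. if x > 0 then f (sqrt x) else 0)" and f: "flat_on {-e<..<e} f"
    by auto
  obtain f' where f': "\<And>t. t \<in> {-e<..<e} \<Longrightarrow> (f has_vector_derivative f' t) (at t)"
    using smooth_on_derivativeE[OF _ flat_on_smooth_on[OF _ f]] by auto
  define g where "g t = (1/2) * f' t / t" for t
  have g: "flat_on {-e<..<e} g"
    unfolding g_def[abs_def]
    by (rule flat_on_divide_parameter) (use flat_on_derivative[OF _ f f'] in auto)
  define G where "G = (\<lambda>x. if x > 0 then g (sqrt x) else 0)"
  have "(F has_real_derivative G x) (at x)" if "x < e\<^sup>2" for x
  proof (cases rule: linorder_cases[of x 0])
    case less
    have "(F has_real_derivative 0) (at x)"
      by (rule has_field_derivative_transform_within_open[OF DERIV_const[of 0], of "{..<0}"])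
        (use less in \<open>auto simp: F\<close>)
    then show ?thesis using less by (simp add: G_def)
  next
    case greater
    have "sqrt x < e" using real_sqrt_less_mono[OF that] assms(1) by simp
    then have "sqrt x \<in> {-e<..<e}"
      using assms(1) real_sqrt_gt_zero[OF greater] unfolding greaterThanLessThan_iff by linarith
    then have "(f has_real_derivative f' (sqrt x)) (at (sqrt x))"
      using f' by (simp add: has_real_derivative_iff_has_vector_derivative)
    from DERIV_chain2[OF this DERIV_real_sqrt[OF greater]]
    have "((\<lambda>x. f (sqrt x)) has_real_derivative G x) (at x)"
      using greater by (simp add: G_def g_def field_simps)
    then show ?thesis
      by (rule has_field_derivative_transform_within_open[where S = "{0<..}"])
        (use greater in \<open>auto simp: F\<close>)
  next
    case equal
    obtain k where k: "smooth_on {-e<..<e} k" "\<And>t. t \<in> {-e<..<e} \<Longrightarrow> f t = t ^ 4 * k t"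
      using f unfolding flat_on_def by blast
    have "isCont k 0"
      using smooth_on_continuous_on[OF k(1)] assms(1) by (simp add: continuous_on_eq_continuous_at)
    then have "((\<lambda>x. k (sqrt \<bar>x\<bar>)) \<longlongrightarrow> k 0) (at 0)"
      by (intro isCont_tendsto_compose[of 0 k]) (auto intro!: tendsto_eq_intros)
    then have "((\<lambda>x. \<bar>x\<bar> * \<bar>k (sqrt \<bar>x\<bar>)\<bar>) \<longlongrightarrow> 0) (at 0)"
      by (auto intro!: tendsto_eq_intros)
    moreover have "\<forall>\<^sub>F x in at 0. norm (F x / x) \<le> \<bar>x\<bar> * \<bar>k (sqrt \<bar>x\<bar>)\<bar>"
    proof -
      have "\<forall>\<^sub>F x in at 0. \<bar>x\<bar> < e\<^sup>2"
        using assms(1) by (intro order_tendstoD(2)[of "\<lambda>x. \<bar>x\<bar>" 0]) (auto intro!: tendsto_eq_intros)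
      then show ?thesis
      proof eventually_elim
        case (elim x)
        show ?case
        proof (cases "x > 0")
          case True
          have "sqrt x < e" using real_sqrt_less_mono[of x "e\<^sup>2"] elim True assms(1) by simp
          then have "sqrt x \<in> {-e<..<e}"
            using assms(1) real_sqrt_gt_zero[OF True] unfolding greaterThanLessThan_iff by linarith
          then have "F x = x\<^sup>2 * k (sqrt x)"
            using k(2) True by (simp add: F power4_eq_xxxx power2_eq_square)
          then show ?thesis using True by (simp add: power2_eq_square abs_mult)
        qed (simp add: F mult_nonpos_nonneg)
      qed
    qed
    ultimately have "((\<lambda>x. F x / x) \<longlongrightarrow> 0) (at 0)" by (rule Lim_null_comparison[rotated])
    then show ?thesis using equal by (simp add: has_field_derivative_iff F G_def)
  qed
  moreover have "G \<in> {\<lambda>x. if x > 0 then f (sqrt x) else 0 | f. flat_on {-e<..<e} f}"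
    using g by (auto simp: G_def)
  ultimately show "\<exists>g\<in>{\<lambda>x. if x > 0 then f (sqrt x) else 0 | f. flat_on {-e<..<e} f}.
      \<forall>x\<in>{..<e\<^sup>2}. (F has_vector_derivative g x) (at x)"
    by (intro bexI[of _ G]) (simp_all add: has_real_derivative_iff_has_vector_derivative)
qed (use f in auto)

lemma flat_on_reflect:
  assumes "flat_on {-e<..<e} f"
  shows "flat_on {-e<..<e} (\<lambda>t. f (- t))" unfolding flat_on_def
proof
  fix n
  obtain g where g: "smooth_on {-e<..<e} g" "\<And>t. t \<in> {-e<..<e} \<Longrightarrow> f t = t ^ n * g t"
    using assms unfolding flat_on_def by blast
  have *: "f (- t) = t ^ n * ((-1) ^ n * g (- t))" if "t \<in> {-e<..<e}" for t
    using g(2)[of "- t"] that power_minus[of t n] by auto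
  have "smooth_on {-e<..<e} (\<lambda>t. g (- t))"
    by (rule smooth_on_compose[OF _ _ smooth_on_minus[OF _ smooth_on_id] g(1)]) auto
  then show "\<exists>g. smooth_on {-e<..<e} g \<and> (\<forall>t\<in>{-e<..<e}. f (- t) = t ^ n * g t)"
    using smooth_on_mult[OF _ smooth_on_const, of "{-e<..<e}" "\<lambda>t. g (- t)" "(-1) ^ n"] *
    by (intro exI[of _ "\<lambda>t. (-1) ^ n * g (- t)"]) simp
qed

lemma flat_on_combination:
  assumes "open S" "flat_on S f" "flat_on S g"
  shows "flat_on S (\<lambda>t. a * f t + b * g t)" unfolding flat_on_def
proof
  fix n
  obtain h where h: "smooth_on S h" "\<And>t. t \<in> S \<Longrightarrow> f t = t ^ n * h t"
    using assms(2) unfolding flat_on_def by blast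
  obtain k where k: "smooth_on S k" "\<And>t. t \<in> S \<Longrightarrow> g t = t ^ n * k t"
    using assms(3) unfolding flat_on_def by blast
  show "\<exists>h. smooth_on S h \<and> (\<forall>t\<in>S. a * f t + b * g t = t ^ n * h t)"
    by (rule exI[of _ "\<lambda>t. a * h t + b * k t"])
      (use assms(1) h k in \<open>auto intro!: smooth_intros simp: algebra_simps\<close>)
qed

lemma flat_on_split_square:
  assumes "e > 0" and f: "flat_on {-e<..<e} f"
  obtains P Q where "smooth_on {..<e\<^sup>2} P" "smooth_on {..<e\<^sup>2} Q"
    and "\<And>t. t \<in> {-e<..<e} \<Longrightarrow> f t = P (t\<^sup>2) + t * Q (t\<^sup>2)"
proof -
  define p where "p t = (1/2) * f t + (1/2) * f (- t)" for t
  define q where "q t = 1 * ((1/2) * f t + (-1/2) * f (- t)) / t" for t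
  have "flat_on {-e<..<e} p" "flat_on {-e<..<e} q"
    unfolding p_def[abs_def] q_def[abs_def]
    by (intro flat_on_combination flat_on_divide_parameter f flat_on_reflect open_greaterThanLessThan)+
  note smooth = this[THEN flat_on_sqrt_smooth[OF assms(1)]]
  have f0: "f 0 = 0" using f assms(1) unfolding flat_on_def by (force dest: spec[of _ 1])
  show ?thesis
  proof (rule that[OF smooth])
    fix t assume "t \<in> {-e<..<e}"
    have "p \<bar>t\<bar> = p t" "q \<bar>t\<bar> = q t" by (auto simp: p_def q_def abs_if diff_divide_distrib)
    moreover have "f t = p t + t * q t" if "t \<noteq> 0" using that by (simp add: p_def q_def field_simps)
    ultimately show "f t = (if t\<^sup>2 > 0 then p (sqrt (t\<^sup>2)) else 0) + t * (if t\<^sup>2 > 0 then q (sqrt (t\<^sup>2)) else 0)"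
      using f0 by (cases "t = 0") auto
  qed
qed

text \<open>
  Whitney's theorem on even functions, in a form that treats the even and the odd part together.
  Borel's lemma provides \<open>P\<close> and \<open>Q\<close> whose Taylor coefficients are those of \<open>f\<close> with even and with odd
  index. Then \<open>f(t) - P(t\<^sup>2) - t Q(t\<^sup>2)\<close> is flat, and a flat function splits in the same way.
\<close>

theorem smooth_on_split_square:
  fixes f :: "real \<Rightarrow> real"
  assumes e: "e > 0" "e \<le> 1" and f: "smooth_on {-e<..<e} f"
  obtains P Q where "smooth_on {-(e\<^sup>2)<..<e\<^sup>2} P" "smooth_on {-(e\<^sup>2)<..<e\<^sup>2} Q"
    and "\<And>t. t \<in> {-e<..<e} \<Longrightarrow> f t = P (t\<^sup>2) + t * Q (t\<^sup>2)"
proof -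
  let ?I = "{-e<..<e}" and ?K = "{-(e\<^sup>2)<..<e\<^sup>2}"
  obtain T where T: "derivative_sequence ?I T" "T 0 = f"
    using smooth_on_derivative_sequence[OF _ f] by auto
  define c where "c i = T i 0 / fact i" for i
  obtain P where P: "derivative_sequence {-1<..<1} P" "\<And>k. P k 0 = fact k * c (2 * k)"
    using borel_lemma[of "\<lambda>k. fact k * c (2 * k)"] by blast
  obtain Q where Q: "derivative_sequence {-1<..<1} Q" "\<And>k. Q k 0 = fact k * c (2 * k + 1)"
    using borel_lemma[of "\<lambda>k. fact k * c (2 * k + 1)"] by blast
  have e2: "e\<^sup>2 \<le> 1" using e by (simp add: power_le_one)
  have sq: "t\<^sup>2 \<in> {-1<..<1}" "t\<^sup>2 < e\<^sup>2" if "t \<in> ?I" for t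
  proof -
    have "\<bar>t\<bar> < \<bar>e\<bar>" using that e by auto
    then show "t\<^sup>2 < e\<^sup>2" using power_strict_mono[of "\<bar>t\<bar>" "\<bar>e\<bar>" 2] by simp
    then show "t\<^sup>2 \<in> {-1<..<1}" using e2 zero_le_power2[of t] unfolding greaterThanLessThan_iff by linarith
  qed
  have smsq: "smooth_on ?I (\<lambda>t. h (t\<^sup>2))" if "smooth_on {-1<..<1} h" for h :: "real \<Rightarrow> real"
    by (rule smooth_on_compose[OF _ _ _ that]) (use sq in \<open>auto intro!: smooth_intros\<close>)
  define k where "k t = f t - (P 0 (t\<^sup>2) + t * Q 0 (t\<^sup>2))" for t
  have "flat_on ?I k" unfolding flat_on_def
  proof
    fix n
    obtain g where g: "smooth_on ?I g"
      "\<And>t. t \<in> ?I \<Longrightarrow> T 0 t = (\<Sum>i<2 * n. c i * t ^ i) + t ^ (2 * n) * g t"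
      unfolding c_def using taylor_smooth_remainder[OF T(1)] by blast
    obtain p where p: "smooth_on {-1<..<1} p"
      "\<And>t. t \<in> {-1<..<1} \<Longrightarrow> P 0 t = (\<Sum>i<n. P i 0 / fact i * t ^ i) + t ^ n * p t"
      using taylor_smooth_remainder[OF P(1)] by blast
    obtain q where q: "smooth_on {-1<..<1} q"
      "\<And>t. t \<in> {-1<..<1} \<Longrightarrow> Q 0 t = (\<Sum>i<n. Q i 0 / fact i * t ^ i) + t ^ n * q t"
      using taylor_smooth_remainder[OF Q(1)] by blast
    \<comment> \<open>The expansions leave the factor \<open>t ^ (2 * n)\<close>, of which \<open>t ^ n\<close> is kept in the quotient.\<close>
    define h where "h t = t ^ n * (g t - (p (t\<^sup>2) + t * q (t\<^sup>2)))" for t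
    have "smooth_on ?I h" unfolding h_def[abs_def]
      by (intro smooth_intros g smsq[OF p(1)] smsq[OF q(1)]) auto
    moreover have "k t = t ^ n * h t" if t: "t \<in> ?I" for t
    proof -
      let ?a = "\<lambda>i. c i * t ^ i"
      have "(\<Sum>i<2 * n. ?a i) = (\<Sum>i<n. ?a (2 * i)) + (\<Sum>i<n. ?a (2 * i + 1))"
        by (induction n) auto
      moreover have "P 0 (t\<^sup>2) = (\<Sum>i<n. ?a (2 * i)) + t ^ (2 * n) * p (t\<^sup>2)"
        unfolding p(2)[OF sq(1)[OF t]] P(2) by (simp add: power_mult)
      moreover have "t * Q 0 (t\<^sup>2) = (\<Sum>i<n. ?a (2 * i + 1)) + t ^ (2 * n) * (t * q (t\<^sup>2))"
        unfolding q(2)[OF sq(1)[OF t]] Q(2)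
        by (simp add: power_mult[symmetric] distrib_left sum_distrib_left mult_ac)
      ultimately have "k t = t ^ (2 * n) * (g t - (p (t\<^sup>2) + t * q (t\<^sup>2)))"
        using g(2)[OF t] by (simp add: k_def T(2) algebra_simps)
      then show ?thesis by (simp add: h_def mult_2 power_add)
    qed
    ultimately show "\<exists>g. smooth_on ?I g \<and> (\<forall>t\<in>?I. k t = t ^ n * g t)" by blast
  qed
  from flat_on_split_square[OF e(1) this] obtain P' Q' where
    PQ': "smooth_on {..<e\<^sup>2} P'" "smooth_on {..<e\<^sup>2} Q'" "\<And>t. t \<in> ?I \<Longrightarrow> k t = P' (t\<^sup>2) + t * Q' (t\<^sup>2)"
    by blast
  have "?K \<subseteq> {..<e\<^sup>2}" "?K \<subseteq> {-1<..<1}" using e2 by auto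
  then have K: "smooth_on ?K P'" "smooth_on ?K Q'" "smooth_on ?K (P 0)" "smooth_on ?K (Q 0)"
    using smooth_on_subset[OF PQ'(1), of ?K] smooth_on_subset[OF PQ'(2), of ?K]
      smooth_on_subset[OF derivative_sequence_smooth_on[OF _ P(1)], of ?K]
      smooth_on_subset[OF derivative_sequence_smooth_on[OF _ Q(1)], of ?K]
    by auto
  show ?thesis
  proof (rule that)
    show "smooth_on ?K (\<lambda>x. P 0 x + P' x)" "smooth_on ?K (\<lambda>x. Q 0 x + Q' x)"
      using K by (auto intro: smooth_intros)
    show "f t = (P 0 (t\<^sup>2) + P' (t\<^sup>2)) + t * (Q 0 (t\<^sup>2) + Q' (t\<^sup>2))" if "t \<in> ?I" for t
      using PQ'(3)[OF that] by (simp add: k_def algebra_simps)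
  qed
qed

section \<open>The normal form of a cusp\<close>

lemma diffeomorphism_sym: "diffeomorphism S T f g \<Longrightarrow> diffeomorphism T S g f"
  unfolding diffeomorphism_def using homeomorphism_sym[of S T f g] by blast

lemma diffeomorphism_restrict:
  assumes "diffeomorphism S T f g" "open U" "U \<subseteq> S"
  shows "diffeomorphism U (f ` U) f g"
proof -
  have h: "homeomorphism S T f g" and "open T" "smooth_on S f" "smooth_on T g"
    using assms(1) by (auto simp: diffeomorphism_def)
  have "f ` U = T \<inter> g -` U"
    using h assms(3) by (force simp: homeomorphism_def)
  moreover have "open (T \<inter> g -` U)"
    using h \<open>open T\<close> assms(2) by (intro continuous_open_preimage) (auto simp: homeomorphism_def)
  moreover have "f ` U \<subseteq> T" using h assms(3) by (auto simp: homeomorphism_def)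
  ultimately show ?thesis
    using assms(2) smooth_on_subset[OF \<open>smooth_on S f\<close> assms(3)]
      smooth_on_subset[OF \<open>smooth_on T g\<close>, of "f ` U"]
      homeomorphism_of_subsets[OF h assms(3), of "f ` U" "f ` U"]
    unfolding diffeomorphism_def by metis
qed

lemma smooth_on_vector_2:
  fixes f g :: "'a::real_normed_vector \<Rightarrow> real"
  assumes "open S" "smooth_on S f" "smooth_on S g"
  shows "smooth_on S (\<lambda>x. vector [f x, g x] :: real^2)"
  unfolding vector_2_eq
  by (intro smooth_on_add smooth_on_scaleR smooth_on_const assms)

lemma smooth_on_component: "open S \<Longrightarrow> smooth_on S (\<lambda>z::real^2. z $ i)"
  by (intro smooth_on_bounded_linear[OF _ bounded_linear_vec_nth] smooth_on_id)

lemma bracket_bilinear: "bounded_linear (\<lambda>z. c * bracket z b)" "bounded_linear (\<lambda>z. c * bracket a z)"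
  unfolding bracket_def
  by (intro bounded_linear_const_mult bounded_linear_sub bounded_linear_mult_const
      bounded_linear_vec_nth)+

lemma cramer_bracket:
  assumes "bracket a b \<noteq> 0"
  shows "v = (bracket v b / bracket a b) *\<^sub>R a + (bracket a v / bracket a b) *\<^sub>R b"
proof -
  have "bracket a b *\<^sub>R v = bracket v b *\<^sub>R a + bracket a v *\<^sub>R b"
    by (simp add: bracket_def vec_eq_iff forall_2 algebra_simps)
  then have "v = (1 / bracket a b) *\<^sub>R (bracket v b *\<^sub>R a + bracket a v *\<^sub>R b)"
    using assms by (metis divide_self_if scaleR_one scaleR_scaleR times_divide_eq_left mult_1)
  then show ?thesis by (simp add: scaleR_add_right)
qed

lemma curve_component_taylor:
  fixes L :: "real^2 \<Rightarrow> real"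
  assumes "smooth_on {-e<..<e} \<gamma>" "bounded_linear L"
  obtains g where "smooth_on {-e<..<e} g"
    and "\<And>t. t \<in> {-e<..<e} \<Longrightarrow> L (\<gamma> t) = (\<Sum>i<n. L (nderiv i \<gamma> 0) / fact i * t ^ i) + t ^ n * g t"
proof -
  have "derivative_sequence {-e<..<e} (\<lambda>k t. L (nderiv k \<gamma> t))"
    unfolding derivative_sequence_def has_real_derivative_iff_has_vector_derivative
  proof (intro allI ballI)
    fix k t assume "t \<in> {-e<..<e}"
    from nderiv_has_vector_derivative[OF _ assms(1) this, of k]
    show "((\<lambda>t. L (nderiv k \<gamma> t)) has_vector_derivative L (nderiv (Suc k) \<gamma> t))
        (at t within {-e<..<e})"
      using has_vector_derivative_at_within[OF bounded_linear.has_vector_derivative[OF assms(2)]] by simp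
  qed
  then obtain g where "smooth_on {-e<..<e} g"
    "\<And>t. t \<in> {-e<..<e} \<Longrightarrow> L (nderiv 0 \<gamma> t) = (\<Sum>i<n. L (nderiv i \<gamma> 0) / fact i * t ^ i) + t ^ n * g t"
    by (rule taylor_smooth_remainder[of e _ n]) (rule that)
  then show ?thesis unfolding nderiv_0 by (rule that)
qed

lemma shrink_interval:
  fixes e :: real
  assumes "e > 0" "continuous_on {-e<..<e} f" "f 0 > (0::real)"
  obtains d where "0 < d" "d \<le> e" "\<And>t. t \<in> {-d<..<d} \<Longrightarrow> f t > 0"
proof -
  have "isCont f 0" using assms by (simp add: continuous_on_eq_continuous_at)
  then have "\<forall>\<^sub>F t in at 0. f t > 0"
    using assms(3) by (intro order_tendstoD(1)[of f "f 0"]) (auto simp: isCont_def)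
  then obtain d where "d > 0" "\<And>t. t \<noteq> 0 \<Longrightarrow> \<bar>t\<bar> < d \<Longrightarrow> f t > 0"
    by (auto simp: eventually_at)
  then have "f t > 0" if "\<bar>t\<bar> < d" for t using assms(3) that by (cases "t = 0") auto
  with \<open>d > 0\<close> show ?thesis by (intro that[of "min d e"]) (use assms(1) in auto)
qed

text \<open>
  \<open>X\<close> and \<open>Y\<close> are the affine coordinates of the plane, with origin \<open>c\<close>, in which \<open>a\<close> and \<open>b\<close> become
  \<open>(2, 0)\<close> and \<open>(0, 6)\<close>. If \<open>a\<close> and \<open>b\<close> are the second and third derivative of a curve at a cusp, then
  its coordinates begin with \<open>t\<^sup>2\<close> and \<open>t\<^sup>3\<close>. In them the map is triangular, so its inverse is explicit.
\<close>

lemma cusp_normal_form: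
  fixes a b :: "real^2" and c :: "real^2"
  assumes ab: "bracket a b \<noteq> 0" and \<rho>: "\<rho> > 0"
    and P: "smooth_on {-\<rho><..<\<rho>} P" "\<And>x. x \<in> {-\<rho><..<\<rho>} \<Longrightarrow> P x \<noteq> 0" and Q: "smooth_on {-\<rho><..<\<rho>} Q"
  defines "X \<equiv> \<lambda>z. 2 / bracket a b * bracket (z - c) b" and "Y \<equiv> \<lambda>z. 6 / bracket a b * bracket a (z - c)"
  shows "diffeomorphism {z. X z \<in> {-\<rho><..<\<rho>}} {z::real^2. z $ 1 \<in> {-\<rho><..<\<rho>}}
     (\<lambda>z. vector [X z, (Y z - (X z)\<^sup>2 * Q (X z)) / P (X z)])
     (\<lambda>z. c + (z $ 1 / 2) *\<^sub>R a + ((z $ 2 * P (z $ 1) + (z $ 1)\<^sup>2 * Q (z $ 1)) / 6) *\<^sub>R b)"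
    (is "diffeomorphism ?W ?W' ?\<Phi> ?\<Psi>")
proof -
  let ?I = "{-\<rho><..<\<rho>}"
  have sX: "smooth_on S X" and sY: "smooth_on S Y" if "open S" for S
    unfolding X_def Y_def
    by (intro smooth_on_bounded_linear[OF that bracket_bilinear(1)]
        smooth_on_bounded_linear[OF that bracket_bilinear(2)] smooth_on_diff smooth_on_id smooth_on_const that)+
  have oW: "open ?W"
    using continuous_open_vimage[of "{-\<rho><..<\<rho>}" X] smooth_on_continuous_on[OF sX[of UNIV]]
    by (simp add: continuous_on_eq_continuous_at vimage_def)
  have oW': "open ?W'"
    using continuous_open_vimage[of "{-\<rho><..<\<rho>}" "\<lambda>z::real^2. z $ 1"]
    by (simp add: vimage_def)
  have comp: "smooth_on S (\<lambda>z. h (f z))"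
    if "open S" "smooth_on S f" "smooth_on ?I h" "f ` S \<subseteq> ?I" for S f and h :: "real \<Rightarrow> real"
    by (rule smooth_on_compose[OF that(1) _ that(2,3,4)]) auto
  have s\<Phi>: "smooth_on ?W ?\<Phi>"
    by (intro smooth_on_vector_2 smooth_on_divide smooth_on_diff smooth_on_mult smooth_on_power
        comp[OF oW sX[OF oW]] P Q sX sY oW) auto
  have s\<Psi>: "smooth_on ?W' ?\<Psi>"
    unfolding divide_inverse
    by (intro smooth_on_add smooth_on_scaleR smooth_on_mult smooth_on_power smooth_on_const
        comp[OF oW' smooth_on_component[OF oW']] smooth_on_component P Q oW') auto
  have X\<Psi>: "X (?\<Psi> z) = z $ 1" and Y\<Psi>: "Y (?\<Psi> z) = z $ 2 * P (z $ 1) + (z $ 1)\<^sup>2 * Q (z $ 1)" for z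
    using ab unfolding X_def Y_def
    by (simp_all add: bracket_add_left bracket_add_right bracket_scaleR_left bracket_scaleR_right
        bracket_self add.assoc)
  have \<Phi>\<Psi>: "?\<Phi> (?\<Psi> z) = z" if "z \<in> ?W'" for z
    unfolding X\<Psi> Y\<Psi> using that P(2)[of "z $ 1"] by (simp add: vec_eq_iff forall_2)
  have \<Psi>\<Phi>: "?\<Psi> (?\<Phi> z) = z" if "z \<in> ?W" for z
  proof -
    have "?\<Psi> (?\<Phi> z) = c + ((X z / 2) *\<^sub>R a + (Y z / 6) *\<^sub>R b)"
      using that P(2)[of "X z"] by simp
    also have "(X z / 2) *\<^sub>R a + (Y z / 6) *\<^sub>R b = z - c"
      using cramer_bracket[OF ab, of "z - c"] by (simp add: X_def Y_def)
    finally show ?thesis by simp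
  qed
  have "homeomorphism ?W ?W' ?\<Phi> ?\<Psi>"
  proof (rule homeomorphismI)
    show "?\<Phi> ` ?W \<subseteq> ?W'" by auto
    show "?\<Psi> ` ?W' \<subseteq> ?W" using X\<Psi> by auto
  qed (use smooth_on_continuous_on[OF s\<Phi>] smooth_on_continuous_on[OF s\<Psi>] \<Phi>\<Psi> \<Psi>\<Phi> in auto)
  then show ?thesis using oW oW' s\<Phi> s\<Psi> by (simp add: diffeomorphism_def)
qed

text \<open>
  In the coordinates of \<open>cusp_normal_form\<close> the curve is \<open>(t\<^sup>2 x(t), t\<^sup>3 y(t))\<close> with \<open>x(0) = y(0) = 1\<close>. The
  new parameter \<open>u = t sqrt(x(t))\<close> makes the first coordinate \<open>u\<^sup>2\<close> and the second one \<open>u\<^sup>3 B(u)\<close>.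
  Splitting \<open>B\<close> along the square of \<open>u\<close> yields the diffeomorphism.
\<close>

theorem derivatives_imp_cusp_3_2:
  assumes e: "e > 0" and \<gamma>: "smooth_on {-e<..<e} \<gamma>"
    and d1: "nderiv 1 \<gamma> 0 = 0" and d23: "bracket (nderiv 2 \<gamma> 0) (nderiv 3 \<gamma> 0) \<noteq> 0"
  shows "cusp_3_2 \<gamma>"
proof -
  define a where "a = nderiv 2 \<gamma> 0"
  define b where "b = nderiv 3 \<gamma> 0"
  define X where "X z = 2 / bracket a b * bracket (z - \<gamma> 0) b" for z
  define Y where "Y z = 6 / bracket a b * bracket a (z - \<gamma> 0)" for z
  have ab: "bracket a b \<noteq> 0" using d23 by (simp add: a_def b_def)
  have bracket_0: "bracket 0 z = 0" "bracket z 0 = 0" for z by (simp_all add: bracket_def)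
  have bracket_diff: "bracket (u - v) z = bracket u z - bracket v z"
    "bracket z (u - v) = bracket z u - bracket z v" for u v z by (simp_all add: bracket_def algebra_simps)
  have low: "nderiv (Suc 0) \<gamma> 0 = 0" "nderiv (Suc (Suc 0)) \<gamma> 0 = a"
    "nderiv (Suc (Suc (Suc 0))) \<gamma> 0 = b" "nderiv 0 \<gamma> 0 = \<gamma> 0"
    using d1 by (simp_all add: a_def b_def nderiv_0 numeral_2_eq_2 numeral_3_eq_3)
  obtain x' where x': "smooth_on {-e<..<e} x'"
    "\<And>t. t \<in> {-e<..<e} \<Longrightarrow> 2 / bracket a b * bracket (\<gamma> t) b =
      (\<Sum>i<3. (2 / bracket a b * bracket (nderiv i \<gamma> 0) b) / fact i * t ^ i) + t ^ 3 * x' t"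
    using curve_component_taylor[OF \<gamma> bracket_bilinear(1)] by blast
  obtain y' where y': "smooth_on {-e<..<e} y'"
    "\<And>t. t \<in> {-e<..<e} \<Longrightarrow> 6 / bracket a b * bracket a (\<gamma> t) =
      (\<Sum>i<4. (6 / bracket a b * bracket a (nderiv i \<gamma> 0)) / fact i * t ^ i) + t ^ 4 * y' t"
    using curve_component_taylor[OF \<gamma> bracket_bilinear(2)] by blast
  define x where "x t = 1 + t * x' t" for t
  define y where "y t = 1 + t * y' t" for t
  have X\<gamma>: "X (\<gamma> t) = t\<^sup>2 * x t" if "t \<in> {-e<..<e}" for t
  proof -
    have "2 / bracket a b * bracket (\<gamma> t) b = 2 / bracket a b * bracket (\<gamma> 0) b + t\<^sup>2 + t ^ 3 * x' t"
      unfolding x'(2)[OF that] using ab by (simp add: eval_nat_numeral low bracket_self bracket_0)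
    then show ?thesis
      by (simp add: X_def x_def bracket_diff right_diff_distrib distrib_left eval_nat_numeral
          diff_divide_distrib)
  qed
  have Y\<gamma>: "Y (\<gamma> t) = t ^ 3 * y t" if "t \<in> {-e<..<e}" for t
  proof -
    have "6 / bracket a b * bracket a (\<gamma> t) = 6 / bracket a b * bracket a (\<gamma> 0) + t ^ 3 + t ^ 4 * y' t"
      unfolding y'(2)[OF that] using ab by (simp add: eval_nat_numeral low bracket_self bracket_0)
    then show ?thesis
      by (simp add: Y_def y_def bracket_diff right_diff_distrib distrib_left eval_nat_numeral
          diff_divide_distrib)
  qed
  have sx: "smooth_on {-e<..<e} x" and sy: "smooth_on {-e<..<e} y"
    unfolding x_def[abs_def] y_def[abs_def] by (intro smooth_intros x' y' open_greaterThanLessThan)+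
  obtain d where d: "0 < d" "d \<le> e" "\<And>t. t \<in> {-d<..<d} \<Longrightarrow> x t > 0"
    using shrink_interval[OF e smooth_on_continuous_on[OF sx]] by (auto simp: x_def)
  have "{-d<..<d} \<subseteq> {-e<..<e}" using d(2) by auto
  then have sxd: "smooth_on {-d<..<d} x" and syd: "smooth_on {-d<..<d} y"
    using smooth_on_subset sx sy by blast+
  define \<theta> where "\<theta> t = t * x t powr (1/2)" for t
  have s\<theta>: "smooth_on {-d<..<d} \<theta>"
    unfolding \<theta>_def[abs_def]
    by (intro smooth_intros smooth_on_powr_compose sxd d open_greaterThanLessThan)
  obtain \<theta>' where \<theta>': "smooth_on {-d<..<d} \<theta>'"
    "\<And>t. t \<in> {-d<..<d} \<Longrightarrow> (\<theta> has_vector_derivative \<theta>' t) (at t)"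
    using smooth_on_derivativeE[OF _ s\<theta>] by auto
  have "\<theta>' 0 = 1"
  proof -
    have "(\<theta> has_real_derivative \<theta>' 0) (at 0)"
      using \<theta>'(2)[of 0] d by (simp add: has_real_derivative_iff_has_vector_derivative)
    then have "((\<lambda>t. \<theta> t / t) \<longlongrightarrow> \<theta>' 0) (at 0)" by (simp add: has_field_derivative_iff \<theta>_def)
    moreover have "((\<lambda>t. \<theta> t / t) \<longlongrightarrow> 1) (at 0)"
    proof -
      have "isCont x 0" using smooth_on_continuous_on[OF sxd] d by (simp add: continuous_on_eq_continuous_at)
      then have "(x \<longlongrightarrow> x 0) (at 0)" by (simp add: isCont_def)
      then have "((\<lambda>t. x t powr (1/2)) \<longlongrightarrow> x 0 powr (1/2)) (at 0)"
        by (rule tendsto_powr[OF _ tendsto_const]) (simp add: x_def)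
      then have "((\<lambda>t. x t powr (1/2)) \<longlongrightarrow> 1) (at 0)" by (simp add: x_def)
      then show ?thesis
        by (rule Lim_transform_eventually) (auto simp: eventually_at_filter \<theta>_def)
    qed
    ultimately show ?thesis using LIM_unique by blast
  qed
  then obtain d' where d': "0 < d'" "d' \<le> d" "\<And>t. t \<in> {-d'<..<d'} \<Longrightarrow> \<theta>' t > 0"
    using shrink_interval[OF d(1) smooth_on_continuous_on[OF \<theta>'(1)]] by auto
  obtain \<phi> where \<theta>: "diffeomorphism {-d'<..<d'} (\<theta> ` {-d'<..<d'}) \<theta> \<phi>"
  proof (rule diffeomorphism_of_pos_derivative)
    show "smooth_on {-d'<..<d'} \<theta>" by (rule smooth_on_subset[OF s\<theta>]) (use d' in auto)
    show "(\<theta> has_vector_derivative \<theta>' t) (at t)" if "t \<in> {-d'<..<d'}" for t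
      using \<theta>'(2)[of t] d' that by auto
  qed (use d' in auto)
  let ?V = "\<theta> ` {-d'<..<d'}"
  have V: "open ?V" "0 \<in> ?V" "smooth_on ?V \<phi>" "homeomorphism {-d'<..<d'} ?V \<theta> \<phi>"
    using \<theta> d' by (auto simp: diffeomorphism_def \<theta>_def intro!: image_eqI[of _ _ 0])
  have \<phi>I: "\<phi> u \<in> {-d'<..<d'}" "\<theta> (\<phi> u) = u" if "u \<in> ?V" for u
    using V(4) that unfolding homeomorphism_def by blast+
  have "\<phi> 0 = 0"
    using V(4) d' homeomorphism_apply1[OF V(4), of 0] by (simp add: \<theta>_def)
  define B where "B u = y (\<phi> u) / x (\<phi> u) powr (3/2)" for u
  have \<phi>d: "\<phi> ` ?V \<subseteq> {-d<..<d}" using \<phi>I(1) d' by force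
  have sB: "smooth_on ?V B"
  proof -
    have "smooth_on ?V (\<lambda>u. x (\<phi> u))" "smooth_on ?V (\<lambda>u. y (\<phi> u))"
      by (rule smooth_on_compose[OF V(1) _ V(3) sxd \<phi>d], simp,
          rule smooth_on_compose[OF V(1) _ V(3) syd \<phi>d], simp)
    moreover have pos: "x (\<phi> u) > 0" if "u \<in> ?V" for u using d(3) \<phi>d that by blast
    moreover have "x (\<phi> u) \<noteq> 0" if "u \<in> ?V" for u using pos[OF that] by simp
    ultimately show ?thesis unfolding B_def[abs_def]
      by (intro smooth_on_divide smooth_on_powr_compose V(1)) simp_all
  qed
  obtain r where r: "0 < r" "r \<le> 1" "{-r<..<r} \<subseteq> ?V"
  proof -
    obtain r where r: "r > 0" "{-r<..<r} \<subseteq> ?V"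
      using openE[OF V(1,2)] by (metis ball_eq_greaterThanLessThan diff_0 add_0)
    have "{- min r 1<..<min r 1} \<subseteq> {-r<..<r}" by auto
    with r show ?thesis by (intro that[of "min r 1"]) (auto simp del: greaterThanLessThan_iff)
  qed
  obtain P Q where PQ: "smooth_on {-(r\<^sup>2)<..<r\<^sup>2} P" "smooth_on {-(r\<^sup>2)<..<r\<^sup>2} Q"
    "\<And>u. u \<in> {-r<..<r} \<Longrightarrow> B u = P (u\<^sup>2) + u * Q (u\<^sup>2)"
    using smooth_on_split_square[OF r(1,2) smooth_on_subset[OF sB r(3)]] by blast
  have "P 0 = 1" using PQ(3)[of 0] r \<open>\<phi> 0 = 0\<close> by (simp add: B_def x_def y_def)
  then obtain \<rho> where \<rho>: "0 < \<rho>" "\<rho> \<le> r\<^sup>2" "\<And>v. v \<in> {-\<rho><..<\<rho>} \<Longrightarrow> P v > 0"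
    using shrink_interval[OF _ smooth_on_continuous_on[OF PQ(1)]] r by auto
  define U where "U = {-sqrt \<rho><..<sqrt \<rho>}"
  have "sqrt \<rho> \<le> r" using \<rho>(2) r(1) by (simp add: real_le_lsqrt)
  then have U: "open U" "0 \<in> U" "U \<subseteq> {-r<..<r}" using \<rho>(1) by (auto simp: U_def)
  have Usq: "u\<^sup>2 < \<rho>" if "u \<in> U" for u
  proof -
    have "\<bar>u\<bar> < sqrt \<rho>" using that by (auto simp: U_def)
    then have "\<bar>u\<bar>\<^sup>2 < (sqrt \<rho>)\<^sup>2" by (intro power_strict_mono) auto
    then show ?thesis using \<rho>(1) by simp
  qed
  let ?W = "{z. X z \<in> {-\<rho><..<\<rho>}}" and ?W' = "{z::real^2. z $ 1 \<in> {-\<rho><..<\<rho>}}"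
  let ?\<Phi> = "\<lambda>z. vector [X z, (Y z - (X z)\<^sup>2 * Q (X z)) / P (X z)] :: real^2"
  let ?\<Psi> = "\<lambda>z::real^2. \<gamma> 0 + (z $ 1 / 2) *\<^sub>R a + ((z $ 2 * P (z $ 1) + (z $ 1)\<^sup>2 * Q (z $ 1)) / 6) *\<^sub>R b"
  have sub: "{-\<rho><..<\<rho>} \<subseteq> {-(r\<^sup>2)<..<r\<^sup>2}" using \<rho> by auto
  have \<Phi>: "diffeomorphism ?W ?W' ?\<Phi> ?\<Psi>"
    unfolding X_def Y_def
    by (rule cusp_normal_form[OF ab \<rho>(1) smooth_on_subset[OF PQ(1) sub] _ smooth_on_subset[OF PQ(2) sub]])
      (use \<rho>(3) in force)
  have \<phi>: "diffeomorphism U (\<phi> ` U) \<phi> \<theta>"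
    by (rule diffeomorphism_restrict[OF diffeomorphism_sym[OF \<theta>] U(1)]) (use U(3) r(3) in auto)
  have main: "\<gamma> (\<phi> u) \<in> ?W \<and> ?\<Phi> (\<gamma> (\<phi> u)) = vector [u\<^sup>2, u ^ 3]" if u: "u \<in> U" for u
  proof -
    have uV: "u \<in> ?V" using u U(3) r(3) by auto
    define t where "t = \<phi> u"
    have t: "t \<in> {-d'<..<d'}" "t \<in> {-d<..<d}" "t \<in> {-e<..<e}" and \<theta>t: "t * x t powr (1/2) = u"
      using \<phi>I[OF uV] d d' by (auto simp: t_def \<theta>_def)
    have "x t > 0" using d(3) t by blast
    have x2: "(x t powr (1/2))\<^sup>2 = x t" and x3: "(x t powr (1/2)) ^ 3 = x t powr (3/2)"
      using \<open>x t > 0\<close> by (simp_all add: powr_power)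
    have Xt: "X (\<gamma> t) = u\<^sup>2"
      unfolding X\<gamma>[OF t(3)] \<theta>t[symmetric] by (simp add: power_mult_distrib x2)
    have "B u = y t / x t powr (3/2)" by (simp add: B_def t_def)
    then have "y t = x t powr (3/2) * B u" using \<open>x t > 0\<close> by simp
    then have Yt: "Y (\<gamma> t) = u ^ 3 * B u"
      unfolding Y\<gamma>[OF t(3)] \<theta>t[symmetric] by (simp add: power_mult_distrib x3)
    have "Y (\<gamma> t) - (u\<^sup>2)\<^sup>2 * Q (u\<^sup>2) = u ^ 3 * P (u\<^sup>2)"
      unfolding Yt using PQ(3)[of u] u U(3)
      by (auto simp: algebra_simps power2_eq_square power3_eq_cube)
    moreover have "u\<^sup>2 \<in> {-\<rho><..<\<rho>}"
      using Usq[OF u] \<rho>(1) zero_le_power2[of u] unfolding greaterThanLessThan_iff by linarith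
    moreover have "P (u\<^sup>2) \<noteq> 0" using \<rho>(3)[OF \<open>u\<^sup>2 \<in> _\<close>] by simp
    ultimately show ?thesis unfolding t_def[symmetric] by (simp add: Xt)
  qed
  have "\<gamma> 0 \<in> ?W" using \<rho>(1) by (simp add: X_def bracket_0)
  then show ?thesis
    unfolding cusp_3_2_def
    by (intro exI[of _ U] exI[of _ "\<phi> ` U"] exI[of _ \<phi>] exI[of _ \<theta>] exI[of _ ?W] exI[of _ ?W']
        exI[of _ ?\<Phi>] exI[of _ ?\<Psi>] main conjI ballI U(2) \<open>\<phi> 0 = 0\<close> \<phi> \<Phi>)
qed

section \<open>Second order jets\<close>

text \<open>
  The Taylor polynomial of order two, with a smooth remainder. Membership of the remainder in a ring
  makes the rule for products pure algebra.
\<close>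

definition jet2 :: "real \<Rightarrow> (real \<Rightarrow> real) \<Rightarrow> real \<Rightarrow> real \<Rightarrow> real \<Rightarrow> bool" where
  "jet2 e f a b c \<longleftrightarrow> (\<exists>g. smooth_on {-e<..<e} g \<and>
     (\<forall>t\<in>{-e<..<e}. f t = a + b * t + c * t\<^sup>2 + t ^ 3 * g t))"

lemma jet2I:
  "smooth_on {-e<..<e} g \<Longrightarrow> (\<And>t. t \<in> {-e<..<e} \<Longrightarrow> f t = a + b * t + c * t\<^sup>2 + t ^ 3 * g t) \<Longrightarrow>
    jet2 e f a b c"
  unfolding jet2_def by blast

lemma jet2_cong:
  "jet2 e f a b c \<Longrightarrow> a = a' \<Longrightarrow> b = b' \<Longrightarrow> c = c' \<Longrightarrow> jet2 e f a' b' c'"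
  by simp

lemma jet2_smooth_on: "jet2 e f a b c \<Longrightarrow> smooth_on {-e<..<e} f"
proof -
  assume "jet2 e f a b c"
  then obtain g where g: "smooth_on {-e<..<e} g"
    "\<And>t. t \<in> {-e<..<e} \<Longrightarrow> f t = a + b * t + c * t\<^sup>2 + t ^ 3 * g t" unfolding jet2_def by blast
  have "smooth_on {-e<..<e} (\<lambda>t. a + b * t + c * t\<^sup>2 + t ^ 3 * g t)"
    by (intro smooth_intros g open_greaterThanLessThan)
  then show ?thesis by (rule smooth_on_cong[rotated 2]) (use g(2) in auto)
qed

lemma jet2_mult:
  assumes "jet2 e f a b c" "jet2 e g a' b' c'"
  shows "jet2 e (\<lambda>t. f t * g t) (a * a') (a * b' + b * a') (a * c' + b * b' + c * a')"
proof -
  obtain u where u: "smooth_on {-e<..<e} u"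
    "\<And>t. t \<in> {-e<..<e} \<Longrightarrow> f t = a + b * t + c * t\<^sup>2 + t ^ 3 * u t" using assms(1) unfolding jet2_def by blast
  obtain v where v: "smooth_on {-e<..<e} v"
    "\<And>t. t \<in> {-e<..<e} \<Longrightarrow> g t = a' + b' * t + c' * t\<^sup>2 + t ^ 3 * v t" using assms(2) unfolding jet2_def by blast
  show ?thesis
  proof (rule jet2I)
    show "smooth_on {-e<..<e} (\<lambda>t. (b * c' + c * b') + c * c' * t + (a + b * t + c * t\<^sup>2) * v t
        + (a' + b' * t + c' * t\<^sup>2) * u t + t ^ 3 * (u t * v t))"
      by (intro smooth_intros u v open_greaterThanLessThan)
  qed (simp add: u(2) v(2) algebra_simps power2_eq_square power3_eq_cube)
qed

lemma jet2_lincomb: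
  assumes "jet2 e f a b c" "jet2 e g a' b' c'"
  shows "jet2 e (\<lambda>t. x * f t + y * g t) (x * a + y * a') (x * b + y * b') (x * c + y * c')"
proof -
  obtain u where u: "smooth_on {-e<..<e} u"
    "\<And>t. t \<in> {-e<..<e} \<Longrightarrow> f t = a + b * t + c * t\<^sup>2 + t ^ 3 * u t" using assms(1) unfolding jet2_def by blast
  obtain v where v: "smooth_on {-e<..<e} v"
    "\<And>t. t \<in> {-e<..<e} \<Longrightarrow> g t = a' + b' * t + c' * t\<^sup>2 + t ^ 3 * v t" using assms(2) unfolding jet2_def by blast
  show ?thesis
    by (rule jet2I[of _ "\<lambda>t. x * u t + y * v t"])
      (auto intro!: smooth_on_add smooth_on_mult smooth_on_const u v simp: u(2) v(2) algebra_simps)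
qed

lemma continuous_cancel_parameter:
  fixes f :: "real \<Rightarrow> real"
  assumes "e > 0" "continuous_on {-e<..<e} f" "\<And>t. t \<in> {-e<..<e} \<Longrightarrow> t * f t = 0" "t \<in> {-e<..<e}"
  shows "f t = 0"
proof (cases "t = 0")
  case True
  have "isCont f 0" using assms(1,2) by (simp add: continuous_on_eq_continuous_at)
  then have "(f \<longlongrightarrow> f 0) (at 0)" by (simp add: isCont_def)
  moreover have "(f \<longlongrightarrow> 0) (at 0)"
  proof (rule Lim_transform_eventually[OF tendsto_const])
    have "\<forall>\<^sub>F t in at 0. t \<in> {-e<..<e}"
      using assms(1) by (intro eventually_at_in_open') auto
    then show "\<forall>\<^sub>F t in at 0. 0 = f t"
      using eventually_neq_at_within[of 0 0 UNIV]
      by eventually_elim (metis assms(3) mult_eq_0_iff)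
  qed
  ultimately show ?thesis using LIM_unique True by blast
qed (use assms in auto)

lemma jet2_unique:
  assumes e: "e > 0" and "jet2 e f a b c" "jet2 e g a' b' c'" "\<And>t. t \<in> {-e<..<e} \<Longrightarrow> f t = g t"
  shows "a = a' \<and> b = b' \<and> c = c'"
proof -
  have "jet2 e (\<lambda>t. 1 * f t + (-1) * g t) (1 * a + (-1) * a') (1 * b + (-1) * b') (1 * c + (-1) * c')"
    by (rule jet2_lincomb[OF assms(2,3)])
  then obtain u where u: "smooth_on {-e<..<e} u"
    "\<And>t. t \<in> {-e<..<e} \<Longrightarrow> 0 = (a - a') + (b - b') * t + (c - c') * t\<^sup>2 + t ^ 3 * u t"
    unfolding jet2_def using assms(4) by fastforce
  have "a = a'" using u(2)[of 0] e by simp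
  have c1: "continuous_on {-e<..<e} (\<lambda>t. (b - b') + (c - c') * t + t\<^sup>2 * u t)"
    and c2: "continuous_on {-e<..<e} (\<lambda>t. (c - c') + t * u t)"
    by (intro continuous_intros smooth_on_continuous_on[OF u(1)])+
  have 1: "(b - b') + (c - c') * t + t\<^sup>2 * u t = 0" if "t \<in> {-e<..<e}" for t
  proof (rule continuous_cancel_parameter[OF e c1 _ that])
    fix t assume "t \<in> {-e<..<e}"
    from u(2)[OF this] show "t * ((b - b') + (c - c') * t + t\<^sup>2 * u t) = 0"
      unfolding \<open>a = a'\<close> by (simp add: algebra_simps power2_eq_square power3_eq_cube)
  qed
  have "b = b'" using 1[of 0] e by simp
  have "(c - c') + 0 * u 0 = 0"
  proof (rule continuous_cancel_parameter[OF e c2])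
    fix t assume "t \<in> {-e<..<e}"
    from 1[OF this] show "t * ((c - c') + t * u t) = 0"
      unfolding \<open>b = b'\<close> by (simp add: algebra_simps power2_eq_square)
  qed (use e in simp)
  with \<open>a = a'\<close> \<open>b = b'\<close> show ?thesis by simp
qed

lemma derivative_sequence_jet2:
  assumes "derivative_sequence {-e<..<e} T"
  shows "jet2 e (T 0) (T 0 0) (T 1 0) (T 2 0 / 2)"
proof -
  obtain g where "smooth_on {-e<..<e} g"
    "\<And>t. t \<in> {-e<..<e} \<Longrightarrow> T 0 t = (\<Sum>i<3. T i 0 / fact i * t ^ i) + t ^ 3 * g t"
    by (rule taylor_smooth_remainder[OF assms, of 3]) (rule that)
  note g = this
  show ?thesis
  proof (rule jet2I[OF g(1)])
    fix t assume "t \<in> {-e<..<e}"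
    from g(2)[OF this] show "T 0 t = T 0 0 + T 1 0 * t + T 2 0 / 2 * t\<^sup>2 + t ^ 3 * g t"
      by (simp add: eval_nat_numeral)
  qed
qed

lemma smooth_on_jet2:
  assumes "smooth_on {-e<..<e} f"
  obtains b c where "jet2 e f (f 0) b c"
proof -
  obtain T where T: "derivative_sequence {-e<..<e} T" "T 0 = f"
    using smooth_on_derivative_sequence[OF _ assms] by auto
  from derivative_sequence_jet2[OF T(1)] that show ?thesis unfolding T(2) by blast
qed

lemma jet2_derivative:
  assumes "e > 0" "jet2 e f a b c"
  shows "(f has_real_derivative b) (at 0)"
proof -
  obtain u where u: "smooth_on {-e<..<e} u"
    "\<And>t. t \<in> {-e<..<e} \<Longrightarrow> f t = a + b * t + c * t\<^sup>2 + t ^ 3 * u t" using assms(2) unfolding jet2_def by blast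
  obtain u' where "(u has_real_derivative u') (at 0)"
    using smooth_on_has_vector_derivative[OF u(1), of 0] assms(1)
    by (auto simp: has_real_derivative_iff_has_vector_derivative)
  then have "((\<lambda>t. a + b * t + c * t\<^sup>2 + t ^ 3 * u t) has_real_derivative b) (at 0)"
    by (auto intro!: derivative_eq_intros)
  then show ?thesis
    by (rule has_field_derivative_transform_within_open[of _ _ _ "{-e<..<e}"]) (use u assms in auto)
qed

section \<open>Arclength\<close>

text \<open>
  The integrand is continuous across the cusp, so the arclength may be read off from any primitive.
\<close>

lemma affine_arclength_eq:
  assumes q: "continuous_on {-e<..<e} q"
    and d: "\<And>t. t \<in> {-e<..<e} \<Longrightarrow> \<bar>dbracket \<gamma> 1 2 t\<bar> powr (1/3) = \<bar>t\<bar> powr (2/3) * q t"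
    and F: "\<And>t. t \<in> {-e<..<e} \<Longrightarrow> (F has_vector_derivative \<bar>t\<bar> powr (2/3) * q t) (at t)"
    and "F 0 = 0" and t: "t \<in> {-e<..<e}"
  shows "affine_arclength \<gamma> t = F t"
proof -
  have sub: "{min 0 t..max 0 t} \<subseteq> {-e<..<e}" using t by auto
  have "continuous_on {-e<..<e} (\<lambda>u. \<bar>u\<bar> powr (2/3) * q u)"
    by (intro continuous_intros continuous_on_powr' q) auto
  from continuous_on_subset[OF this sub]
  have c: "continuous_on {min 0 t..max 0 t} (\<lambda>u. \<bar>dbracket \<gamma> 1 2 u\<bar> powr (1/3))"
    by (rule continuous_on_eq) (metis d sub subsetD)
  have "affine_arclength \<gamma> t = F t - F 0"
    unfolding affine_arclength_def
  proof (rule interval_integral_FTC_finite[OF c])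
    fix u assume "min 0 t \<le> u" "u \<le> max 0 t"
    then have u: "u \<in> {-e<..<e}" using sub by auto
    show "(F has_vector_derivative \<bar>dbracket \<gamma> 1 2 u\<bar> powr (1/3)) (at u within {min 0 t..max 0 t})"
      unfolding d[OF u] by (rule has_vector_derivative_at_within[OF F[OF u]])
  qed
  then show ?thesis using assms(4) by simp
qed

lemma arclength_3_5_eq:
  assumes "affine_arclength \<gamma> t = t * \<bar>t\<bar> powr (2/3) * r" "r > 0"
  shows "arclength_3_5 \<gamma> t = t * r powr (3/5)"
proof (cases "t = 0")
  case False
  have "\<bar>t * \<bar>t\<bar> powr (2/3) * r\<bar> = \<bar>t\<bar> powr (5/3) * r"
    using False assms(2) powr_add[of "\<bar>t\<bar>" 1 "2/3"] by (simp add: abs_mult)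
  then have 1: "\<bar>t * \<bar>t\<bar> powr (2/3) * r\<bar> powr (3/5) = \<bar>t\<bar> * r powr (3/5)"
    using False assms(2) by (simp add: powr_mult powr_powr)
  have 2: "sgn (t * \<bar>t\<bar> powr (2/3) * r) = sgn t"
    using False assms(2) by (simp add: sgn_mult)
  show ?thesis
    by (simp only: arclength_3_5_def assms(1) 1 2 mult.assoc[symmetric] sgn_mult_abs)
qed (use assms in \<open>simp add: arclength_3_5_def\<close>)

section \<open>The normalized affine curvature near a cusp\<close>

lemma dbracket_has_derivative:
  assumes "open S" "smooth_on S \<gamma>" "t \<in> S"
  shows "(dbracket \<gamma> i j has_real_derivative dbracket \<gamma> (i + 1) j t + dbracket \<gamma> i (j + 1) t) (at t)"
proof -
  have "((\<lambda>t. nderiv k \<gamma> t $ l) has_real_derivative nderiv (Suc k) \<gamma> t $ l) (at t)" for k l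
    unfolding has_real_derivative_iff_has_vector_derivative
    by (rule bounded_linear.has_vector_derivative[OF bounded_linear_vec_nth
          nderiv_has_vector_derivative[OF assms]])
  note D = this
  show ?thesis
    unfolding dbracket_def[abs_def] bracket_def
    using DERIV_diff[OF DERIV_mult[OF D[of i 1] D[of j 2]] DERIV_mult[OF D[of i 2] D[of j 1]]]
    by (simp add: algebra_simps)
qed

lemma smooth_on_dbracket:
  assumes "open S" "smooth_on S \<gamma>"
  shows "smooth_on S (dbracket \<gamma> i j)"
  unfolding dbracket_def[abs_def] bracket_def
  by (intro smooth_on_diff smooth_on_mult smooth_on_bounded_linear[OF _ bounded_linear_vec_nth]
      smooth_on_nderiv assms)

lemma derivative_sequence_next:
  assumes S: "open S" and T: "derivative_sequence S T" and eq: "\<And>t. t \<in> S \<Longrightarrow> T k t = F t"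
    and F: "\<And>t. t \<in> S \<Longrightarrow> (F has_real_derivative F' t) (at t)" and t: "t \<in> S"
  shows "T (Suc k) t = F' t"
proof -
  have "(T k has_real_derivative T (Suc k) t) (at t)"
    using derivative_sequenceD[OF T t, of k] at_within_open[OF t S] by simp
  from has_field_derivative_transform_within_open[OF this S t eq]
  show ?thesis using F[OF t] DERIV_unique by blast
qed

text \<open>
  The comparison of coefficients. With \<open>D = [\<gamma>', \<gamma>'']\<close> and \<open>E = [\<gamma>'', \<gamma>''']\<close>, the numbers \<open>A, B, C, F\<close> are
  the values at \<open>0\<close> of \<open>[\<gamma>'', \<gamma>''']\<close>, \<open>[\<gamma>'', \<gamma>\<^sup>(\<^sup>4\<^sup>)]\<close>, \<open>[\<gamma>''', \<gamma>\<^sup>(\<^sup>4\<^sup>)]\<close> and \<open>[\<gamma>'', \<gamma>\<^sup>(\<^sup>5\<^sup>)]\<close>. Since \<open>\<gamma>'(0) = 0\<close>, the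
  derivatives of \<open>D\<close> of order \<open>2, 3, 4\<close> at \<open>0\<close> are \<open>A, 2 B, 2 C + 3 F\<close>, so \<open>p = D / t\<^sup>2\<close> has the coefficients on the
  left of the second group of hypotheses, and \<open>p = s q\<^sup>3\<close> with a sign \<open>s\<close> gives the right-hand sides. The
  numbers \<open>M0, M1, M2\<close> are the coefficients of \<open>M = 3 p (D'' + 3 E) - 5 (D' / t)\<^sup>2\<close>, and \<open>r0, r1, r2\<close> come from
  \<open>(5/3) r + t r' = q\<close>. The last group is \<open>f \<cdot> 9 q\<^sup>8 = r\<^sup>2 M\<close>, coefficient by coefficient.
\<close>

lemma normalized_curvature_jet_algebra:
  fixes q0 q1 q2 A B C F s :: real
  assumes q0: "q0 > 0" and s: "s * s = 1"
    and p: "A / 2 = s * q0 ^ 3" "B / 3 = s * (3 * q0\<^sup>2 * q1)"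
      "(2 * C + 3 * F) / 24 = s * (3 * q0\<^sup>2 * q2 + 3 * q0 * q1\<^sup>2)"
    and M: "M0 = 3 * (A/2 * (4 * A)) - 5 * (A * A)"
      "M1 = 3 * (A/2 * (5 * B) + B/3 * (4 * A)) - 5 * (A * B + B * A)"
      "M2 = 3 * (A/2 * ((2 * C + 3 * F) / 2 + 3 * ((C + F) / 2)) + B/3 * (5 * B)
          + (2 * C + 3 * F) / 24 * (4 * A)) - 5 * (A * ((2 * C + 3 * F) / 6) + B * B + (2 * C + 3 * F) / 6 * A)"
    and r: "r0 = 3/5 * q0" "r1 = 3/8 * q1" "r2 = 3/11 * q2"
    and f: "f0 * (9 * q0 ^ 8) = r0\<^sup>2 * M0"
      "f0 * (9 * (8 * q0 ^ 7 * q1)) + f1 * (9 * q0 ^ 8) = r0\<^sup>2 * M1 + 2 * r0 * r1 * M0"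
      "f0 * (9 * (8 * q0 ^ 7 * q2 + 28 * q0 ^ 6 * q1\<^sup>2)) + f1 * (9 * (8 * q0 ^ 7 * q1)) + f2 * (9 * q0 ^ 8)
        = r0\<^sup>2 * M2 + 2 * r0 * r1 * M1 + (2 * r0 * r2 + r1\<^sup>2) * M0"
  shows "f0 = 4/25" "f1 = 0" "f2 * (4400 * q0 ^ 6) = 3 * (24 * A * F + 60 * A * C - 35 * B\<^sup>2)"
proof -
  have A: "A = 2 * s * q0 ^ 3" and B: "B = 9 * s * q0\<^sup>2 * q1"
    using p(1,2) by simp_all
  have F: "F = 24 * s * (q0\<^sup>2 * q2 + q0 * q1\<^sup>2) - 2/3 * C"
    using p(3) by (simp add: field_simps)
  have s2: "s * (s * x) = x" for x using s by (simp flip: mult.assoc)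
  have M0: "M0 = 4 * q0 ^ 6"
    unfolding M A by (simp add: algebra_simps s2 power2_eq_square eval_nat_numeral)
  have M1: "M1 = 27 * q0 ^ 5 * q1"
    unfolding M A B by (simp add: algebra_simps s2 power2_eq_square eval_nat_numeral)
  show f0: "f0 = 4/25"
    using f(1) q0 unfolding M0 r by (simp add: field_simps eval_nat_numeral)
  show f1: "f1 = 0"
    using f(2) q0 unfolding M0 M1 r f0 by (simp add: field_simps eval_nat_numeral)
  have M2: "M2 = 48 * q0 ^ 5 * q2 + 48 * q0 ^ 4 * q1\<^sup>2 + 3/2 * s * C * q0 ^ 3"
    unfolding M A B F
    by (simp add: algebra_simps s2 power2_eq_square eval_nat_numeral; simp add: field_simps)
  have "f2 * (4400 * q0 ^ 8) = 3456 * (q0 ^ 7 * q2) - 5049 * (q0 ^ 6 * q1\<^sup>2) + 264 * (s * C * q0 ^ 5)"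
    using f(3) unfolding M0 M1 M2 r f0 f1
    by (simp add: algebra_simps power2_eq_square eval_nat_numeral; linarith)
  then have "(f2 * (4400 * q0 ^ 6) - 3 * (24 * A * F + 60 * A * C - 35 * B\<^sup>2)) * q0 ^ 2 = 0"
    unfolding A B F
    by (simp add: algebra_simps s2 power2_eq_square eval_nat_numeral)
  then show "f2 * (4400 * q0 ^ 6) = 3 * (24 * A * F + 60 * A * C - 35 * B\<^sup>2)" using q0 by simp
qed

text \<open>
  The numerator of the affine curvature is \<open>3 D (D'' + 3 E) - 5 D'\<^sup>2\<close> for \<open>D = [\<gamma>', \<gamma>'']\<close> and
  \<open>E = [\<gamma>'', \<gamma>''']\<close>, because \<open>D'' = E + [\<gamma>', \<gamma>\<^sup>(\<^sup>4\<^sup>)]\<close>. Here \<open>D\<close> is divisible by \<open>t\<^sup>2\<close> and \<open>D'\<close> by \<open>t\<close>, so the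
  numerator is \<open>t\<^sup>2 M\<close>. With \<open>z = \<bar>t\<bar> powr (2/3)\<close>, that is \<open>z\<^sup>3 = t\<^sup>2\<close>, the squared arclength is \<open>(t z r)\<^sup>2\<close> and the
  denominator is \<open>9 (z q)\<^sup>8\<close>, so all powers of \<open>t\<close> cancel.
\<close>

theorem normalized_curvature_expansion:
  assumes e: "e > 0" and \<gamma>: "smooth_on {-e<..<e} \<gamma>"
    and d1: "nderiv 1 \<gamma> 0 = 0" and d23: "dbracket \<gamma> 2 3 0 \<noteq> 0"
    and d12: "\<And>t. t \<in> {-e<..<e} \<Longrightarrow> t \<noteq> 0 \<Longrightarrow> dbracket \<gamma> 1 2 t \<noteq> 0"
  obtains r f c q0 where "smooth_on {-e<..<e} r" "\<And>t. t \<in> {-e<..<e} \<Longrightarrow> r t > 0"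
    and "\<And>t. t \<in> {-e<..<e} \<Longrightarrow> affine_arclength \<gamma> t = t * \<bar>t\<bar> powr (2/3) * r t"
    and "\<And>t. t \<in> {-e<..<e} \<Longrightarrow> t \<noteq> 0 \<Longrightarrow> (affine_arclength \<gamma> t)\<^sup>2 * affine_curvature \<gamma> t = f t"
    and "jet2 e f (4/25) 0 c" "q0 > 0" "r 0 = 3/5 * q0" "\<bar>dbracket \<gamma> 2 3 0\<bar> = 2 * q0 ^ 3"
    and "c * (4400 * q0 ^ 6) = 3 * (24 * dbracket \<gamma> 2 3 0 * dbracket \<gamma> 2 5 0
      + 60 * dbracket \<gamma> 2 3 0 * dbracket \<gamma> 3 4 0 - 35 * (dbracket \<gamma> 2 4 0)\<^sup>2)"
proof -
  let ?I = "{-e<..<e}" and ?d = "dbracket \<gamma>"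
  define A where "A = ?d 2 3 0"
  define B where "B = ?d 2 4 0"
  define C where "C = ?d 3 4 0"
  define F where "F = ?d 2 5 0"
  have I: "open ?I" "0 \<in> ?I" using e by auto
  note D = dbracket_has_derivative[OF I(1) \<gamma>]
  have self: "?d i i t = 0" for i t by (simp add: dbracket_def bracket_self)
  have one: "?d 1 j 0 = 0" for j using d1 by (simp add: dbracket_def bracket_def)
  \<comment> \<open>Brackets with \<open>\<gamma>'\<close> vanish at the cusp, so only \<open>A\<close>, \<open>B\<close>, \<open>C\<close> and \<open>F\<close> enter the derivatives at \<open>0\<close>.\<close>
  obtain T where T: "derivative_sequence ?I T" "T 0 = ?d 1 2"
    using smooth_on_derivative_sequence[OF I(1) smooth_on_dbracket[OF I(1) \<gamma>]] by blast
  note dnext = derivative_sequence_next[OF I(1) T(1)]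
  have D12: "(?d 1 2 has_real_derivative ?d 1 3 t) (at t)" if "t \<in> ?I" for t
    using D[OF that, of 1 2] by (simp add: self del: One_nat_def)
  have T1: "T 1 t = ?d 1 3 t" if "t \<in> ?I" for t
    using dnext[of 0 "?d 1 2" "?d 1 3", OF _ D12 that] by (simp add: T(2) flip: One_nat_def)
  have D13: "(?d 1 3 has_real_derivative ?d 2 3 t + ?d 1 4 t) (at t)" if "t \<in> ?I" for t
    using D[OF that, of 1 3] by (simp del: One_nat_def)
  have T2: "T 2 t = ?d 2 3 t + ?d 1 4 t" if "t \<in> ?I" for t
    using dnext[OF T1 D13 that] by (simp del: One_nat_def)
  have D23_14: "((\<lambda>t. ?d 2 3 t + ?d 1 4 t) has_real_derivative 2 * ?d 2 4 t + ?d 1 5 t) (at t)" if "t \<in> ?I" for t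
    using DERIV_add[OF D[OF that, of 2 3] D[OF that, of 1 4]] by (simp add: self del: One_nat_def)
  have T3: "T 3 t = 2 * ?d 2 4 t + ?d 1 5 t" if "t \<in> ?I" for t
    using dnext[OF T2 D23_14 that] by (simp del: One_nat_def)
  have D24_15: "((\<lambda>t. 2 * ?d 2 4 t + ?d 1 5 t) has_real_derivative
      2 * (?d 3 4 t + ?d 2 5 t) + (?d 2 5 t + ?d 1 6 t)) (at t)" if "t \<in> ?I" for t
    using DERIV_add[OF DERIV_cmult[OF D[OF that, of 2 4], of 2] D[OF that, of 1 5]]
    by (simp del: One_nat_def)
  have T4: "T 4 t = 2 * (?d 3 4 t + ?d 2 5 t) + (?d 2 5 t + ?d 1 6 t)" if "t \<in> ?I" for t
    using dnext[OF T3 D24_15 that] by (simp del: One_nat_def)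
  have T0: "T 0 0 = 0" "T 1 0 = 0" "T 2 0 = A" "T 3 0 = 2 * B" "T 4 0 = 2 * C + 3 * F"
    using I(2) by (simp_all add: T(2) T1 T2 T3 T4 one A_def B_def C_def F_def del: One_nat_def)
  obtain S where S: "derivative_sequence ?I S" "S 0 = ?d 2 3"
    using smooth_on_derivative_sequence[OF I(1) smooth_on_dbracket[OF I(1) \<gamma>]] by blast
  note dnext' = derivative_sequence_next[OF I(1) S(1)]
  have D23: "(?d 2 3 has_real_derivative ?d 2 4 t) (at t)" if "t \<in> ?I" for t
    using D[OF that, of 2 3] by (simp add: self)
  have S1: "S 1 t = ?d 2 4 t" if "t \<in> ?I" for t
    using dnext'[of 0 "?d 2 3" "?d 2 4", OF _ D23 that] by (simp add: S(2))
  have D24: "(?d 2 4 has_real_derivative ?d 3 4 t + ?d 2 5 t) (at t)" if "t \<in> ?I" for t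
    using D[OF that, of 2 4] by simp
  have S2: "S 2 t = ?d 3 4 t + ?d 2 5 t" if "t \<in> ?I" for t
    using dnext'[OF S1 D24 that] by (simp del: One_nat_def)
  have jE: "jet2 e (?d 2 3) A B ((C + F) / 2)"
    using derivative_sequence_jet2[OF S(1)] S1[OF I(2)] S2[OF I(2)]
    by (simp add: S(2) A_def B_def C_def F_def)
  \<comment> \<open>Division by the powers of \<open>t\<close> that \<open>[\<gamma>',\<gamma>'']\<close> and its derivatives contain.\<close>
  obtain u where u: "smooth_on ?I u" "\<And>t. t \<in> ?I \<Longrightarrow> T 0 t = (\<Sum>i<5. T i 0 / fact i * t ^ i) + t ^ 5 * u t"
    by (rule taylor_smooth_remainder[OF T(1), of 5]) (rule that)
  define p where "p t = A / 2 + B / 3 * t + (2 * C + 3 * F) / 24 * t\<^sup>2 + t ^ 3 * u t" for t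
  have jp: "jet2 e p (A / 2) (B / 3) ((2 * C + 3 * F) / 24)"
    by (rule jet2I[OF u(1)]) (simp add: p_def)
  have p: "?d 1 2 t = t\<^sup>2 * p t" if "t \<in> ?I" for t
  proof -
    have "T 0 t = t\<^sup>2 * p t"
      using u(2)[OF that] T0 unfolding p_def by (simp add: eval_nat_numeral algebra_simps)
    then show ?thesis by (simp only: T(2))
  qed
  obtain v where v: "smooth_on ?I v"
    "\<And>t. t \<in> ?I \<Longrightarrow> T (0 + 1) t = (\<Sum>i<4. T (i + 1) 0 / fact i * t ^ i) + t ^ 4 * v t"
    by (rule taylor_smooth_remainder[OF derivative_sequence_shift[OF T(1), of 1], of 4]) (rule that)
  define p1 where "p1 t = A + B * t + (2 * C + 3 * F) / 6 * t\<^sup>2 + t ^ 3 * v t" for t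
  have jp1: "jet2 e p1 A B ((2 * C + 3 * F) / 6)"
    by (rule jet2I[OF v(1)]) (simp add: p1_def)
  have p1: "?d 1 3 t = t * p1 t" if "t \<in> ?I" for t
    using v(2)[OF that] T1[OF that] T0 unfolding p1_def by (simp add: eval_nat_numeral algebra_simps)
  have jp2: "jet2 e (T 2) A (2 * B) ((2 * C + 3 * F) / 2)"
    using derivative_sequence_jet2[OF derivative_sequence_shift[OF T(1), of 2]] T0
    by (simp add: eval_nat_numeral)
  have p0: "p t \<noteq> 0" if "t \<in> ?I" for t
    using p[OF that] d12[OF that] d23 by (cases "t = 0") (auto simp: p_def A_def)
  \<comment> \<open>The cube root of the absolute value of \<open>p\<close>, written so that its smoothness does not depend on the sign of \<open>p\<close>.\<close>
  define q where "q t = ((p t)\<^sup>2) powr (1/6)" for t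
  have q_pos: "q t > 0" if "t \<in> ?I" for t using p0[OF that] by (simp add: q_def)
  have sq: "smooth_on ?I q" unfolding q_def[abs_def]
    by (rule smooth_on_powr_compose[OF I(1) smooth_on_power[OF I(1) jet2_smooth_on[OF jp]]])
      (use p0 in simp)
  have q6: "q t ^ 6 = (p t)\<^sup>2" if "t \<in> ?I" for t
    using p0[OF that] by (simp add: q_def powr_power)
  have q_root: "\<bar>?d 1 2 t\<bar> powr (1/3) = \<bar>t\<bar> powr (2/3) * q t" if "t \<in> ?I" for t
  proof -
    have "(p t)\<^sup>2 powr (1/6) = \<bar>p t\<bar> powr (1/3)"
      using powr_powr[of "\<bar>p t\<bar>" 2 "1/6"] p0[OF that] by simp
    moreover have "(t\<^sup>2) powr (1/3) = \<bar>t\<bar> powr (2/3)"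
      using powr_powr[of "\<bar>t\<bar>" 2 "1/3"] by (cases "t = 0") simp_all
    ultimately show ?thesis unfolding p[OF that] by (simp add: abs_mult powr_mult q_def)
  qed
  obtain q1 q2 where jq: "jet2 e q (q 0) q1 q2" using smooth_on_jet2[OF sq] .
  obtain r where r: "smooth_on ?I r"
    "\<And>t. t \<in> ?I \<Longrightarrow> ((\<lambda>t. t * \<bar>t\<bar> powr (5/3 - 1) * r t) has_vector_derivative \<bar>t\<bar> powr (5/3 - 1) * q t) (at t)"
    "\<And>t. t \<in> ?I \<Longrightarrow> \<exists>d. (r has_vector_derivative d) (at t) \<and> 5/3 * r t + t * d = q t"
    "\<And>t. t \<in> ?I \<Longrightarrow> r t > 0"
    by (rule smooth_on_homogeneous_primitive[OF e sq q_pos, of "5/3"], assumption, simp, rule that)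
  have arc: "affine_arclength \<gamma> t = t * \<bar>t\<bar> powr (2/3) * r t" if "t \<in> ?I" for t
    by (rule affine_arclength_eq[OF smooth_on_continuous_on[OF sq] q_root _ _ that]) (use r(2) in auto)
  obtain r1 r2 where jr: "jet2 e r (r 0) r1 r2" using smooth_on_jet2[OF r(1)] .
  have r012: "r 0 = 3/5 * q 0" "r1 = 3/8 * q1" "r2 = 3/11 * q2"
  proof -
    obtain w where w: "smooth_on ?I w" "\<And>t. t \<in> ?I \<Longrightarrow> r t = r 0 + r1 * t + r2 * t\<^sup>2 + t ^ 3 * w t"
      using jr unfolding jet2_def by blast
    obtain w' where w': "smooth_on ?I w'" "\<And>t. t \<in> ?I \<Longrightarrow> (w has_vector_derivative w' t) (at t)"
      using smooth_on_derivativeE[OF I(1) w(1)] by blast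
    have "q t = 5/3 * r 0 + 8/3 * r1 * t + 11/3 * r2 * t\<^sup>2 + t ^ 3 * (14/3 * w t + t * w' t)"
      if t: "t \<in> ?I" for t
    proof -
      obtain d where d: "(r has_real_derivative d) (at t)" "5/3 * r t + t * d = q t"
        using r(3)[OF t] by (auto simp: has_real_derivative_iff_has_vector_derivative)
      have "(w has_real_derivative w' t) (at t)"
        using w'(2)[OF t] by (simp add: has_real_derivative_iff_has_vector_derivative)
      then have "((\<lambda>t. r 0 + r1 * t + r2 * t\<^sup>2 + t ^ 3 * w t) has_real_derivative
          r1 + 2 * r2 * t + (3 * t\<^sup>2 * w t + t ^ 3 * w' t)) (at t)"
        by (auto intro!: derivative_eq_intros simp: algebra_simps)
      moreover have "((\<lambda>t. r 0 + r1 * t + r2 * t\<^sup>2 + t ^ 3 * w t) has_real_derivative d) (at t)"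
        using has_field_derivative_transform_within_open[OF d(1) I(1) t w(2)] by blast
      ultimately have "d = r1 + 2 * r2 * t + (3 * t\<^sup>2 * w t + t ^ 3 * w' t)" using DERIV_unique by blast
      then show ?thesis using d(2) w(2)[OF t]
        by (simp add: field_simps power2_eq_square power3_eq_cube)
    qed
    moreover have "smooth_on ?I (\<lambda>t. 14/3 * w t + t * w' t)"
      by (intro smooth_intros w w' I)
    ultimately have "jet2 e q (5/3 * r 0) (8/3 * r1) (11/3 * r2)" by (intro jet2I) auto
    from jet2_unique[OF e this jq] show "r 0 = 3/5 * q 0" "r1 = 3/8 * q1" "r2 = 3/11 * q2" by auto
  qed
  define M where "M t = 3 * (p t * (1 * T 2 t + 3 * ?d 2 3 t)) + (-5) * (p1 t * p1 t)" for t
  note jM = jet2_lincomb[OF jet2_mult[OF jp jet2_lincomb[OF jp2 jE, of 1 3]] jet2_mult[OF jp1 jp1],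
    of 3 "-5", folded M_def[abs_def]]
  define f where "f t = (r t * r t) * M t / (9 * q t ^ 8)" for t
  have "9 * q t ^ 8 \<noteq> 0" if "t \<in> ?I" for t using q_pos[OF that] by simp
  then have sf: "smooth_on ?I f" unfolding f_def[abs_def]
    by (intro smooth_on_divide smooth_on_mult smooth_on_power smooth_on_const jet2_smooth_on[OF jM] r sq I)
  obtain f1 f2 where jf: "jet2 e f (f 0) f1 f2" using smooth_on_jet2[OF sf] .
  note jq2 = jet2_mult[OF jq jq]
  note jq4 = jet2_mult[OF jq2 jq2]
  note jq8 = jet2_mult[OF jq4 jq4]
  note jr2 = jet2_mult[OF jr jr]
  have fq: "f t * (q t * q t * (q t * q t) * (q t * q t * (q t * q t))) * 9 = (r t * r t) * M t" if "t \<in> ?I" for t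
    using q_pos[OF that] by (simp add: f_def field_simps eval_nat_numeral)
  define M0 where "M0 = 3 * (A/2 * (4 * A)) - 5 * (A * A)"
  define M1 where "M1 = 3 * (A/2 * (5 * B) + B/3 * (4 * A)) - 5 * (A * B + B * A)"
  define M2 where "M2 = 3 * (A/2 * ((2 * C + 3 * F) / 2 + 3 * ((C + F) / 2)) + B/3 * (5 * B)
          + (2 * C + 3 * F) / 24 * (4 * A)) - 5 * (A * ((2 * C + 3 * F) / 6) + B * B + (2 * C + 3 * F) / 6 * A)"
  have jM': "jet2 e M M0 M1 M2"
    by (rule jet2_cong[OF jM]) (simp_all add: M0_def M1_def M2_def)
  have eqs: "f 0 * (9 * q 0 ^ 8) = (r 0)\<^sup>2 * M0"
    "f 0 * (9 * (8 * q 0 ^ 7 * q1)) + f1 * (9 * q 0 ^ 8) = (r 0)\<^sup>2 * M1 + 2 * r 0 * r1 * M0"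
    "f 0 * (9 * (8 * q 0 ^ 7 * q2 + 28 * q 0 ^ 6 * q1\<^sup>2)) + f1 * (9 * (8 * q 0 ^ 7 * q1)) + f2 * (9 * q 0 ^ 8)
        = (r 0)\<^sup>2 * M2 + 2 * r 0 * r1 * M1 + (2 * r 0 * r2 + r1\<^sup>2) * M0"
    using jet2_unique[OF e jet2_lincomb[OF jet2_mult[OF jf jq8] jq8, of 9 0] jet2_mult[OF jr2 jM']] fq
    by (simp_all add: eval_nat_numeral algebra_simps)
  note jq3 = jet2_mult[OF jq jet2_mult[OF jq jq]]
  have "(q 0 ^ 3) * (q 0 ^ 3) = A / 2 * (A / 2)"
    and m1: "q 0 ^ 3 * (3 * (q 0)\<^sup>2 * q1) = A / 2 * (B / 3)"
    and m2: "2 * (q 0 ^ 3 * (3 * (q 0)\<^sup>2 * q2 + 3 * q 0 * q1\<^sup>2)) + (3 * (q 0)\<^sup>2 * q1)\<^sup>2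
      = 2 * (A / 2 * ((2 * C + 3 * F) / 24)) + (B / 3)\<^sup>2"
    using jet2_unique[OF e jet2_mult[OF jq3 jq3] jet2_mult[OF jp jp]] q6
    by (simp_all add: eval_nat_numeral algebra_simps)
  note m0 = this(1)
  have q0: "q 0 > 0" using q_pos I(2) by blast
  then have q3: "q 0 ^ 3 \<noteq> 0" by simp
  \<comment> \<open>The sign of \<open>p\<close>; from \<open>q ^ 6 = p\<^sup>2\<close> the jets of \<open>q ^ 3\<close> and \<open>p\<close> agree up to \<open>s\<close>.\<close>
  define s where "s = (A / 2) / q 0 ^ 3"
  have s0: "A / 2 = s * q 0 ^ 3" using q0 by (simp add: s_def)
  have ss: "s * s = 1"
  proof -
    have "(q 0 ^ 3 * q 0 ^ 3) * (s * s - 1) = 0" using m0 unfolding s0 by algebra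
    then show ?thesis using q0 by simp
  qed
  have s1: "B / 3 = s * (3 * (q 0)\<^sup>2 * q1)"
  proof -
    have "q 0 ^ 3 * (3 * (q 0)\<^sup>2 * q1) = q 0 ^ 3 * (s * (B / 3))"
      using m1 unfolding s0 by (simp only: mult.assoc mult.left_commute)
    then have "3 * (q 0)\<^sup>2 * q1 = s * (B / 3)" using mult_left_cancel[OF q3] by blast
    then have "s * (3 * (q 0)\<^sup>2 * q1) = (s * s) * (B / 3)" by simp
    then show ?thesis by (simp add: ss)
  qed
  have s2: "(2 * C + 3 * F) / 24 = s * (3 * (q 0)\<^sup>2 * q2 + 3 * q 0 * q1\<^sup>2)"
  proof -
    have "(B / 3)\<^sup>2 = (s * s) * (3 * (q 0)\<^sup>2 * q1)\<^sup>2" unfolding s1 by (simp add: power_mult_distrib power2_eq_square)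
    then have "q 0 ^ 3 * (3 * (q 0)\<^sup>2 * q2 + 3 * q 0 * q1\<^sup>2) = A / 2 * ((2 * C + 3 * F) / 24)"
      using m2 unfolding ss by linarith
    then have "q 0 ^ 3 * (3 * (q 0)\<^sup>2 * q2 + 3 * q 0 * q1\<^sup>2) = q 0 ^ 3 * (s * ((2 * C + 3 * F) / 24))"
      unfolding s0 by (simp only: mult.assoc mult.left_commute)
    then have "3 * (q 0)\<^sup>2 * q2 + 3 * q 0 * q1\<^sup>2 = s * ((2 * C + 3 * F) / 24)"
      using mult_left_cancel[OF q3] by blast
    then have "s * (3 * (q 0)\<^sup>2 * q2 + 3 * q 0 * q1\<^sup>2) = (s * s) * ((2 * C + 3 * F) / 24)" by simp
    then show ?thesis by (simp add: ss)
  qed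
  note alg = normalized_curvature_jet_algebra[OF q0 ss s0 s1 s2 M0_def M1_def M2_def r012 eqs]
  have "\<bar>A\<bar> = 2 * q 0 ^ 3"
  proof -
    have "\<bar>s\<bar> = 1" using ss by (metis abs_mult_self_eq abs_of_nonneg abs_square_eq_1 mult_1 power2_eq_square)
    moreover have "A = 2 * s * q 0 ^ 3" using s0 by simp
    ultimately show ?thesis using q0 by (simp add: abs_mult)
  qed
  have curv: "(affine_arclength \<gamma> t)\<^sup>2 * affine_curvature \<gamma> t = f t" if t: "t \<in> ?I" "t \<noteq> 0" for t
  proof -
    define z where "z = \<bar>t\<bar> powr (2/3)"
    have z: "z > 0" "z ^ 3 = t\<^sup>2" using t(2) by (simp_all add: z_def powr_power)
    have "?d 1 2 t \<noteq> 0" using d12[OF t] .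
    then have "\<bar>?d 1 2 t\<bar> powr (8/3) = (\<bar>?d 1 2 t\<bar> powr (1/3)) ^ 8" by (simp add: powr_power)
    also have "\<dots> = (z * q t) ^ 8" unfolding q_root[OF t(1)] z_def ..
    finally have den: "\<bar>?d 1 2 t\<bar> powr (8/3) = z ^ 8 * q t ^ 8" by (simp add: power_mult_distrib)
    have num: "3 * ?d 1 2 t * ?d 1 4 t + 12 * ?d 1 2 t * ?d 2 3 t - 5 * (?d 1 3 t)\<^sup>2 = t\<^sup>2 * M t"
      unfolding p[OF t(1)] p1[OF t(1)] M_def T2[OF t(1)] by (simp add: algebra_simps power2_eq_square)
    have "(t * z * r t)\<^sup>2 * (t\<^sup>2 * M t) = (z ^ 8 * (r t * r t)) * M t"
    proof -
      have "(t * z * r t)\<^sup>2 * (t\<^sup>2 * M t) = (t\<^sup>2 * t\<^sup>2) * (z\<^sup>2 * (r t * r t)) * M t"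
        by (simp add: power2_eq_square)
      also have "t\<^sup>2 * t\<^sup>2 = z ^ 6" unfolding z(2)[symmetric] by (simp flip: power_add)
      finally show ?thesis by (simp flip: power_add mult.assoc)
    qed
    then have "(t * z * r t)\<^sup>2 * ((t\<^sup>2 * M t) / (9 * (z ^ 8 * q t ^ 8))) = (z ^ 8 * (r t * r t)) * M t / (9 * (z ^ 8 * q t ^ 8))"
      by (simp only: times_divide_eq_right)
    also have "\<dots> = f t" using z(1) by (simp add: f_def)
    finally show ?thesis unfolding affine_curvature_def num den arc[OF t(1)] z_def .
  qed
  show ?thesis
  proof (rule that[OF r(1) r(4) arc curv _ q0 r012(1)])
    show "jet2 e f (4/25) 0 f2" using jf alg(1,2) by simp
    show "\<bar>?d 2 3 0\<bar> = 2 * q 0 ^ 3" using \<open>\<bar>A\<bar> = _\<close> by (simp add: A_def)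
    show "f2 * (4400 * q 0 ^ 6) = 3 * (24 * ?d 2 3 0 * ?d 2 5 0 + 60 * ?d 2 3 0 * ?d 3 4 0 - 35 * (?d 2 4 0)\<^sup>2)"
      using alg(3) by (simp add: A_def B_def C_def F_def)
  qed
qed

section \<open>Curves with prescribed normalized affine curvature\<close>

lemma smooth_on_antiderivative_exists:
  fixes g :: "real \<Rightarrow> real"
  assumes "e > 0" and g: "smooth_on {-e<..<e} g"
  obtains G where "smooth_on {-e<..<e} G" "G 0 = 0"
    and "\<And>t. t \<in> {-e<..<e} \<Longrightarrow> (G has_vector_derivative g t) (at t)"
proof -
  define G where "G t = (LBINT s=0..ereal t. g s)" for t
  have d: "(G has_vector_derivative g t) (at t)" if t: "t \<in> {-e<..<e}" for t
  proof -
    define b where "b = (\<bar>t\<bar> + e) / 2"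
    have b: "\<bar>t\<bar> < b" "b < e" using t by (auto simp: b_def)
    have "((\<lambda>t. LBINT s=ereal 0..ereal t. g s) has_vector_derivative g t) (at t within {-b..b})"
      by (rule interval_integral_FTC2[OF _ _ continuous_on_subset[OF smooth_on_continuous_on[OF g]]])
        (use b in auto)
    moreover have "t \<in> interior {-b..b}" using b(1) by auto
    ultimately show ?thesis
      using at_within_interior[of t "{-b..b}"] by (simp add: G_def[abs_def] zero_ereal_def)
  qed
  show ?thesis
    by (rule that[OF smooth_on_antiderivative[OF _ d g] _ d]) (auto simp: G_def zero_ereal_def[symmetric])
qed

lemma vector_2_has_vector_derivative:
  assumes "(f has_vector_derivative f') (at t)" "(g has_vector_derivative g') (at t)"
  shows "((\<lambda>t. vector [f t, g t] :: real^2) has_vector_derivative vector [f', g']) (at t)"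
proof -
  have "((\<lambda>t. f t *\<^sub>R axis 1 1 + g t *\<^sub>R axis 2 1 :: real^2) has_vector_derivative
      (f' *\<^sub>R axis 1 1 + f t *\<^sub>R 0) + (g' *\<^sub>R axis 2 1 + g t *\<^sub>R 0)) (at t)"
    by (intro has_vector_derivative_add has_vector_derivative_real_scaleR assms has_vector_derivative_const)
  then show ?thesis by (simp add: vector_2_eq)
qed

text \<open>
  With \<open>\<gamma>' = t w\<close> one has \<open>[\<gamma>', \<gamma>''] = t\<^sup>2 [w, w']\<close>, and the arclength of the desired curve forces the value
  \<open>c = (5/3)\<^sup>3\<close> of the Wronskian. The bracket of the second and third derivative is then
  \<open>c (2 + t\<^sup>2 h)\<close>, and solving the formula of the affine curvature for \<open>h\<close> gives
  \<open>h = (25/9) (f - 4/25) / t\<^sup>2\<close>.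
\<close>

theorem prescribed_normalized_curvature:
  fixes f :: "real \<Rightarrow> real"
  assumes \<delta>: "\<delta> > 0" and f: "smooth_on {-\<delta><..<\<delta>} f" and f0: "f 0 = 4/25" "deriv f 0 = 0"
  obtains \<epsilon> \<gamma> where "\<epsilon> \<le> \<delta>" "cuspidal_curve \<epsilon> \<gamma>"
    and "\<And>t. t \<in> {-\<epsilon><..<\<epsilon>} \<Longrightarrow> arclength_3_5 \<gamma> t = t"
    and "\<And>t. t \<in> {-\<epsilon><..<\<epsilon>} \<Longrightarrow> normalized_affine_curvature \<gamma> t = f t"
proof -
  define c :: real where "c = 125/27"
  obtain T where T: "derivative_sequence {-\<delta><..<\<delta>} T" "T 0 = f"
    using smooth_on_derivative_sequence[OF _ f] by auto
  have "(f has_real_derivative T 1 0) (at 0)"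
    using derivative_sequenceD[OF T(1), of 0 0] at_within_open[of 0 "{-\<delta><..<\<delta>}"] \<delta>
    by (simp add: T(2))
  then have "T 1 0 = 0" using f0(2) DERIV_imp_deriv by fastforce
  obtain g where g: "smooth_on {-\<delta><..<\<delta>} g"
    "\<And>t. t \<in> {-\<delta><..<\<delta>} \<Longrightarrow> T 0 t = (\<Sum>i<2. T i 0 / fact i * t ^ i) + t ^ 2 * g t"
    by (rule taylor_smooth_remainder[OF T(1), of 2]) (rule that)
  have fg: "f t = 4/25 + t\<^sup>2 * g t" if "t \<in> {-\<delta><..<\<delta>}" for t
  proof -
    have "T 0 t = T 0 0 + t\<^sup>2 * g t"
      using g(2)[OF that] \<open>T 1 0 = 0\<close> by (simp add: numeral_2_eq_2)
    then show ?thesis by (simp add: T(2) f0)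
  qed
  define h where "h t = 25/9 * g t" for t
  have "smooth_on {-\<delta><..<\<delta>} h"
    unfolding h_def[abs_def] by (intro smooth_intros g) auto
  from linear_ode_solutions_smooth[OF \<delta> this] obtain \<epsilon> where \<epsilon>: "0 < \<epsilon>" "\<epsilon> \<le> \<delta>"
    and ode: "\<And>a b. \<exists>w w'. w 0 = a \<and> w' 0 = b \<and> smooth_on {-\<epsilon><..<\<epsilon>} w \<and> smooth_on {-\<epsilon><..<\<epsilon>} w' \<and>
       (\<forall>t\<in>{-\<epsilon><..<\<epsilon>}. (w has_real_derivative w' t) (at t) \<and> (w' has_real_derivative - h t * w t) (at t))"
    by (metis (no_types, lifting))
  let ?I = "{-\<epsilon><..<\<epsilon>}"
  have I: "open ?I" "0 \<in> ?I" "\<And>t. t \<in> ?I \<Longrightarrow> t \<in> {-\<delta><..<\<delta>}" using \<epsilon> by auto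
  obtain x x' where x: "x 0 = 1" "x' 0 = 0" "smooth_on ?I x" "smooth_on ?I x'"
    "\<And>t. t \<in> ?I \<Longrightarrow> (x has_real_derivative x' t) (at t)"
    "\<And>t. t \<in> ?I \<Longrightarrow> (x' has_real_derivative - h t * x t) (at t)" using ode[of 1 0] by blast
  obtain y y' where y: "y 0 = 0" "y' 0 = c" "smooth_on ?I y" "smooth_on ?I y'"
    "\<And>t. t \<in> ?I \<Longrightarrow> (y has_real_derivative y' t) (at t)"
    "\<And>t. t \<in> ?I \<Longrightarrow> (y' has_real_derivative - h t * y t) (at t)" using ode[of 0 c] by blast
  have wronskian: "x t * y' t - y t * x' t = c" if t: "t \<in> ?I" for t
  proof -
    have "((\<lambda>t. x t * y' t - y t * x' t) has_real_derivative 0) (at s within ?I)" if "s \<in> ?I" for s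
    proof -
      have "((\<lambda>t. x t * y' t - y t * x' t) has_real_derivative
          (x s * (- h s * y s) + x' s * y' s) - (y s * (- h s * x s) + y' s * x' s)) (at s)"
        by (rule DERIV_diff[OF DERIV_mult'[OF x(5) y(6)] DERIV_mult'[OF y(5) x(6)]]) (fact that)+
      then show ?thesis by (simp add: algebra_simps has_field_derivative_at_within)
    qed
    from has_field_derivative_zero_constant[OF _ this] obtain k where
      "\<And>t. t \<in> ?I \<Longrightarrow> x t * y' t - y t * x' t = k" by auto
    from this[OF I(2)] this[OF t] show ?thesis by (simp add: x(1,2) y(1,2))
  qed
  have sm: "smooth_on ?I (\<lambda>t. t * x t)" "smooth_on ?I (\<lambda>t. t * y t)"
    by (intro smooth_intros x y I)+
  obtain X where X: "smooth_on ?I X" "X 0 = 0" "\<And>t. t \<in> ?I \<Longrightarrow> (X has_vector_derivative t * x t) (at t)"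
    by (rule smooth_on_antiderivative_exists[OF \<epsilon>(1) sm(1)]) (rule that)
  obtain Y where Y: "smooth_on ?I Y" "Y 0 = 0" "\<And>t. t \<in> ?I \<Longrightarrow> (Y has_vector_derivative t * y t) (at t)"
    by (rule smooth_on_antiderivative_exists[OF \<epsilon>(1) sm(2)]) (rule that)
  define \<gamma> :: "real \<Rightarrow> real^2" where "\<gamma> t = vector [X t, Y t]" for t
  have s\<gamma>: "smooth_on ?I \<gamma>" unfolding \<gamma>_def[abs_def] by (rule smooth_on_vector_2[OF I(1) X(1) Y(1)])
  note nd = nderiv_SucI[OF I(1)]
  have n1: "nderiv 1 \<gamma> t = vector [t * x t, t * y t]" if "t \<in> ?I" for t
    using nd[of t 0 \<gamma> \<gamma>] vector_2_has_vector_derivative[OF X(3)[OF that] Y(3)[OF that]] that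
    by (simp add: nderiv_0 \<gamma>_def[abs_def])
  have d1: "((\<lambda>t. t * z t) has_vector_derivative z t + t * z' t) (at t)"
    if "(z has_real_derivative z' t) (at t)" for z z' :: "real \<Rightarrow> real" and t
    using DERIV_mult'[OF DERIV_ident that]
    by (simp add: has_real_derivative_iff_has_vector_derivative add.commute)
  have n2: "nderiv 2 \<gamma> t = vector [x t + t * x' t, y t + t * y' t]" if "t \<in> ?I" for t
    using nd[OF that n1 vector_2_has_vector_derivative[OF d1[of x x'] d1[of y y']]] x(5) y(5) that
    by (simp add: numeral_2_eq_2)
  have d2: "((\<lambda>t. z t + t * z' t) has_vector_derivative 2 * z' t + t * (- h t * z t)) (at t)"
    if "(z has_real_derivative z' t) (at t)" "(z' has_real_derivative - h t * z t) (at t)"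
    for z z' :: "real \<Rightarrow> real" and t
    using DERIV_add[OF that(1) DERIV_mult'[OF DERIV_ident that(2)]]
    by (simp add: has_real_derivative_iff_has_vector_derivative algebra_simps)
  have n3: "nderiv 3 \<gamma> t = vector [2 * x' t + t * (- h t * x t), 2 * y' t + t * (- h t * y t)]"
    if "t \<in> ?I" for t
    using nd[OF that n2 vector_2_has_vector_derivative[OF d2[of x x'] d2[of y y']]] x(5,6) y(5,6) that
    by (simp add: numeral_3_eq_3)
  let ?d = "dbracket \<gamma>"
  have d12: "?d 1 2 t = c * t\<^sup>2" if "t \<in> ?I" for t
  proof -
    have "?d 1 2 t = t\<^sup>2 * (x t * y' t - y t * x' t)"
      unfolding dbracket_def n1[OF that] n2[OF that]
      by (simp add: bracket_def algebra_simps power2_eq_square)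
    then show ?thesis by (simp add: wronskian[OF that])
  qed
  have d23: "?d 2 3 t = c * (2 + t\<^sup>2 * h t)" if "t \<in> ?I" for t
  proof -
    have "?d 2 3 t = (2 + t\<^sup>2 * h t) * (x t * y' t - y t * x' t)"
      unfolding dbracket_def n2[OF that] n3[OF that]
      by (simp add: bracket_def algebra_simps power2_eq_square)
    then show ?thesis by (simp add: wronskian[OF that])
  qed
  have self: "?d i i t = 0" for i t by (simp add: dbracket_def bracket_self)
  have d13: "?d 1 3 t = 2 * c * t" if t: "t \<in> ?I" for t
  proof -
    have "(?d 1 2 has_real_derivative ?d 1 3 t) (at t)"
      using dbracket_has_derivative[OF I(1) s\<gamma> t, of 1 2] by (simp add: self del: One_nat_def)
    from has_field_derivative_transform_within_open[OF this I(1) t d12]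
    have "((\<lambda>t. c * t\<^sup>2) has_real_derivative ?d 1 3 t) (at t)" .
    moreover have "((\<lambda>t. c * t\<^sup>2) has_real_derivative 2 * c * t) (at t)"
      by (auto intro!: derivative_eq_intros)
    ultimately show ?thesis using DERIV_unique by blast
  qed
  have d14: "?d 1 4 t = 2 * c - ?d 2 3 t" if t: "t \<in> ?I" for t
  proof -
    have "(?d 1 3 has_real_derivative ?d 2 3 t + ?d 1 4 t) (at t)"
      using dbracket_has_derivative[OF I(1) s\<gamma> t, of 1 3] by (simp del: One_nat_def)
    from has_field_derivative_transform_within_open[OF this I(1) t d13]
    have "((\<lambda>t. 2 * c * t) has_real_derivative ?d 2 3 t + ?d 1 4 t) (at t)" .
    moreover have "((\<lambda>t. 2 * c * t) has_real_derivative 2 * c) (at t)"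
      by (auto intro!: derivative_eq_intros)
    ultimately have "?d 2 3 t + ?d 1 4 t = 2 * c" using DERIV_unique by blast
    then show ?thesis by linarith
  qed
  have d12_nonzero: "?d 1 2 t \<noteq> 0" if "t \<in> ?I" "t \<noteq> 0" for t
    unfolding d12[OF that(1)] using that(2) by (simp add: c_def)
  have c13: "c powr (1/3) = 5/3"
  proof -
    have cc: "c = (5/3) powr real 3"
      by (subst powr_realpow) (simp_all add: c_def eval_nat_numeral)
    then show ?thesis unfolding cc powr_powr by simp
  qed
  have root: "\<bar>?d 1 2 t\<bar> powr (1/3) = \<bar>t\<bar> powr (2/3) * (5/3)" if "t \<in> ?I" for t
  proof -
    have "(t\<^sup>2) powr (1/3) = \<bar>t\<bar> powr (2/3)"
      using powr_powr[of "\<bar>t\<bar>" 2 "1/3"] by (cases "t = 0") simp_all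
    moreover have "c > 0" by (simp add: c_def)
    ultimately show ?thesis unfolding d12[OF that] using c13 by (simp add: abs_mult powr_mult)
  qed
  have arc: "affine_arclength \<gamma> t = t * \<bar>t\<bar> powr (2/3)" if t: "t \<in> ?I" for t
  proof (rule affine_arclength_eq[OF _ root _ _ t])
    show "((\<lambda>t. t * \<bar>t\<bar> powr (2/3)) has_vector_derivative \<bar>t\<bar> powr (2/3) * (5/3)) (at t)" for t
      using DERIV_signed_powr[of "5/3" t]
      by (simp add: has_real_derivative_iff_has_vector_derivative mult.commute)
  qed auto
  have curv: "(affine_arclength \<gamma> t)\<^sup>2 * affine_curvature \<gamma> t = f t" if t: "t \<in> ?I" "t \<noteq> 0" for t
  proof -
    define z where "z = \<bar>t\<bar> powr (2/3)"
    have z: "z > 0" "z ^ 3 = t\<^sup>2" using t(2) by (simp_all add: z_def powr_power)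
    have "\<bar>?d 1 2 t\<bar> powr (8/3) = (\<bar>?d 1 2 t\<bar> powr (1/3)) ^ 8"
      using d12_nonzero[OF t] by (simp add: powr_power)
    also have "\<dots> = (z * (5/3)) ^ 8" unfolding root[OF t(1)] z_def ..
    finally have den: "\<bar>?d 1 2 t\<bar> powr (8/3) = z ^ 8 * (5/3) ^ 8" by (simp only: power_mult_distrib)
    have num: "3 * ?d 1 2 t * ?d 1 4 t + 12 * ?d 1 2 t * ?d 2 3 t - 5 * (?d 1 3 t)\<^sup>2
        = 25 * c\<^sup>2 * (t\<^sup>2 * f t)"
      unfolding d12[OF t(1)] d13[OF t(1)] d14[OF t(1)] d23[OF t(1)] fg[OF I(3)[OF t(1)]] h_def
      by (simp add: algebra_simps power2_eq_square)
    have "(t * z)\<^sup>2 * (25 * c\<^sup>2 * (t\<^sup>2 * f t)) = 25 * c\<^sup>2 * (z ^ 8) * f t"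
    proof -
      have "(t * z)\<^sup>2 * (25 * c\<^sup>2 * (t\<^sup>2 * f t)) = 25 * c\<^sup>2 * ((t\<^sup>2 * t\<^sup>2) * z\<^sup>2) * f t"
        by (simp add: power2_eq_square)
      also have "t\<^sup>2 * t\<^sup>2 = z ^ 6" unfolding z(2)[symmetric] by (simp flip: power_add)
      finally show ?thesis by (simp flip: power_add mult.assoc)
    qed
    then have "(t * z)\<^sup>2 * ((25 * c\<^sup>2 * (t\<^sup>2 * f t)) / (9 * (z ^ 8 * (5/3) ^ 8)))
        = 25 * c\<^sup>2 * (z ^ 8) * f t / (9 * (z ^ 8 * (5/3) ^ 8))"
      by (simp only: times_divide_eq_right)
    also have "\<dots> = f t" using z(1) by (simp add: c_def eval_nat_numeral)
    finally show ?thesis unfolding affine_curvature_def num den arc[OF t(1)] z_def .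
  qed
  show ?thesis
  proof (rule that[OF \<epsilon>(2)])
    have "cusp_3_2 \<gamma>"
    proof (rule derivatives_imp_cusp_3_2[OF \<epsilon>(1) s\<gamma>])
      show "nderiv 1 \<gamma> 0 = 0" using n1[OF I(2)] by (simp add: vec_eq_iff forall_2)
      show "bracket (nderiv 2 \<gamma> 0) (nderiv 3 \<gamma> 0) \<noteq> 0"
        using d23[OF I(2)] by (simp add: dbracket_def c_def)
    qed
    then show "cuspidal_curve \<epsilon> \<gamma>"
      unfolding cuspidal_curve_def using \<epsilon>(1) s\<gamma> d12_nonzero by blast
    show "arclength_3_5 \<gamma> t = t" if "t \<in> ?I" for t
      using arclength_3_5_eq[of \<gamma> t 1] arc[OF that] by simp
    show "normalized_affine_curvature \<gamma> t = f t" if t: "t \<in> ?I" for t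
    proof (cases "t = 0")
      case True
      have "isCont f 0" using smooth_on_continuous_on[OF f] \<delta> by (simp add: continuous_on_eq_continuous_at)
      then have "(f \<longlongrightarrow> f 0) (at 0)" by (simp add: isCont_def)
      moreover have "\<forall>\<^sub>F u in at 0. f u = (affine_arclength \<gamma> u)\<^sup>2 * affine_curvature \<gamma> u"
        using eventually_at_in_open[OF I(1,2)] by eventually_elim (use curv in auto)
      ultimately have "((\<lambda>u. (affine_arclength \<gamma> u)\<^sup>2 * affine_curvature \<gamma> u) \<longlongrightarrow> f 0) (at 0)"
        by (rule Lim_transform_eventually)
      then show ?thesis using True by (simp add: normalized_affine_curvature_def tendsto_Lim)
    qed (use curv t in \<open>simp add: normalized_affine_curvature_def\<close>)
  qed
qed

section \<open>Normalized affine curvature and cuspidal curvature\<close>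

text \<open>
  The limit is the quotient of \<open>c\<close> by \<open>r(0) powr (6/5)\<close>, where \<open>c\<close> is the quadratic coefficient of
  the normalized curvature and \<open>r(0) = 3 q0 / 5\<close>; the cuspidal curvature is divided by a power of \<open>\<bar>[\<gamma>'', \<gamma>''']\<bar> = 2 q0\<^sup>3\<close>. This identity
  converts one normalization into the other.
\<close>

lemma cuspidal_limit_constant:
  fixes q0 :: real
  assumes "q0 > 0"
  shows "3 / (4400 * q0 ^ 6) / ((3/5 * q0) powr (3/5))\<^sup>2
    = 1/220 * root 5 (20/3) / (2 * q0 ^ 3) powr (12/5)"
proof -
  have "((3/5 * q0) powr (3/5))\<^sup>2 = (3/5 * q0) powr (6/5)"
    using assms by (simp add: powr_power)
  also have "\<dots> = (3/5) powr (6/5) * q0 powr (6/5)" by (rule powr_mult)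
  also have "(3/5::real) powr (6/5) = 3/5 * (3/5) powr (1/5)"
    using powr_add[of "3/5::real" 1 "1/5"] by simp
  finally have l: "((3/5 * q0) powr (3/5))\<^sup>2 = 3/5 * (3/5) powr (1/5) * q0 powr (6/5)" .
  have "(2 * q0 ^ 3) powr (12/5) = 2 powr (12/5) * (q0 powr real 3) powr (12/5)"
    using assms by (simp only: powr_mult powr_realpow)
  also have "\<dots> = 2 powr (12/5) * q0 powr (36/5)" unfolding powr_powr by simp
  also have "(2::real) powr (12/5) = 4 * 4 powr (1/5)"
  proof -
    have four: "(2::real) powr 2 = 4" by simp
    have "(2::real) powr (12/5) = 2 powr (2 + 2/5)" by simp
    also have "\<dots> = 2 powr 2 * 2 powr (2 * (1/5))" unfolding powr_add by simp
    finally show ?thesis unfolding powr_powr[symmetric] four .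
  qed
  also have "q0 powr (36/5) = q0 ^ 6 * q0 powr (6/5)"
    using assms powr_add[of q0 6 "6/5"] by simp
  finally have r: "(2 * q0 ^ 3) powr (12/5) = 4 * 4 powr (1/5) * (q0 ^ 6 * q0 powr (6/5))" .
  have "root 5 (20/3::real) = (20/3) powr (1/5)" by (simp add: root_powr_inverse)
  also have "(20/3::real) powr (1/5) = (4 / (3/5)) powr (1/5)" by simp
  also have "\<dots> = 4 powr (1/5) / (3/5) powr (1/5)" by (rule powr_divide)
  finally have root: "root 5 (20/3::real) = 4 powr (1/5) / (3/5) powr (1/5)" .
  show ?thesis unfolding l r root using assms by (simp add: field_simps)
qed

text \<open>
  The \<open>3/5\<close>-arclength is \<open>t \<rho>(t)\<close> with \<open>\<rho> = r powr (3/5)\<close> smooth and positive, so it is a coordinate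
  near \<open>0\<close>; the limit is the quadratic coefficient of the normalized curvature divided by \<open>\<rho>(0)\<^sup>2\<close>.
\<close>

theorem cuspidal_curve_normalized_curvature:
  assumes "cuspidal_curve \<epsilon> \<gamma>"
  shows "\<exists>U V \<sigma>. 0 \<in> U \<and> U \<subseteq> {-\<epsilon><..<\<epsilon>} \<and>
               diffeomorphism U V (arclength_3_5 \<gamma>) \<sigma> \<and>
               smooth_on U (normalized_affine_curvature \<gamma>) \<and>
               smooth_on V (normalized_affine_curvature \<gamma> \<circ> \<sigma>) \<and>
               deriv (normalized_affine_curvature \<gamma> \<circ> \<sigma>) 0 = 0"
    and "normalized_affine_curvature \<gamma> 0 = 4/25"
    and "deriv (normalized_affine_curvature \<gamma>) 0 = 0"
    and "((\<lambda>t. ((affine_arclength \<gamma> t)^2 * affine_curvature \<gamma> t - 4/25) / (arclength_3_5 \<gamma> t)^2)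
               \<longlongrightarrow> 1/220 * root 5 (20/3) * affine_cuspidal_curvature \<gamma>) (at 0)"
proof -
  let ?I = "{-\<epsilon><..<\<epsilon>}" and ?N = "normalized_affine_curvature \<gamma>" and ?\<tau> = "arclength_3_5 \<gamma>"
  have \<epsilon>: "\<epsilon> > 0" and \<gamma>: "smooth_on ?I \<gamma>" and cusp: "cusp_3_2 \<gamma>"
    and nz: "\<And>t. t \<in> ?I \<Longrightarrow> t \<noteq> 0 \<Longrightarrow> dbracket \<gamma> 1 2 t \<noteq> 0"
    using assms by (auto simp: cuspidal_curve_def)
  have I: "open ?I" "0 \<in> ?I" using \<epsilon> by auto
  note d = cusp_3_2_imp_derivatives[OF \<epsilon> \<gamma> cusp]
  have d23: "dbracket \<gamma> 2 3 0 \<noteq> 0" using d(2) by (simp add: dbracket_def)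
  obtain r f c q0 where r: "smooth_on ?I r" "\<And>t. t \<in> ?I \<Longrightarrow> r t > 0"
    and arc: "\<And>t. t \<in> ?I \<Longrightarrow> affine_arclength \<gamma> t = t * \<bar>t\<bar> powr (2/3) * r t"
    and curv: "\<And>t. t \<in> ?I \<Longrightarrow> t \<noteq> 0 \<Longrightarrow> (affine_arclength \<gamma> t)\<^sup>2 * affine_curvature \<gamma> t = f t"
    and f: "jet2 \<epsilon> f (4/25) 0 c" and q0: "q0 > 0" "r 0 = 3/5 * q0" "\<bar>dbracket \<gamma> 2 3 0\<bar> = 2 * q0 ^ 3"
    and c: "c * (4400 * q0 ^ 6) = 3 * (24 * dbracket \<gamma> 2 3 0 * dbracket \<gamma> 2 5 0
      + 60 * dbracket \<gamma> 2 3 0 * dbracket \<gamma> 3 4 0 - 35 * (dbracket \<gamma> 2 4 0)\<^sup>2)"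
    by (rule normalized_curvature_expansion[OF \<epsilon> \<gamma> d(1) d23 nz], assumption, assumption, rule that)
  have sf: "smooth_on ?I f" using f by (rule jet2_smooth_on)
  obtain g where g: "smooth_on ?I g" "\<And>t. t \<in> ?I \<Longrightarrow> f t = 4/25 + 0 * t + c * t\<^sup>2 + t ^ 3 * g t"
    using f unfolding jet2_def by blast
  have N: "?N t = f t" if t: "t \<in> ?I" for t
  proof (cases "t = 0")
    case True
    have "isCont f 0" using smooth_on_continuous_on[OF sf] \<epsilon> by (simp add: continuous_on_eq_continuous_at)
    then have "(f \<longlongrightarrow> f 0) (at 0)" by (simp add: isCont_def)
    moreover have "\<forall>\<^sub>F u in at 0. f u = (affine_arclength \<gamma> u)\<^sup>2 * affine_curvature \<gamma> u"
      using eventually_at_in_open[OF I] by eventually_elim (use curv in auto)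
    ultimately have "((\<lambda>u. (affine_arclength \<gamma> u)\<^sup>2 * affine_curvature \<gamma> u) \<longlongrightarrow> f 0) (at 0)"
      by (rule Lim_transform_eventually)
    then show ?thesis using True by (simp add: normalized_affine_curvature_def tendsto_Lim)
  qed (use curv t in \<open>simp add: normalized_affine_curvature_def\<close>)
  have sN: "smooth_on ?I ?N" by (rule smooth_on_cong[OF I(1) _ sf]) (simp add: N)
  show "?N 0 = 4/25" using N[OF I(2)] g(2)[OF I(2)] by simp
  have dN: "(?N has_real_derivative 0) (at 0)"
    by (rule has_field_derivative_transform_within_open[OF jet2_derivative[OF \<epsilon> f] I]) (simp add: N)
  then show "deriv ?N 0 = 0" by (rule DERIV_imp_deriv)
  define \<rho> where "\<rho> t = r t powr (3/5)" for t
  have \<rho>: "smooth_on ?I \<rho>" "\<And>t. t \<in> ?I \<Longrightarrow> \<rho> t > 0"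
    unfolding \<rho>_def[abs_def] by (rule smooth_on_powr_compose[OF I(1) r], assumption) (drule r(2), simp)
  have \<tau>: "?\<tau> t = t * \<rho> t" if "t \<in> ?I" for t
    unfolding \<rho>_def by (rule arclength_3_5_eq[OF arc[OF that] r(2)[OF that]])
  have s\<tau>: "smooth_on ?I ?\<tau>"
    by (rule smooth_on_cong[OF I(1) _ smooth_on_mult[OF I(1) smooth_on_id[OF I(1)] \<rho>(1)]]) (simp add: \<tau>)
  obtain \<tau>' where \<tau>': "smooth_on ?I \<tau>'" "\<And>t. t \<in> ?I \<Longrightarrow> (?\<tau> has_vector_derivative \<tau>' t) (at t)"
    using smooth_on_derivativeE[OF I(1) s\<tau>] by blast
  have "\<tau>' 0 = \<rho> 0"
  proof -
    obtain d where "(\<rho> has_real_derivative d) (at 0)"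
      using smooth_on_has_vector_derivative[OF \<rho>(1) I(2)]
      by (auto simp: has_real_derivative_iff_has_vector_derivative)
    from DERIV_mult'[OF DERIV_ident this] have "((\<lambda>t. t * \<rho> t) has_real_derivative \<rho> 0) (at 0)" by simp
    from has_field_derivative_transform_within_open[OF this I] have "(?\<tau> has_real_derivative \<rho> 0) (at 0)"
      using \<tau> by simp
    then show ?thesis
      using \<tau>'(2)[OF I(2)]
      by (metis has_real_derivative_iff_has_vector_derivative vector_derivative_unique_at)
  qed
  then obtain e where e: "0 < e" "e \<le> \<epsilon>" "\<And>t. t \<in> {-e<..<e} \<Longrightarrow> \<tau>' t > 0"
    using shrink_interval[OF \<epsilon> smooth_on_continuous_on[OF \<tau>'(1)]] \<rho>(2)[OF I(2)] by auto
  let ?U = "{-e<..<e}"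
  have U: "?U \<subseteq> ?I" "0 \<in> ?U" using e by auto
  obtain \<sigma> where \<sigma>: "diffeomorphism ?U (?\<tau> ` ?U) ?\<tau> \<sigma>"
    by (rule diffeomorphism_of_pos_derivative[OF smooth_on_subset[OF s\<tau> U(1)] \<tau>'(2)[OF subsetD[OF U(1)]] e(3)],
        assumption, assumption, rule that)
  have h: "homeomorphism ?U (?\<tau> ` ?U) ?\<tau> \<sigma>" "open (?\<tau> ` ?U)" "smooth_on (?\<tau> ` ?U) \<sigma>"
    using \<sigma> by (auto simp: diffeomorphism_def)
  have "?\<tau> 0 = 0" using \<tau>[OF I(2)] by simp
  then have V0: "0 \<in> ?\<tau> ` ?U" "\<sigma> 0 = 0"
    using U(2) homeomorphism_apply1[OF h(1) U(2)] by (force, simp)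
  have sN\<sigma>: "smooth_on (?\<tau> ` ?U) (?N \<circ> \<sigma>)"
    unfolding o_def
    by (rule smooth_on_compose[OF h(2) _ h(3) smooth_on_subset[OF sN U(1)]])
      (use h(1) in \<open>auto simp: homeomorphism_def\<close>)
  have "deriv (?N \<circ> \<sigma>) 0 = 0"
  proof -
    obtain s where "(\<sigma> has_real_derivative s) (at 0)"
      using smooth_on_has_vector_derivative[OF h(3) V0(1)]
      by (auto simp: has_real_derivative_iff_has_vector_derivative)
    from DERIV_chain[of ?N 0 \<sigma> 0, OF _ this] dN have "((?N \<circ> \<sigma>) has_real_derivative 0) (at 0)"
      by (simp add: V0(2))
    then show ?thesis by (rule DERIV_imp_deriv)
  qed
  then show "\<exists>U V \<sigma>. 0 \<in> U \<and> U \<subseteq> ?I \<and> diffeomorphism U V ?\<tau> \<sigma> \<and> smooth_on U ?N \<and>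
      smooth_on V (?N \<circ> \<sigma>) \<and> deriv (?N \<circ> \<sigma>) 0 = 0"
    using U \<sigma> smooth_on_subset[OF sN U(1)] sN\<sigma> by blast
  have lim: "((\<lambda>t. (c + t * g t) / (\<rho> t)\<^sup>2) \<longlongrightarrow> (c + 0 * g 0) / (\<rho> 0)\<^sup>2) (at 0)"
  proof -
    have "isCont g 0" "isCont \<rho> 0"
      using smooth_on_continuous_on[OF g(1)] smooth_on_continuous_on[OF \<rho>(1)] \<epsilon>
      by (simp_all add: continuous_on_eq_continuous_at)
    then show ?thesis using \<rho>(2)[OF I(2)] by (intro tendsto_intros) (auto simp: isCont_def)
  qed
  have ev: "\<forall>\<^sub>F t in at 0. (c + t * g t) / (\<rho> t)\<^sup>2 =
      ((affine_arclength \<gamma> t)^2 * affine_curvature \<gamma> t - 4/25) / (?\<tau> t)^2"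
    using eventually_at_in_open[OF I]
  proof eventually_elim
    case (elim t)
    then have t: "t \<in> ?I" "t \<noteq> 0" by auto
    have "f t - 4/25 = t\<^sup>2 * (c + t * g t)"
      using g(2)[OF t(1)] by (simp add: algebra_simps power2_eq_square power3_eq_cube)
    then show ?case
      unfolding curv[OF t] \<tau>[OF t(1)] using t(2) by (simp add: power_mult_distrib)
  qed
  have limit_value: "(c + 0 * g 0) / (\<rho> 0)\<^sup>2 = 1/220 * root 5 (20/3) * affine_cuspidal_curvature \<gamma>"
  proof -
    define m where "m = 24 * dbracket \<gamma> 2 3 0 * dbracket \<gamma> 2 5 0
      + 60 * dbracket \<gamma> 2 3 0 * dbracket \<gamma> 3 4 0 - 35 * (dbracket \<gamma> 2 4 0)\<^sup>2"
    have "c = m * (3 / (4400 * q0 ^ 6))" using c q0(1) by (simp add: m_def field_simps)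
    then have "(c + 0 * g 0) / (\<rho> 0)\<^sup>2 = m * (3 / (4400 * q0 ^ 6) / ((3/5 * q0) powr (3/5))\<^sup>2)"
      by (simp add: \<rho>_def q0(2))
    also have "\<dots> = 1/220 * root 5 (20/3) * (m / (2 * q0 ^ 3) powr (12/5))"
      unfolding cuspidal_limit_constant[OF q0(1)] by simp
    also have "m / (2 * q0 ^ 3) powr (12/5) = affine_cuspidal_curvature \<gamma>"
      unfolding affine_cuspidal_curvature_def m_def q0(3) ..
    finally show ?thesis .
  qed
  show "((\<lambda>t. ((affine_arclength \<gamma> t)^2 * affine_curvature \<gamma> t - 4/25) / (?\<tau> t)^2)
               \<longlongrightarrow> 1/220 * root 5 (20/3) * affine_cuspidal_curvature \<gamma>) (at 0)"
    using Lim_transform_eventually[OF lim ev] unfolding limit_value .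
qed

theorem theorem1p3:
  shows "(\<forall>(\<epsilon>::real) (\<gamma>::real \<Rightarrow> real^2). cuspidal_curve \<epsilon> \<gamma> \<longrightarrow>
            (\<exists>U V \<sigma>. 0 \<in> U \<and> U \<subseteq> {-\<epsilon><..<\<epsilon>} \<and>
               diffeomorphism U V (arclength_3_5 \<gamma>) \<sigma> \<and>
               smooth_on U (normalized_affine_curvature \<gamma>) \<and>
               smooth_on V (normalized_affine_curvature \<gamma> \<circ> \<sigma>) \<and>
               deriv (normalized_affine_curvature \<gamma> \<circ> \<sigma>) 0 = 0) \<and>
            normalized_affine_curvature \<gamma> 0 = 4/25 \<and>
            deriv (normalized_affine_curvature \<gamma>) 0 = 0 \<and>
            ((\<lambda>t. ((affine_arclength \<gamma> t)^2 * affine_curvature \<gamma> t - 4/25) / (arclength_3_5 \<gamma> t)^2)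
               \<longlongrightarrow> 1/220 * root 5 (20/3) * affine_cuspidal_curvature \<gamma>) (at 0))
       \<and> (\<forall>(\<delta>::real) (f::real \<Rightarrow> real).
            \<delta> > 0 \<and> smooth_on {-\<delta><..<\<delta>} f \<and> f 0 = 4/25 \<and> deriv f 0 = 0 \<longrightarrow>
            (\<exists>\<epsilon> \<gamma>. \<epsilon> \<le> \<delta> \<and> cuspidal_curve \<epsilon> \<gamma> \<and>
               (\<forall>\<tau>\<in>{-\<epsilon><..<\<epsilon>}. arclength_3_5 \<gamma> \<tau> = \<tau> \<and>
                  normalized_affine_curvature \<gamma> \<tau> = f \<tau>)))"
proof (intro conjI allI impI, goal_cases)
  case (1 \<epsilon> \<gamma>)
  then show ?case by (rule cuspidal_curve_normalized_curvature)
next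
  case (2 \<epsilon> \<gamma>)
  then show ?case by (rule cuspidal_curve_normalized_curvature)
next
  case (3 \<epsilon> \<gamma>)
  then show ?case by (rule cuspidal_curve_normalized_curvature)
next
  case (4 \<epsilon> \<gamma>)
  then show ?case by (rule cuspidal_curve_normalized_curvature)
next
  case (5 \<delta> f)
  then obtain \<epsilon> \<gamma> where "\<epsilon> \<le> \<delta>" "cuspidal_curve \<epsilon> \<gamma>"
    "\<And>t. t \<in> {-\<epsilon><..<\<epsilon>} \<Longrightarrow> arclength_3_5 \<gamma> t = t"
    "\<And>t. t \<in> {-\<epsilon><..<\<epsilon>} \<Longrightarrow> normalized_affine_curvature \<gamma> t = f t"
    using prescribed_normalized_curvature[of \<delta> f] by metis
  then show ?case by blast
qed

end
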